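(* Let $G$ be a locally compact second countable group, $\Gamma<G$ a lattice, and $\Lambda<G$ a dense subgroup that contains and commensurates $\Gamma$. Let $(X,\nu)$ be a $G$-space such that the restriction of the action to $\Gamma$ is contractive, and let $(Y,\eta)$ be a $\Lambda$-space such that there exists a $\Gamma$-map $\varphi:(X,\nu)\to(Y,\eta)$. Then the $\Lambda$-action on $(Y,\eta)$ extends measurably to $G$ in such a way that $\varphi$ becomes a $G$-map. More precisely, there exist a $G$-space $(Y',\eta')$, a $G$-map $\varphi':(X,\nu)\to(Y',\eta')$ and a $\Lambda$-isomorphism $\rho:(Y,\eta)\to(Y',\eta')$ such that $\varphi'=\rho\circ\varphi$ almost everywhere.
   Context: All probability measure spaces are standard. For a group $L$, a probability space $(X,\nu)$ is an $L$-space if $L$ acts measurably on (a measure one subset of) $X$ so that $\nu$ is quasi-invariant (its measure class is preserved by every element of $L$). An $L$-map $\varphi:(X,\nu)\to(Y,\eta)$ between $L$-spaces is a measurable map with $\varphi(gx)=g\varphi(x)$ for all $g\in L$ and $\nu$-almost every $x$, and $\varphi_*\nu=\eta$. An $L$-isomorphism is an $L$-map which is an isomorphism of measure spaces (modulo null sets). An $L$-space $(X,\nu)$ is contractive if for every measurable $B\subseteq X$ with $\nu(B)<1$ and every $\epsilon>0$ there is $g\in L$ with $\nu(gB)<\epsilon$. A lattice is a discrete subgroup of finite covolume. $\Lambda$ commensurates $\Gamma$ if $\lambda\Gamma\lambda^{-1}\cap\Gamma$ has finite index in both $\lambda\Gamma\lambda^{-1}$ and $\Gamma$ for all $\lambda\in\Lambda$.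 *)

theory Defs
  imports "HOL-Probability.Probability" "HOL-Algebra.Algebra"
begin

definition borel_of :: "'a topology \<Rightarrow> 'a measure" where
  "borel_of T = sigma (topspace T) {U. openin T U}"

locale lcsc_group = group G for G (structure) and T +
  assumes topspace_eq: "topspace T = carrier G"
    and continuous_mult: "continuous_map (prod_topology T T) T (\<lambda>(g, h). g \<otimes> h)"
    and continuous_inv: "continuous_map T T (\<lambda>g. inv g)"
    and Hausdorff: "Hausdorff_space T"
    and locally_compact: "locally_compact_space T"
    and second_countable: "second_countable T"

text \<open>On a second countable locally compact Hausdorff space a Borel measure that is finite on
  compact sets is automatically regular, so regularity need not be demanded.\<close>

definition left_haar_measure :: "('g, 'm) monoid_scheme \<Rightarrow> 'g topology \<Rightarrow> 'g measure \<Rightarrow> bool" where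
  "left_haar_measure G T \<mu> \<longleftrightarrow>
     space \<mu> = carrier G \<and> sets \<mu> = sets (borel_of T) \<and>
     emeasure \<mu> (carrier G) \<noteq> 0 \<and>
     (\<forall>K. compactin T K \<longrightarrow> emeasure \<mu> K < \<infinity>) \<and>
     (\<forall>g\<in>carrier G. \<forall>A\<in>sets \<mu>. emeasure \<mu> (g <#\<^bsub>G\<^esub> A) = emeasure \<mu> A)"

text \<open>The covolume of a discrete subgroup is the Haar measure of a Borel fundamental domain.  The
  fundamental domain is for left translation by the subgroup, under which the left Haar measure
  is invariant; hence its measure does not depend on the choice of the domain, even if the
  group is not assumed to be unimodular.\<close>

definition fundamental_domain ::
    "('g, 'm) monoid_scheme \<Rightarrow> 'g topology \<Rightarrow> 'g set \<Rightarrow> 'g set \<Rightarrow> bool" where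
  "fundamental_domain G T \<Gamma> F \<longleftrightarrow>
     F \<in> sets (borel_of T) \<and> (\<forall>x\<in>carrier G. \<exists>!\<gamma>. \<gamma> \<in> \<Gamma> \<and> \<gamma> \<otimes>\<^bsub>G\<^esub> x \<in> F)"

definition finite_covolume :: "('g, 'm) monoid_scheme \<Rightarrow> 'g topology \<Rightarrow> 'g set \<Rightarrow> bool" where
  "finite_covolume G T \<Gamma> \<longleftrightarrow>
     (\<exists>\<mu> F. left_haar_measure G T \<mu> \<and> fundamental_domain G T \<Gamma> F \<and> emeasure \<mu> F < \<infinity>)"

definition lattice_subgroup :: "('g, 'm) monoid_scheme \<Rightarrow> 'g topology \<Rightarrow> 'g set \<Rightarrow> bool" where
  "lattice_subgroup G T \<Gamma> \<longleftrightarrow>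
     subgroup \<Gamma> G \<and> subtopology T \<Gamma> = discrete_topology \<Gamma> \<and> finite_covolume G T \<Gamma>"

definition finite_index :: "('g, 'm) monoid_scheme \<Rightarrow> 'g set \<Rightarrow> 'g set \<Rightarrow> bool" where
  "finite_index G K H \<longleftrightarrow> finite (rcosets\<^bsub>G\<lparr>carrier := H\<rparr>\<^esub> K)"

definition commensurates :: "('g, 'm) monoid_scheme \<Rightarrow> 'g set \<Rightarrow> 'g set \<Rightarrow> bool" where
  "commensurates G \<Lambda> \<Gamma> \<longleftrightarrow>
     (\<forall>l\<in>\<Lambda>. let C = l <#\<^bsub>G\<^esub> \<Gamma> #>\<^bsub>G\<^esub> inv\<^bsub>G\<^esub> l
            in finite_index G (C \<inter> \<Gamma>) C \<and> finite_index G (C \<inter> \<Gamma>) \<Gamma>)"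

definition standard_borel :: "'a measure \<Rightarrow> bool" where
  "standard_borel M \<longleftrightarrow>
     (\<exists>T. completely_metrizable_space T \<and> second_countable T \<and> sets M = sets (borel_of T))"

text \<open>An abstract group \<open>L\<close> acts on the conull measurable subset \<open>X\<^sub>0\<close> of the standard probability
  space \<open>M\<close>; each group element acts measurably and preserves the measure class.  (The library's
  notion of a group action makes \<open>a g\<close> equal to \<open>undefined\<close> outside \<open>X\<^sub>0\<close>.)\<close>

locale quasi_invariant_space =
  prob_space M + group_action L X\<^sub>0 a
  for L :: "('g, 'm) monoid_scheme" and M :: "'x measure" and X\<^sub>0 and a +
  assumes standard: "standard_borel M"
    and sets_X0: "X\<^sub>0 \<in> sets M"
    and conull_X0: "measure M X\<^sub>0 = 1"
    and measurable_action_elem: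
      "g \<in> carrier L \<Longrightarrow> a g \<in> measurable (restrict_space M X\<^sub>0) (restrict_space M X\<^sub>0)"
    and quasi_invariant:
      "g \<in> carrier L \<Longrightarrow>
        null_sets (distr (restrict_space M X\<^sub>0) (restrict_space M X\<^sub>0) (a g)) =
        null_sets (restrict_space M X\<^sub>0)"

text \<open>For a topological group the action is moreover required to be jointly measurable.  For a
  countable discrete group this is automatic.\<close>

locale topological_quasi_invariant_space = quasi_invariant_space L M X\<^sub>0 a
  for L :: "('g, 'm) monoid_scheme" and T :: "'g topology" and M :: "'x measure" and X\<^sub>0 and a +
  assumes jointly_measurable:
    "(\<lambda>(g, x). a g x) \<in>
       measurable (borel_of T \<Otimes>\<^sub>M restrict_space M X\<^sub>0) (restrict_space M X\<^sub>0)"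

definition contractive ::
    "('g, 'm) monoid_scheme \<Rightarrow> 'x measure \<Rightarrow> 'x set \<Rightarrow> ('g \<Rightarrow> 'x \<Rightarrow> 'x) \<Rightarrow> bool" where
  "contractive L M X\<^sub>0 a \<longleftrightarrow>
     (\<forall>B\<in>sets M. measure M B < 1 \<longrightarrow>
        (\<forall>\<epsilon>>0. \<exists>g\<in>carrier L. measure M (a g ` (B \<inter> X\<^sub>0)) < \<epsilon>))"

definition equivariant_map ::
    "('g, 'm) monoid_scheme \<Rightarrow> 'x measure \<Rightarrow> ('g \<Rightarrow> 'x \<Rightarrow> 'x) \<Rightarrow>
     'y measure \<Rightarrow> ('g \<Rightarrow> 'y \<Rightarrow> 'y) \<Rightarrow> ('x \<Rightarrow> 'y) \<Rightarrow> bool" where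
  "equivariant_map L M a N b \<phi> \<longleftrightarrow>
     \<phi> \<in> measurable M N \<and> distr M N \<phi> = N \<and>
     (\<forall>g\<in>carrier L. AE x in M. \<phi> (a g x) = b g (\<phi> x))"

definition isomorphism_mod_null :: "'x measure \<Rightarrow> 'y measure \<Rightarrow> ('x \<Rightarrow> 'y) \<Rightarrow> bool" where
  "isomorphism_mod_null M N \<rho> \<longleftrightarrow>
     \<rho> \<in> measurable M N \<and> distr M N \<rho> = N \<and>
     (\<exists>A\<in>sets M. \<exists>B\<in>sets N.
        space M - A \<in> null_sets M \<and> space N - B \<in> null_sets N \<and> bij_betw \<rho> A B \<and>
        the_inv_into A \<rho> \<in> measurable (restrict_space N B) (restrict_space M A))"

definition equivariant_isomorphism ::
    "('g, 'm) monoid_scheme \<Rightarrow> 'x measure \<Rightarrow> ('g \<Rightarrow> 'x \<Rightarrow> 'x) \<Rightarrow>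
     'y measure \<Rightarrow> ('g \<Rightarrow> 'y \<Rightarrow> 'y) \<Rightarrow> ('x \<Rightarrow> 'y) \<Rightarrow> bool" where
  "equivariant_isomorphism L M a N b \<rho> \<longleftrightarrow>
     equivariant_map L M a N b \<rho> \<and> isomorphism_mod_null M N \<rho>"

end

theory Submission
  imports Defs
begin

text \<open>
  The map \<open>\<phi>\<close> is first shown to be equivariant under \<open>\<Lambda>\<close>. For \<open>l \<in> \<Lambda>\<close> the map
  \<open>\<psi> x = l\<inverse> \<phi> (l x)\<close> is, like \<open>\<phi>\<close>, equivariant under \<open>K = \<Gamma> \<inter> l\<inverse> \<Gamma> l\<close>. This subgroup has
  finite index in \<open>\<Gamma>\<close>, so it still acts contractively (\<open>contractive_finite_index_subgroup\<close>).
  Two equivariant maps out of a contractive space agree as soon as the law of one is absolutely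
  continuous with respect to the law of the other (\<open>contractive_maps_agree\<close>): if \<open>\<phi> x \<in> B\<close> and \<open>\<psi> x \<notin> B\<close> on a set of positive measure, group elements
  spread that set over almost all of the space, and the corresponding translates of \<open>B\<close> have
  measure near one for the law of \<open>\<phi>\<close> and near zero for the law of \<open>\<psi>\<close>. Hence \<open>\<psi> = \<phi>\<close>, which is
  equivariance under \<open>l\<close> (\<open>contractive_equivariance_extends\<close>).

  The sigma-algebra of the preimages under \<open>\<phi>\<close> is therefore invariant under \<open>\<Lambda>\<close> modulo null sets.
  Translation of Borel sets is continuous with respect to Haar measure (\<open>gap_Borel\<close>). Applied to the
  sets \<open>{t. t x \<in> A}\<close> and integrated over \<open>x\<close>, this shows that if \<open>h n\<close> tends to \<open>g\<close>, then along a
  subsequence almost every \<open>x\<close> has \<open>h n x \<in> A\<close> for large \<open>n\<close> exactly when \<open>g x \<in> A\<close>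
  (\<open>AE_translates_agree_subsequence\<close>). Because \<open>\<Lambda>\<close> is dense, the sigma-algebra is invariant under all
  of \<open>G\<close> (\<open>equivariant_factor_invariant\<close>).

  It remains to realise this invariant sigma-algebra by a space on which \<open>G\<close> acts everywhere and
  jointly measurably. Let the sets \<open>A i\<close> generate it, and send \<open>x\<close> to the sequence of sets
  \<open>{g. g\<inverse> x \<in> A i}\<close>, taken modulo Haar null sets. The group acts on such sequences by left
  translation, and the map intertwines the two actions for every \<open>g\<close> and every \<open>x\<close> of the invariant
  set, so that no action known only almost everywhere has to be repaired. A Borel set modulo null sets is coded
  by its distances to a countable dense family of sets. The code can be decoded in a Borel way
  (\<open>set_decode_code\<close>), so the codes form a Borel set of real sequences, and the translation action on
  them is jointly Borel (\<open>shift_measurable\<close>). Each coordinate of the code of \<open>x\<close> is an average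
  over \<open>g\<close> of functions that depend on \<open>\<phi> x\<close> only, hence is itself such a function
  (\<open>determined_by_average\<close>, \<open>orbit_code_factors\<close>). Conversely the code determines membership of \<open>x\<close> in
  each \<open>A i\<close> (\<open>set_determined_by_orbit_code\<close>), and so determines \<open>\<phi> x\<close>. The resulting two maps between
  \<open>\<eta>\<close> and the law of the code are inverse to each other almost everywhere.
\<close>

section \<open>Predicates determined by a map up to null sets\<close>

text \<open>A predicate that is measurable with respect to the map, modulo null sets. It is an arbitrary
  predicate rather than a measurable set, so that expressions which make sense only on a conull set
  can be inserted directly.\<close>

definition determined_by ::
    "'x measure \<Rightarrow> 'y measure \<Rightarrow> ('x \<Rightarrow> 'y) \<Rightarrow> ('x \<Rightarrow> bool) \<Rightarrow> bool" where
  "determined_by M N \<psi> P \<longleftrightarrow> (\<exists>B\<in>sets N. AE x in M. P x \<longleftrightarrow> \<psi> x \<in> B)"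

lemma determined_by_cong:
  assumes "determined_by M N \<psi> P" "AE x in M. P x \<longleftrightarrow> Q x"
  shows "determined_by M N \<psi> Q"
proof -
  obtain B where B: "B \<in> sets N" "AE x in M. P x \<longleftrightarrow> \<psi> x \<in> B"
    using assms(1) by (auto simp: determined_by_def)
  have "AE x in M. Q x \<longleftrightarrow> \<psi> x \<in> B"
    using B(2) assms(2) by eventually_elim auto
  then show ?thesis using B(1) by (auto simp: determined_by_def)
qed

text \<open>The upper limit of witnesses for the approximating predicates is a witness for the limit.\<close>

lemma determined_by_limit:
  fixes P :: "nat \<Rightarrow> 'x \<Rightarrow> bool"
  assumes "\<And>n. determined_by M N \<psi> (P n)"
    and "AE x in M. \<forall>\<^sub>F n in sequentially. P n x = Q x"
  shows "determined_by M N \<psi> Q"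
proof -
  have "\<forall>n. \<exists>B. B \<in> sets N \<and> (AE x in M. P n x \<longleftrightarrow> \<psi> x \<in> B)"
    using assms(1) by (auto simp: determined_by_def)
  then obtain B where B: "\<And>n. B n \<in> sets N" "\<And>n. AE x in M. P n x \<longleftrightarrow> \<psi> x \<in> B n"
    by metis
  define L where "L = (\<Inter>m. \<Union>n\<in>{m..}. B n)"
  have "L \<in> sets N" using B(1) unfolding L_def by auto
  moreover have "AE x in M. \<forall>n. P n x \<longleftrightarrow> \<psi> x \<in> B n"
    using B(2) by (simp add: AE_all_countable)
  with assms(2) have "AE x in M. Q x \<longleftrightarrow> \<psi> x \<in> L"
  proof eventually_elim
    case (elim x)
    then obtain m where m: "\<And>n. n \<ge> m \<Longrightarrow> P n x = Q x"
      by (auto simp: eventually_sequentially)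
    have "\<psi> x \<in> L \<longleftrightarrow> (\<forall>k. \<exists>n\<ge>k. P n x)"
      using elim(2) by (auto simp: L_def)
    also have "\<dots> \<longleftrightarrow> Q x"
      using m by (meson nat_le_linear order_trans order_refl)
    finally show ?case by simp
  qed
  ultimately show ?thesis by (auto simp: determined_by_def)
qed

text \<open>A real number is the infimum of the rationals above it. The infimum is formed in the extended
  reals because off a null set there may be no such rational.\<close>

lemma determined_by_real:
  fixes v :: "'x \<Rightarrow> real"
  assumes "\<And>q. q \<in> \<rat> \<Longrightarrow> determined_by M N \<psi> (\<lambda>x. v x < q)"
  shows "\<exists>r\<in>borel_measurable N. AE x in M. v x = r (\<psi> x)"
proof -
  have "\<forall>q. \<exists>B. B \<in> sets N \<and> (q \<in> \<rat> \<longrightarrow> (AE x in M. v x < q \<longleftrightarrow> \<psi> x \<in> B))"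
    using assms by (auto simp: determined_by_def)
  then obtain B where B[measurable]: "\<And>q. B q \<in> sets N"
    and Bq: "\<And>q. q \<in> \<rat> \<Longrightarrow> AE x in M. v x < q \<longleftrightarrow> \<psi> x \<in> B q"
    by metis
  define r where "r y = real_of_ereal (INF q\<in>\<rat>. if y \<in> B q then ereal q else \<infinity>)" for y
  have [measurable]: "r \<in> borel_measurable N"
    unfolding r_def
    by (intro borel_measurable_real_of_ereal borel_measurable_INF countable_rat measurable_If) auto
  have "AE x in M. \<forall>q\<in>\<rat>. v x < q \<longleftrightarrow> \<psi> x \<in> B q"
    using Bq by (intro AE_ball_countable'[OF _ countable_rat])
  then have "AE x in M. v x = r (\<psi> x)"
  proof eventually_elim
    case (elim x)
    have "(INF q\<in>\<rat>. if \<psi> x \<in> B q then ereal q else \<infinity>) = ereal (v x)" (is "?L = _")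
    proof (rule antisym)
      show "ereal (v x) \<le> ?L"
        using elim by (intro INF_greatest) (auto simp: less_imp_le)
      show "?L \<le> ereal (v x)"
      proof (rule ereal_le_epsilon2)
        fix e :: real assume "0 < e"
        then obtain q where q: "q \<in> \<rat>" "v x < q" "q < v x + e"
          using Rats_dense_in_real[of "v x" "v x + e"] by auto
        have "?L \<le> (if \<psi> x \<in> B q then ereal q else \<infinity>)"
          by (rule INF_lower[OF q(1)])
        also have "\<dots> = ereal q" using elim q by auto
        also have "\<dots> \<le> ereal (v x) + ereal e" using q(3) by simp
        finally show "?L \<le> ereal (v x) + ereal e" .
      qed
    qed
    then show ?case by (simp add: r_def)
  qed
  then show ?thesis using \<open>r \<in> borel_measurable N\<close> by blast
qed

lemma determined_by_real_sequence:
  fixes v :: "'x \<Rightarrow> nat \<Rightarrow> real"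
  assumes "\<And>k q. q \<in> \<rat> \<Longrightarrow> determined_by M N \<psi> (\<lambda>x. v x k < q)"
  shows "\<exists>r\<in>borel_measurable N. AE x in M. v x = r (\<psi> x)"
proof -
  have "\<forall>k. \<exists>r. r \<in> borel_measurable N \<and> (AE x in M. v x k = r (\<psi> x))"
    using determined_by_real[OF assms] by blast
  then obtain r where r: "\<And>k. r k \<in> borel_measurable N" "\<And>k. AE x in M. v x k = r k (\<psi> x)"
    by metis
  have "(\<lambda>y k. r k y) \<in> borel_measurable N"
    by (rule measurable_coordinatewise_then_product) (rule r(1))
  moreover have "AE x in M. \<forall>k. v x k = r k (\<psi> x)"
    using r(2) by (simp add: AE_all_countable)
  then have "AE x in M. v x = (\<lambda>k. r k (\<psi> x))"
    by eventually_elim auto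
  ultimately show ?thesis by (intro bexI[of _ "\<lambda>y k. r k y"])
qed

text \<open>Let \<open>v x\<close> be the measure of the section at \<open>x\<close>, let \<open>e\<close> be its conditional expectation given
  \<open>\<psi>\<close>, and put \<open>w = v - e\<close>. Then \<open>w\<close> is orthogonal to every function of \<open>\<psi>\<close>, in particular to \<open>e\<close>.
  It is also orthogonal to \<open>v\<close>: by Fubini the integral of \<open>v * w\<close> is an integral over \<open>g\<close> of the
  integrals of \<open>w\<close> over the sections at \<open>g\<close>, and those sections depend on \<open>\<psi>\<close> only. So \<open>w\<close> is orthogonal
  to itself.\<close>

lemma determined_by_average:
  assumes M: "prob_space M" and m: "finite_measure m"
    and \<psi>[measurable]: "\<psi> \<in> measurable M N"
    and W[measurable]: "W \<in> sets (m \<Otimes>\<^sub>M M)"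
    and slices: "AE g in m. determined_by M N \<psi> (\<lambda>x. (g, x) \<in> W)"
  shows "\<exists>r\<in>borel_measurable N. AE x in M. measure m {g \<in> space m. (g, x) \<in> W} = r (\<psi> x)"
proof -
  interpret M: prob_space M by fact
  interpret m: finite_measure m by fact
  interpret P: pair_sigma_finite m M ..
  define F where "F = vimage_algebra (space M) \<psi> N"
  have FM: "Conditional_Expectation.subalgebra M F"
    unfolding F_def Conditional_Expectation.subalgebra_def using sets_image_in_sets[OF refl \<psi>] by simp
  interpret F: finite_measure_subalgebra M F
    by unfold_locales (rule FM)
  have F_ind: "(\<lambda>x. indicator B (\<psi> x) :: real) \<in> borel_measurable F" if "B \<in> sets N" for B
  proof -
    have "\<psi> \<in> measurable F N"
      unfolding F_def using measurable_space[OF \<psi>] by (intro measurable_vimage_algebra1) auto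
    then show ?thesis using that by measurable
  qed
  define v where "v x = measure m {g \<in> space m. (g, x) \<in> W}" for x
  define c where "c = measure m (space m)"
  have v_bd: "0 \<le> v x" "v x \<le> c" for x
    unfolding v_def c_def by (auto intro: m.finite_measure_mono)
  have v_int_eq: "v x = (\<integral>g. indicator W (g, x) \<partial>m)" if "x \<in> space M" for x
  proof -
    have [measurable]: "x \<in> space M" by fact
    have "{g \<in> space m. (g, x) \<in> W} \<in> sets m" by measurable
    then have "v x = (\<integral>g. indicator {g \<in> space m. (g, x) \<in> W} g \<partial>m)"
      unfolding v_def by simp
    also have "\<dots> = (\<integral>g. indicator W (g, x) \<partial>m)"
      by (intro Bochner_Integration.integral_cong) (auto simp: indicator_def)
    finally show ?thesis .
  qed
  have "(\<lambda>x. \<integral>g. indicator W (g, x) \<partial>m :: real) \<in> borel_measurable M"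
    by measurable
  then have v_meas[measurable]: "v \<in> borel_measurable M"
    by (subst measurable_cong[OF v_int_eq])
  have v_int: "integrable M v"
    using v_bd by (intro M.integrable_const_bound[of _ c]) auto
  define e where "e = real_cond_exp M F v"
  have e_F: "e \<in> borel_measurable F" and e_M[measurable]: "e \<in> borel_measurable M"
    by (simp_all add: e_def)
  have e_int: "integrable M e"
    unfolding e_def by (rule F.real_cond_exp_int(1)[OF v_int])
  define w where "w x = v x - e x" for x
  have w_meas[measurable]: "w \<in> borel_measurable M" unfolding w_def by measurable
  have w_int: "integrable M w" unfolding w_def using v_int e_int by auto
  have bound_int: "integrable M (\<lambda>x. v x * f x)" if "integrable M f" for f :: "_ \<Rightarrow> real"
  proof (rule Bochner_Integration.integrable_bound)
    show "integrable M (\<lambda>x. c * f x)" using that by simp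
    have "\<bar>v x * f x\<bar> \<le> \<bar>c * f x\<bar>" for x
      using v_bd[of x] by (auto simp: abs_mult intro!: mult_right_mono)
    then show "AE x in M. norm (v x * f x) \<le> norm (c * f x)" by simp
  qed (use that in measurable)
  have vw_int: "integrable M (\<lambda>x. v x * w x)"
    by (rule bound_int[OF w_int])
  have ev_int: "integrable M (\<lambda>x. e x * v x)"
    using bound_int[OF e_int] by (simp add: mult.commute)
  have orth_e: "(\<integral>x. e x * w x \<partial>M) = 0" and ew_int: "integrable M (\<lambda>x. e x * w x)"
    using F.real_cond_exp_intg[OF ev_int e_F v_meas] ev_int
    by (simp_all add: w_def right_diff_distrib flip: e_def)
  have orth_ind: "(\<integral>x. indicator B (\<psi> x) * w x \<partial>M) = 0" if B: "B \<in> sets N" for B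
  proof -
    have i: "integrable M (\<lambda>x. indicator B (\<psi> x) * v x)"
      using v_int B by (intro Bochner_Integration.integrable_bound[OF v_int]) (auto simp: indicator_def)
    show ?thesis
      using F.real_cond_exp_intg[OF i F_ind[OF B] v_meas] i
      by (simp add: w_def right_diff_distrib flip: e_def)
  qed
  have Ww_int: "integrable (m \<Otimes>\<^sub>M M) (\<lambda>(g, x). indicator W (g, x) * w x)"
  proof (rule Bochner_Integration.integrable_bound)
    show "integrable (m \<Otimes>\<^sub>M M) (\<lambda>(g, x). w x)"
    proof (rule P.Fubini_integrable)
      show "integrable m (\<lambda>g. \<integral>x. norm (case (g, x) of (g, x) \<Rightarrow> w x) \<partial>M)" by simp
    qed (use w_int in auto)
  qed (auto simp: indicator_def)
  have "(\<integral>x. v x * w x \<partial>M) = (\<integral>x. (\<integral>g. indicator W (g, x) * w x \<partial>m) \<partial>M)"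
    by (intro Bochner_Integration.integral_cong) (auto simp: v_int_eq)
  also have "\<dots> = (\<integral>g. (\<integral>x. indicator W (g, x) * w x \<partial>M) \<partial>m)"
    by (rule P.Fubini_integral[OF Ww_int])
  also have "\<dots> = (\<integral>g. 0 \<partial>m)"
  proof (rule integral_cong_AE)
    show "AE g in m. (\<integral>x. indicator W (g, x) * w x \<partial>M) = 0"
      using slices AE_space
    proof eventually_elim
      case (elim g)
      then obtain B where B[measurable]: "B \<in> sets N" and *: "AE x in M. (g, x) \<in> W \<longleftrightarrow> \<psi> x \<in> B"
        by (auto simp: determined_by_def)
      have [measurable]: "g \<in> space m" by (rule elim)
      have "(\<integral>x. indicator W (g, x) * w x \<partial>M) = (\<integral>x. indicator B (\<psi> x) * w x \<partial>M)"
      proof (rule integral_cong_AE)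
        show "AE x in M. indicator W (g, x) * w x = indicator B (\<psi> x) * w x"
          using * by eventually_elim (auto simp: indicator_def)
      qed measurable
      then show ?case using orth_ind[OF B] by simp
    qed
  qed measurable
  finally have "(\<integral>x. v x * w x \<partial>M) = 0" by simp
  then have "(\<integral>x. w x * w x \<partial>M) = 0"
    using orth_e vw_int ew_int
    by (subst w_def) (simp add: left_diff_distrib)
  moreover have "integrable M (\<lambda>x. w x * w x)"
    using vw_int ew_int by (subst w_def) (simp add: left_diff_distrib)
  ultimately have "AE x in M. w x * w x = 0"
    by (subst (asm) integral_nonneg_eq_0_iff_AE) auto
  then have v_e: "AE x in M. v x = e x"
    by eventually_elim (simp add: w_def)
  have "determined_by M N \<psi> (\<lambda>x. v x < q)" for q
  proof -
    have "{x \<in> space F. e x < q} \<in> sets F"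
      using e_F by measurable
    then obtain B where B: "B \<in> sets N" "{x \<in> space F. e x < q} = \<psi> -` B \<inter> space M"
      unfolding F_def using measurable_space[OF \<psi>]
      by (auto simp: sets_vimage_algebra2)
    have "AE x in M. v x < q \<longleftrightarrow> \<psi> x \<in> B"
      using v_e AE_space by eventually_elim (use B(2) in \<open>auto simp: F_def\<close>)
    then show ?thesis using B(1) by (auto simp: determined_by_def)
  qed
  from determined_by_real[OF this] show ?thesis unfolding v_def by simp
qed

section \<open>Borel structures of topological spaces\<close>

lemma measurable_sequence_component [measurable]: "(\<lambda>z. z n) \<in> borel_measurable (borel :: (nat \<Rightarrow> real) measure)"
  by (intro borel_measurable_continuous_onI continuous_on_product_coordinates)

lemma space_borel_of [simp]: "space (borel_of T) = topspace T"
  unfolding borel_of_def by (rule space_measure_of) (auto dest: openin_subset)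

lemma sets_borel_of: "sets (borel_of T) = sigma_sets (topspace T) {U. openin T U}"
  unfolding borel_of_def by (rule sets_measure_of) (auto dest: openin_subset)

lemma openin_sets_borel_of: "openin T U \<Longrightarrow> U \<in> sets (borel_of T)"
  by (auto simp: sets_borel_of)

lemma continuous_map_measurable:
  assumes "continuous_map S T f"
  shows "f \<in> measurable (borel_of S) (borel_of T)"
proof (rule measurable_sigma_sets[OF sets_borel_of])
  show "f \<in> space (borel_of S) \<rightarrow> topspace T"
    using assms by (auto simp: continuous_map_def)
  show "f -` U \<inter> space (borel_of S) \<in> sets (borel_of S)" if "U \<in> {U. openin T U}" for U
  proof -
    have "f -` U \<inter> space (borel_of S) = {x \<in> topspace S. f x \<in> U}" by auto
    then show ?thesis using assms that by (auto simp: continuous_map_def openin_sets_borel_of)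
  qed
qed (auto dest: openin_subset)

text \<open>A Polish space embeds into the real sequences by \<open>\<iota> y k = d y (s k)\<close>, where \<open>s\<close> enumerates a
  dense set. By completeness a sequence \<open>z\<close> lies in the image exactly if it satisfies the triangle
  inequalities of a distance function and has infimum zero: indices with \<open>z k\<close> tending to zero give a
  Cauchy sequence whose limit has the distances \<open>z\<close>. These are countably many Borel conditions, so
  the image is Borel.\<close>

lemma standard_borel_embedding:
  fixes M :: "'a measure"
  assumes "standard_borel M"
  shows "\<exists>(\<iota> :: 'a \<Rightarrow> nat \<Rightarrow> real) \<theta>.
           \<iota> \<in> borel_measurable M \<and> \<iota> ` space M \<in> sets borel \<and>
           \<theta> \<in> measurable (restrict_space borel (\<iota> ` space M)) M \<and>
           (\<forall>y\<in>space M. \<theta> (\<iota> y) = y)"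
proof -
  obtain T where T: "completely_metrizable_space T" "second_countable T" "sets M = sets (borel_of T)"
    using assms by (auto simp: standard_borel_def)
  obtain S d where "Metric_space S d" and complete_d: "Metric_space.mcomplete S d"
    and T_eq: "T = Metric_space.mtopology S d"
    using T(1) by (auto simp: completely_metrizable_space_def)
  interpret Metric_space S d by fact
  have space_M: "space M = S"
    using sets_eq_imp_space_eq[OF T(3)] T_eq by simp
  have sets_M: "sets M = sigma_sets S {U. openin mtopology U}"
    using T(3) T_eq by (simp add: sets_borel_of)
  show ?thesis
  proof (cases "S = {}")
    case True
    then have empty: "space M = {}" by (simp add: space_M)
    have "(\<lambda>_ _. 0) \<in> borel_measurable M"
      by measurable
    moreover have "\<theta> \<in> measurable (restrict_space borel {}) M" for \<theta> :: "(nat \<Rightarrow> real) \<Rightarrow> 'a"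
      by (rule measurableI) (simp_all add: space_restrict_space)
    ultimately show ?thesis
      by (intro exI[of _ "\<lambda>_ _. 0"] exI) (simp add: empty)
  next
    case False
    obtain D where D: "countable D" "D \<subseteq> S" "mtopology closure_of D = S"
      using second_countable_imp_separable_space[OF T(2)] T_eq by (auto simp: separable_space_def)
    have "D \<noteq> {}" using D(3) False by auto
    then obtain s :: "nat \<Rightarrow> 'a" where s: "range s = D"
      using D(1) by (metis range_from_nat_into)
    have sS[simp]: "s k \<in> S" for k using s D(2) by auto
    have dense: "\<exists>k. d y (s k) < \<epsilon>" if "y \<in> S" "0 < \<epsilon>" for y \<epsilon>
      using that D(3) s by (auto simp: metric_closure_of)
    define \<iota> where "\<iota> y k = d y (s k)" for y k
    have ball_sets: "mball x r \<in> sets M" for x r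
      unfolding sets_M by auto
    have \<iota>_meas: "\<iota> \<in> borel_measurable M"
    proof (rule measurable_coordinatewise_then_product)
      fix k
      show "(\<lambda>y. \<iota> y k) \<in> borel_measurable M"
        unfolding borel_measurable_iff_less
      proof
        fix q
        have "{y \<in> space M. \<iota> y k < q} = mball (s k) q"
          by (auto simp: space_M \<iota>_def commute)
        then show "{y \<in> space M. \<iota> y k < q} \<in> sets M" using ball_sets by simp
      qed
    qed
    have inj: "y = y'" if yy: "y \<in> S" "y' \<in> S" "\<iota> y = \<iota> y'" for y y'
    proof (rule ccontr)
      assume "y \<noteq> y'"
      then have "0 < d y y'" using yy by simp
      then obtain k where k: "d y (s k) < d y y' / 2"
        using dense[OF yy(1), of "d y y' / 2"] by auto
      have "d y' (s k) = d y (s k)" using fun_cong[OF yy(3), of k] by (simp add: \<iota>_def)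
      then show False
        using triangle[OF yy(1) sS[of k] yy(2)] k by (simp add: commute)
    qed
    \<comment> \<open>The last condition says that the infimum of the coordinates is at most zero.\<close>
    define I where "I = {z :: nat \<Rightarrow> real.
      (\<forall>k l. \<bar>z k - z l\<bar> \<le> d (s k) (s l) \<and> d (s k) (s l) \<le> z k + z l) \<and> (\<forall>n. \<exists>k. z k < (1/2) ^ n)}"
    have I_sets: "I \<in> sets borel"
    proof -
      have "I = {z \<in> space borel. (\<forall>k l. \<bar>z k - z l\<bar> \<le> d (s k) (s l) \<and> d (s k) (s l) \<le> z k + z l) \<and> (\<forall>n. \<exists>k. z k < (1/2) ^ n)}"
        by (auto simp: I_def)
      also have "\<dots> \<in> sets borel" by measurable
      finally show ?thesis .
    qed
    have I_eq: "\<iota> ` space M = I"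
    proof
      show "\<iota> ` space M \<subseteq> I"
      proof safe
        fix y assume "y \<in> space M"
        then have y: "y \<in> S" by (simp add: space_M)
        have "\<bar>\<iota> y k - \<iota> y l\<bar> \<le> d (s k) (s l)" "d (s k) (s l) \<le> \<iota> y k + \<iota> y l" for k l
          using triangle[OF y sS[of k] sS[of l]] triangle[OF y sS[of l] sS[of k]]
            triangle[OF sS[of k] y sS[of l]]
          by (auto simp: \<iota>_def commute)
        moreover have "\<exists>k. \<iota> y k < (1/2) ^ n" for n
          using dense[OF y, of "(1/2) ^ n"] by (simp add: \<iota>_def)
        ultimately show "\<iota> y \<in> I" by (simp add: I_def)
      qed
      show "I \<subseteq> \<iota> ` space M"
      proof
        fix z assume z: "z \<in> I"
        then have "\<forall>n. \<exists>k. z k < (1/2) ^ n" by (simp add: I_def)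
        then obtain k where k: "\<And>n. z (k n) < (1/2) ^ n" by metis
        have z1: "\<bar>z i - z j\<bar> \<le> d (s i) (s j)" "d (s i) (s j) \<le> z i + z j" for i j
          using z by (auto simp: I_def)
        have z_nonneg: "0 \<le> z i" for i using z1(2)[of i i] by simp
        have zk: "(\<lambda>n. z (k n)) \<longlonglongrightarrow> 0"
          by (rule tendsto_sandwich[OF _ _ tendsto_const LIMSEQ_power_zero[of "1/2"]])
             (auto simp: z_nonneg k less_imp_le)
        have "MCauchy (\<lambda>n. s (k n))"
          unfolding MCauchy_def
        proof safe
          fix \<epsilon> :: real assume "0 < \<epsilon>"
          then have "\<forall>\<^sub>F n in sequentially. z (k n) < \<epsilon> / 2"
            by (intro order_tendstoD(2)[OF zk]) simp
          then obtain N where N: "\<And>n. n \<ge> N \<Longrightarrow> z (k n) < \<epsilon> / 2"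
            by (auto simp: eventually_sequentially)
          have "d (s (k n)) (s (k n')) < \<epsilon>" if "N \<le> n" "N \<le> n'" for n n'
            using N[OF that(1)] N[OF that(2)] z1(2)[of "k n" "k n'"] by linarith
          then show "\<exists>N. \<forall>n n'. N \<le> n \<longrightarrow> N \<le> n' \<longrightarrow> d (s (k n)) (s (k n')) < \<epsilon>" by blast
        qed auto
        then obtain y where y: "limitin mtopology (\<lambda>n. s (k n)) y sequentially"
          using complete_d unfolding mcomplete_def by blast
        then have yS: "y \<in> S" using limitin_topspace by fastforce
        have dy: "(\<lambda>n. d (s (k n)) y) \<longlonglongrightarrow> 0"
          using y by (auto simp: limit_metric_sequentially LIMSEQ_iff)
        have "\<iota> y l = z l" for l
        proof -
          have "\<bar>d y (s l) - z l\<bar> \<le> d (s (k n)) y + z (k n)" for n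
            using triangle[OF yS sS[of "k n"] sS[of l]] triangle[OF sS[of "k n"] yS sS[of l]]
              z1[of "k n" l] by (auto simp: commute)
          then have "\<bar>d y (s l) - z l\<bar> \<le> 0"
            using tendsto_add[OF dy zk] by (intro LIMSEQ_le_const[where X="\<lambda>n. d (s (k n)) y + z (k n)"]) auto
          then show ?thesis by (simp add: \<iota>_def)
        qed
        then have "z = \<iota> y" by auto
        then show "z \<in> \<iota> ` space M" using yS space_M by auto
      qed
    qed
    define \<theta> where "\<theta> = inv_into S \<iota>"
    have \<theta>\<iota>: "\<theta> (\<iota> y) = y" if "y \<in> S" for y
      unfolding \<theta>_def using inj that by (intro inv_into_f_f) (auto simp: inj_on_def)
    have \<theta>_meas: "\<theta> \<in> measurable (restrict_space borel I) M"
    proof (rule measurable_sigma_sets[OF sets_M])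
      show "\<theta> \<in> space (restrict_space borel I) \<rightarrow> S"
        using \<theta>\<iota> I_eq space_M by (auto simp: space_restrict_space)
      fix U assume "U \<in> {U. openin mtopology U}"
      then have U: "openin mtopology U" by simp
      have US: "U \<subseteq> S" using openin_subset[OF U] by simp
      have "\<theta> -` U \<inter> space (restrict_space borel I) =
          (\<Union>k. \<Union>q\<in>{q \<in> \<rat>. mball (s k) q \<subseteq> U}. {z. z k < q}) \<inter> I"
      proof (intro equalityI subsetI; elim IntE)
        fix z assume z: "z \<in> \<theta> -` U" "z \<in> space (restrict_space borel I)"
        then obtain y where y: "y \<in> S" "z = \<iota> y"
          using I_eq space_M by (auto simp: space_restrict_space)
        have "y \<in> U" using z y \<theta>\<iota> by auto
        then obtain r where r: "0 < r" "mball y r \<subseteq> U"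
          using U by (auto simp: openin_mtopology)
        obtain k where k: "d y (s k) < r / 2" using dense[OF y(1), of "r/2"] r by auto
        obtain q where q: "q \<in> \<rat>" "d y (s k) < q" "q < r / 2"
          using Rats_dense_in_real[OF k] by auto
        have "mball (s k) q \<subseteq> mball y r"
        proof
          fix x assume "x \<in> mball (s k) q"
          then show "x \<in> mball y r"
            using triangle[OF y(1) sS[of k], of x] k q y(1) by auto
        qed
        then have "z \<in> {z. z k < q}" "q \<in> {q \<in> \<rat>. mball (s k) q \<subseteq> U}"
          using q r y by (auto simp: \<iota>_def)
        then show "z \<in> (\<Union>k. \<Union>q\<in>{q \<in> \<rat>. mball (s k) q \<subseteq> U}. {z. z k < q}) \<inter> I"
          using y I_eq space_M by blast
      next
        fix z assume z: "z \<in> (\<Union>k. \<Union>q\<in>{q \<in> \<rat>. mball (s k) q \<subseteq> U}. {z. z k < q})" "z \<in> I"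
        then obtain y where y: "y \<in> S" "z = \<iota> y" using I_eq space_M by auto
        from z obtain k q where "mball (s k) q \<subseteq> U" "z k < q" by auto
        then have "y \<in> U" using y by (auto simp: \<iota>_def commute)
        then show "z \<in> \<theta> -` U \<inter> space (restrict_space borel I)"
          using y \<theta>\<iota> z by (auto simp: space_restrict_space)
      qed
      also have "\<dots> \<in> sets (restrict_space borel I)"
      proof -
        have "{z. z k < q} \<in> sets (borel :: (nat \<Rightarrow> real) measure)" for k q
        proof -
          have "{z \<in> space (borel :: (nat \<Rightarrow> real) measure). z k < q} \<in> sets (borel :: (nat \<Rightarrow> real) measure)" by measurable
          then show ?thesis by simp
        qed
        then have "(\<Union>k. \<Union>q\<in>{q \<in> \<rat>. mball (s k) q \<subseteq> U}. {z. z k < q}) \<in> sets borel"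
          by (intro sets.countable_UN'' countable_subset[OF _ countable_rat]) auto
        then show ?thesis by (auto simp: sets_restrict_space)
      qed
      finally show "\<theta> -` U \<inter> space (restrict_space borel I) \<in> sets (restrict_space borel I)" .
    qed (use openin_subset in fastforce)
    show ?thesis
      using \<iota>_meas I_sets \<theta>_meas \<theta>\<iota> space_M unfolding I_eq[symmetric]
      by (intro exI[of _ \<iota>] exI[of _ \<theta>]) auto
  qed
qed

lemma standard_borel_sequences: "standard_borel (borel :: (nat \<Rightarrow> real) measure)"
proof -
  have "second_countable (euclidean :: (nat \<Rightarrow> real) topology)"
  proof -
    obtain \<B> :: "(nat \<Rightarrow> real) set set" where \<B>: "countable \<B>" "topological_basis \<B>"
      using ex_countable_basis by blast
    show ?thesis
      unfolding second_countable_def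
    proof (intro exI[of _ \<B>] conjI ballI allI impI)
      show "openin euclidean V" if "V \<in> \<B>" for V
        using topological_basis_open[OF \<B>(2) that] by simp
      show "\<exists>V\<in>\<B>. x \<in> V \<and> V \<subseteq> U" if "openin euclidean U \<and> x \<in> U" for U x
        using topological_basisE[OF \<B>(2), of U x] that by auto
    qed (rule \<B>(1))
  qed
  moreover have "sets (borel :: (nat \<Rightarrow> real) measure) = sets (borel_of euclidean)"
    by (simp add: sets_borel_of borel_def)
  ultimately show ?thesis
    using completely_metrizable_space_euclidean by (auto simp: standard_borel_def)
qed

lemma standard_borel_cong: "sets M = sets N \<Longrightarrow> standard_borel M \<longleftrightarrow> standard_borel N"
  by (simp add: standard_borel_def)

text \<open>The diagonal of a standard Borel space is measurable: two points coincide if the coordinates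
  of their embeddings do.\<close>

lemma standard_borel_equalizer_sets:
  assumes "standard_borel N" and f: "f \<in> measurable M N" and g: "g \<in> measurable M N"
  shows "{x \<in> space M. f x = g x} \<in> sets M"
proof -
  obtain \<iota> :: "_ \<Rightarrow> nat \<Rightarrow> real" and \<theta> where \<iota>: "\<iota> \<in> borel_measurable N"
    and \<theta>: "\<And>y. y \<in> space N \<Longrightarrow> \<theta> (\<iota> y) = y"
    using standard_borel_embedding[OF assms(1)] by blast
  have "(\<lambda>x. \<iota> (f x) k) \<in> borel_measurable M" "(\<lambda>x. \<iota> (g x) k) \<in> borel_measurable M" for k
    using measurable_compose[OF measurable_compose[OF f \<iota>] measurable_sequence_component]
      measurable_compose[OF measurable_compose[OF g \<iota>] measurable_sequence_component] by auto
  then have "{x \<in> space M. \<iota> (f x) k = \<iota> (g x) k} \<in> sets M" for k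
    by (intro borel_measurable_eq)
  then have "{x \<in> space M. \<forall>k. \<iota> (f x) k = \<iota> (g x) k} \<in> sets M"
    by (rule sets.sets_Collect_countable_All)
  also have "{x \<in> space M. \<forall>k. \<iota> (f x) k = \<iota> (g x) k} = {x \<in> space M. f x = g x}"
    using \<theta> measurable_space[OF f] measurable_space[OF g] by (auto simp flip: fun_eq_iff) metis
  finally show ?thesis .
qed

text \<open>Countably many sets, the rational cuts of the coordinates of an embedding, separate the points,
  so the exceptional null sets can be united.\<close>

lemma AE_eq_of_AE_mem_iff:
  assumes "standard_borel N" and \<phi>: "\<phi> \<in> measurable M N" and \<psi>: "\<psi> \<in> measurable M N"
    and mem: "\<And>B. B \<in> sets N \<Longrightarrow> AE x in M. \<phi> x \<in> B \<longleftrightarrow> \<psi> x \<in> B"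
  shows "AE x in M. \<phi> x = \<psi> x"
proof -
  obtain \<iota> :: "_ \<Rightarrow> nat \<Rightarrow> real" and \<theta> where \<iota>[measurable]: "\<iota> \<in> borel_measurable N"
    and \<theta>: "\<And>y. y \<in> space N \<Longrightarrow> \<theta> (\<iota> y) = y"
    using standard_borel_embedding[OF assms(1)] by blast
  have "AE x in M. \<forall>k. \<forall>q\<in>\<rat>. \<iota> (\<phi> x) k < q \<longleftrightarrow> \<iota> (\<psi> x) k < q"
    unfolding AE_all_countable
  proof (intro allI AE_ball_countable'[OF _ countable_rat])
    fix k and q :: real
    have "{y \<in> space N. \<iota> y k < q} \<in> sets N" by measurable
    from mem[OF this] AE_space
    show "AE x in M. \<iota> (\<phi> x) k < q \<longleftrightarrow> \<iota> (\<psi> x) k < q"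
      by eventually_elim (use measurable_space[OF \<phi>] measurable_space[OF \<psi>] in auto)
  qed
  then show ?thesis using AE_space
  proof eventually_elim
    case (elim x)
    have "\<iota> (\<phi> x) k = \<iota> (\<psi> x) k" for k
    proof (rule ccontr)
      assume "\<iota> (\<phi> x) k \<noteq> \<iota> (\<psi> x) k"
      then consider "\<iota> (\<phi> x) k < \<iota> (\<psi> x) k" | "\<iota> (\<psi> x) k < \<iota> (\<phi> x) k" by linarith
      then show False
        using elim(1) Rats_dense_in_real by (cases; metis less_asym)
    qed
    then have "\<iota> (\<phi> x) = \<iota> (\<psi> x)" by blast
    then show ?case
      using \<theta> measurable_space[OF \<phi> elim(2)] measurable_space[OF \<psi> elim(2)] by metis
  qed
qed

text \<open>Second countability enters here: an open set of the product is a union of countably many open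
  rectangles.\<close>

lemma openin_prod_sets:
  assumes S: "second_countable S" and T: "second_countable T" and U: "openin (prod_topology S T) U"
  shows "U \<in> sets (borel_of S \<Otimes>\<^sub>M borel_of T)"
proof -
  obtain \<B> where \<B>: "countable \<B>" "\<And>V. V \<in> \<B> \<Longrightarrow> openin S V"
    "\<And>U x. openin S U \<Longrightarrow> x \<in> U \<Longrightarrow> \<exists>V\<in>\<B>. x \<in> V \<and> V \<subseteq> U"
    using S unfolding second_countable_def by metis
  obtain \<C> where \<C>: "countable \<C>" "\<And>V. V \<in> \<C> \<Longrightarrow> openin T V"
    "\<And>U x. openin T U \<Longrightarrow> x \<in> U \<Longrightarrow> \<exists>V\<in>\<C>. x \<in> V \<and> V \<subseteq> U"
    using T unfolding second_countable_def by metis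
  define \<R> where "\<R> = {(V, W) \<in> \<B> \<times> \<C>. V \<times> W \<subseteq> U}"
  have "countable \<R>"
    using \<B>(1) \<C>(1) by (auto simp: \<R>_def intro: countable_subset[of _ "\<B> \<times> \<C>"])
  have "U = (\<Union>(V, W)\<in>\<R>. V \<times> W)"
  proof (intro equalityI subsetI)
    fix z assume "z \<in> U"
    then obtain x y where z: "z = (x, y)" "(x, y) \<in> U" by (cases z) auto
    then obtain V W where VW: "openin S V" "openin T W" "x \<in> V" "y \<in> W" "V \<times> W \<subseteq> U"
      using U[unfolded openin_prod_topology_alt, rule_format, OF z(2)] by blast
    obtain V' where "V' \<in> \<B>" "x \<in> V'" "V' \<subseteq> V" using \<B>(3)[OF VW(1,3)] by blast
    moreover obtain W' where "W' \<in> \<C>" "y \<in> W'" "W' \<subseteq> W" using \<C>(3)[OF VW(2,4)] by blast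
    ultimately show "z \<in> (\<Union>(V, W)\<in>\<R>. V \<times> W)"
      using VW(5) z(1) unfolding \<R>_def by blast
  qed (auto simp: \<R>_def)
  also have "\<dots> \<in> sets (borel_of S \<Otimes>\<^sub>M borel_of T)"
    using \<open>countable \<R>\<close> \<B>(2) \<C>(2)
    by (intro sets.countable_UN'') (auto simp: \<R>_def intro!: pair_measureI openin_sets_borel_of)
  finally show ?thesis .
qed

lemma continuous_map_prod_measurable:
  assumes "second_countable S" "second_countable T" "continuous_map (prod_topology S T) R f"
  shows "f \<in> measurable (borel_of S \<Otimes>\<^sub>M borel_of T) (borel_of R)"
proof (rule measurable_sigma_sets[OF sets_borel_of])
  show "f \<in> space (borel_of S \<Otimes>\<^sub>M borel_of T) \<rightarrow> topspace R"
    using assms(3) by (auto simp: continuous_map_def space_pair_measure)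
  fix U assume "U \<in> {U. openin R U}"
  then have "openin (prod_topology S T) {z \<in> topspace (prod_topology S T). f z \<in> U}"
    using assms(3) by (auto simp: continuous_map_def)
  moreover have "f -` U \<inter> space (borel_of S \<Otimes>\<^sub>M borel_of T) = {z \<in> topspace (prod_topology S T). f z \<in> U}"
    by (auto simp: space_pair_measure)
  ultimately show "f -` U \<inter> space (borel_of S \<Otimes>\<^sub>M borel_of T) \<in> sets (borel_of S \<Otimes>\<^sub>M borel_of T)"
    using openin_prod_sets[OF assms(1,2)] by simp
qed (auto dest: openin_subset)

section \<open>Codes of sequences of measurable sets\<close>

text \<open>Closing under complements and unions in countably many rounds produces the generated algebra
  and keeps it countable.\<close>

primrec algebra_stage :: "'a set \<Rightarrow> 'a set set \<Rightarrow> nat \<Rightarrow> 'a set set" where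
  "algebra_stage \<Omega> \<B> 0 = insert {} \<B>"
| "algebra_stage \<Omega> \<B> (Suc n) =
     algebra_stage \<Omega> \<B> n \<union> (\<lambda>A. \<Omega> - A) ` algebra_stage \<Omega> \<B> n
     \<union> (\<lambda>(A, B). A \<union> B) ` (algebra_stage \<Omega> \<B> n \<times> algebra_stage \<Omega> \<B> n)"

lemma countable_algebra_stage: "countable \<B> \<Longrightarrow> countable (algebra_stage \<Omega> \<B> n)"
  by (induction n) auto

lemma algebra_stage_sets:
  "\<B> \<subseteq> sets M \<Longrightarrow> \<Omega> = space M \<Longrightarrow> algebra_stage \<Omega> \<B> n \<subseteq> sets M"
  by (induction n) auto

lemma algebra_stage_mono: "i \<le> j \<Longrightarrow> algebra_stage \<Omega> \<B> i \<subseteq> algebra_stage \<Omega> \<B> j"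
  by (induction j) (auto simp: le_Suc_eq)

text \<open>The sets that can be approximated by members of the algebra generated by \<open>\<B>\<close> form a
  sigma-algebra.\<close>

lemma countable_dense_family:
  assumes m: "finite_measure m" and \<B>: "countable \<B>" "sets m = sigma_sets (space m) \<B>"
  shows "\<exists>C :: nat \<Rightarrow> 'a set. (\<forall>k. C k \<in> sets m) \<and>
           (\<forall>E\<in>sets m. \<forall>\<epsilon>>0. \<exists>k. measure m (sym_diff E (C k)) < \<epsilon>)"
proof -
  interpret finite_measure m by fact
  define \<A> where "\<A> = (\<Union>n. algebra_stage (space m) \<B> n)"
  have \<B>_sub: "\<B> \<subseteq> sets m" unfolding \<B>(2) by auto
  have cA: "countable \<A>"
    unfolding \<A>_def using countable_algebra_stage[OF \<B>(1)] by auto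
  have Am: "\<A> \<subseteq> sets m"
    unfolding \<A>_def using algebra_stage_sets[OF \<B>_sub refl] by auto
  have A_empty: "{} \<in> \<A>" and A_base: "\<B> \<subseteq> \<A>"
    unfolding \<A>_def by (auto intro!: exI[of _ 0])
  have A_compl: "space m - A \<in> \<A>" if "A \<in> \<A>" for A
  proof -
    from that obtain n where "A \<in> algebra_stage (space m) \<B> n" by (auto simp: \<A>_def)
    then have "space m - A \<in> algebra_stage (space m) \<B> (Suc n)" by auto
    then show ?thesis unfolding \<A>_def by blast
  qed
  have A_Un: "A \<union> B \<in> \<A>" if "A \<in> \<A>" "B \<in> \<A>" for A B
  proof -
    from that obtain i j
      where "A \<in> algebra_stage (space m) \<B> i" "B \<in> algebra_stage (space m) \<B> j"
      by (auto simp: \<A>_def)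
    then have "A \<in> algebra_stage (space m) \<B> (max i j)" "B \<in> algebra_stage (space m) \<B> (max i j)"
      using algebra_stage_mono[of i "max i j" "space m" \<B>]
        algebra_stage_mono[of j "max i j" "space m" \<B>] by (meson max.cobounded1 max.cobounded2 subsetD)+
    then have "A \<union> B \<in> algebra_stage (space m) \<B> (Suc (max i j))" by auto
    then show ?thesis unfolding \<A>_def by blast
  qed
  have approx: "\<forall>\<epsilon>>0. \<exists>A\<in>\<A>. measure m (sym_diff E A) < \<epsilon>" if "E \<in> sigma_sets (space m) \<B>" for E
    using that
  proof induction
    case (Basic E)
    then show ?case using A_base by (auto intro!: bexI[of _ E])
  next
    case Empty
    show ?case using A_empty by (auto intro!: bexI[of _ "{}"])
  next
    case (Compl E)
    have E: "E \<subseteq> space m" using sets.sets_into_space Compl(1) \<B>(2) by auto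
    show ?case
    proof safe
      fix \<epsilon> :: real assume "0 < \<epsilon>"
      then obtain A where A: "A \<in> \<A>" "measure m (sym_diff E A) < \<epsilon>" using Compl by blast
      have "sym_diff (space m - E) (space m - A) = sym_diff E A"
        using E sets.sets_into_space[of A m] A(1) Am by auto
      then show "\<exists>A\<in>\<A>. measure m (sym_diff (space m - E) A) < \<epsilon>"
        using A A_compl[OF A(1)] by (intro bexI[of _ "space m - A"]) auto
    qed
  next
    case (Union E)
    have E[measurable]: "E i \<in> sets m" for i using Union(1) \<B>(2) by auto
    show ?case
    proof safe
      fix \<epsilon> :: real assume \<epsilon>: "0 < \<epsilon>"
      define U where "U n = (\<Union>i<n. E i)" for n
      have "(\<lambda>n. measure m (U n)) \<longlonglongrightarrow> measure m (\<Union>n. U n)"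
        unfolding U_def by (intro finite_Lim_measure_incseq) (force simp: incseq_def)+
      moreover have U_all: "(\<Union>n. U n) = (\<Union>i. E i)" unfolding U_def by auto
      ultimately have "\<forall>\<^sub>F n in sequentially. measure m (\<Union>i. E i) - \<epsilon> / 2 < measure m (U n)"
        using \<epsilon> by (intro order_tendstoD(1)) auto
      then obtain n where n: "measure m (\<Union>i. E i) - measure m (U n) < \<epsilon> / 2"
        by (metis (lifting) add.commute diff_less_eq eventually_at_top_linorder le_refl)
      have tail: "measure m ((\<Union>i. E i) - U n) < \<epsilon> / 2"
        using n by (subst finite_measure_Diff) (auto simp: U_def)
      have "\<exists>A\<in>\<A>. measure m (sym_diff (U k) A) < \<delta>" if "0 < \<delta>" for k \<delta>
        using that
      proof (induction k arbitrary: \<delta>)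
        case 0
        then show ?case using A_empty by (auto simp: U_def intro!: bexI[of _ "{}"])
      next
        case (Suc k)
        obtain A where A: "A \<in> \<A>" "measure m (sym_diff (U k) A) < \<delta> / 2"
          using Suc.IH[of "\<delta> / 2"] Suc.prems by auto
        obtain B where B: "B \<in> \<A>" "measure m (sym_diff (E k) B) < \<delta> / 2"
          using Union.IH[of k] Suc.prems half_gt_zero by blast
        have [measurable]: "A \<in> sets m" "B \<in> sets m" "U k \<in> sets m"
          using A B Am by (auto simp: U_def)
        have "measure m (sym_diff (U (Suc k)) (A \<union> B))
            \<le> measure m (sym_diff (U k) A \<union> sym_diff (E k) B)"
          by (intro finite_measure_mono) (auto simp: U_def lessThan_Suc)
        also have "\<dots> \<le> measure m (sym_diff (U k) A) + measure m (sym_diff (E k) B)"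
          by (intro measure_Un_le) auto
        also have "\<dots> < \<delta>" using A B by simp
        finally show ?case using A_Un[OF A(1) B(1)] by blast
      qed
      from this[of "\<epsilon> / 2" n] obtain A where A: "A \<in> \<A>" "measure m (sym_diff (U n) A) < \<epsilon> / 2"
        using \<epsilon> by auto
      have [measurable]: "A \<in> sets m" "U n \<in> sets m" using A Am by (auto simp: U_def)
      have "measure m (sym_diff (\<Union>i. E i) A)
          \<le> measure m (((\<Union>i. E i) - U n) \<union> sym_diff (U n) A)"
        by (intro finite_measure_mono) (auto simp: U_def)
      also have "\<dots> \<le> measure m ((\<Union>i. E i) - U n) + measure m (sym_diff (U n) A)"
        by (intro measure_Un_le) auto
      also have "\<dots> < \<epsilon>" using A(2) tail by simp
      finally show "\<exists>A\<in>\<A>. measure m (sym_diff (\<Union>i. E i) A) < \<epsilon>"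
        using A(1) by blast
    qed
  qed
  obtain C :: "nat \<Rightarrow> 'a set" where C: "range C = \<A>"
    using cA A_empty by (metis empty_iff range_from_nat_into)
  show ?thesis
  proof (intro exI[of _ C] conjI allI ballI impI)
    show "C k \<in> sets m" for k using C Am by auto
    show "\<exists>k. measure m (sym_diff E (C k)) < \<epsilon>" if "E \<in> sets m" "0 < \<epsilon>" for E \<epsilon>
    proof -
      from that obtain A where "A \<in> \<A>" "measure m (sym_diff E A) < \<epsilon>"
        using approx \<B>(2) by blast
      then show ?thesis using C by auto
    qed
  qed
qed

text \<open>A sequence of sets is recorded, up to null sets, by the distances of its terms to the sets of
  a countable family.\<close>

definition set_code :: "'g measure \<Rightarrow> (nat \<Rightarrow> 'g set) \<Rightarrow> (nat \<Rightarrow> 'g set) \<Rightarrow> nat \<Rightarrow> real" where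
  "set_code m C E n = (case prod_decode n of (i, k) \<Rightarrow> measure m (sym_diff (E i) (C k)))"

text \<open>If \<open>z\<close> is a code, the set of this index has distance less than \<open>(1/2) ^ n\<close> from the
  \<open>i\<close>-th coded set. If no index qualifies, the value is unspecified but still depends measurably on
  \<open>z\<close>.\<close>

definition best_index :: "(nat \<Rightarrow> real) \<Rightarrow> nat \<Rightarrow> nat \<Rightarrow> nat" where
  "best_index z i n = (LEAST k. z (prod_encode (i, k)) < (1/2) ^ n)"

text \<open>The upper limit of approximating sets; unlike a limit it is defined for every \<open>z\<close>, so decoding
  is a Borel operation on all sequences.\<close>

definition set_decode :: "'g measure \<Rightarrow> (nat \<Rightarrow> 'g set) \<Rightarrow> (nat \<Rightarrow> real) \<Rightarrow> nat \<Rightarrow> 'g set" where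
  "set_decode m C z i = {g \<in> space m. \<exists>\<^sub>\<infinity>n. g \<in> C (best_index z i n)}"

lemma measurable_best_index [measurable]: "(\<lambda>z. best_index z i n) \<in> measurable borel (count_space UNIV)"
  unfolding best_index_def by measurable

lemma set_decode_measurable:
  assumes [measurable]: "\<And>k. C k \<in> sets m"
  shows "Measurable.pred (borel \<Otimes>\<^sub>M m) (\<lambda>(z, g). g \<in> set_decode m C z i)"
proof -
  have [measurable]: "Measurable.pred (borel \<Otimes>\<^sub>M m) (\<lambda>(z, g). g \<in> C (best_index z i n))" for n
  proof -
    have "(\<lambda>(z, g). g \<in> C (best_index z i n)) = (\<lambda>(z, g). \<exists>k. best_index z i n = k \<and> g \<in> C k)"
      by auto
    also have "Measurable.pred (borel \<Otimes>\<^sub>M m) \<dots>" by measurable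
    finally show ?thesis .
  qed
  have "Measurable.pred (borel \<Otimes>\<^sub>M m) (\<lambda>x. \<exists>\<^sub>\<infinity>n. (case x of (z, g) \<Rightarrow> g \<in> C (best_index z i n)))"
    unfolding INFM_nat by measurable
  then show ?thesis
    by (subst measurable_cong[where g="\<lambda>x. \<exists>\<^sub>\<infinity>n. (case x of (z, g) \<Rightarrow> g \<in> C (best_index z i n))"])
       (auto simp: set_decode_def space_pair_measure)
qed

lemma set_decode_sets:
  assumes "\<And>k. C k \<in> sets m"
  shows "set_decode m C z i \<in> sets m"
proof -
  note set_decode_measurable[OF assms, measurable]
  have "{g \<in> space m. g \<in> set_decode m C z i} \<in> sets m" by measurable
  moreover have "{g \<in> space m. g \<in> set_decode m C z i} = set_decode m C z i"
    by (auto simp: set_decode_def)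
  ultimately show ?thesis by simp
qed

lemma set_code_cong_AE:
  assumes "\<And>i. E i \<in> sets m" "\<And>i. E' i \<in> sets m" "\<And>k. C k \<in> sets m"
    "\<And>i. AE g in m. g \<in> E i \<longleftrightarrow> g \<in> E' i"
  shows "set_code m C E = set_code m C E'"
proof
  fix n
  obtain i k where ik: "prod_decode n = (i, k)" by (cases "prod_decode n")
  have "AE g in m. g \<in> sym_diff (E i) (C k) \<longleftrightarrow> g \<in> sym_diff (E' i) (C k)"
    using assms(4)[of i] by eventually_elim auto
  then have "measure m (sym_diff (E i) (C k)) = measure m (sym_diff (E' i) (C k))"
    using assms(1-3) by (intro measure_eq_AE) auto
  then show "set_code m C E n = set_code m C E' n" by (simp add: set_code_def ik)
qed

text \<open>The approximating sets have summable distances to \<open>E i\<close>, so by Borel-Cantelli almost every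
  point belongs to only finitely many of the symmetric differences.\<close>

lemma set_decode_code:
  assumes m: "finite_measure m" and C: "\<And>k. C k \<in> sets m"
    and dense: "\<And>E \<epsilon>. E \<in> sets m \<Longrightarrow> 0 < \<epsilon> \<Longrightarrow> \<exists>k. measure m (sym_diff E (C k)) < \<epsilon>"
    and E: "\<And>i. E i \<in> sets m"
  shows "AE g in m. g \<in> set_decode m C (set_code m C E) i \<longleftrightarrow> g \<in> E i"
proof -
  interpret finite_measure m by fact
  define \<kappa> where "\<kappa> n = best_index (set_code m C E) i n" for n
  have \<kappa>: "measure m (sym_diff (E i) (C (\<kappa> n))) < (1/2) ^ n" for n
    using LeastI_ex[OF dense[OF E[of i], of "(1/2) ^ n"]]
    unfolding \<kappa>_def best_index_def set_code_def by simp
  have "summable (\<lambda>n. measure m (sym_diff (E i) (C (\<kappa> n))))"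
    by (rule summable_comparison_test'[of "\<lambda>n. (1/2) ^ n" 0]) (auto simp: \<kappa> less_imp_le)
  then have "AE g in m. \<forall>\<^sub>F n in sequentially. g \<in> space m - sym_diff (E i) (C (\<kappa> n))"
    using C E by (intro borel_cantelli_AE1) (auto simp: less_top[symmetric])
  then show ?thesis
    using AE_space
  proof eventually_elim
    case (elim g)
    then obtain n0 where n0: "\<And>n. n \<ge> n0 \<Longrightarrow> g \<in> E i \<longleftrightarrow> g \<in> C (\<kappa> n)"
      by (auto simp: eventually_sequentially)
    have "g \<in> set_decode m C (set_code m C E) i \<longleftrightarrow> (\<forall>k. \<exists>n\<ge>k. g \<in> C (\<kappa> n))"
      using elim(2) by (auto simp: set_decode_def \<kappa>_def INFM_nat_le)
    also have "\<dots> \<longleftrightarrow> g \<in> E i"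
      using n0 by (meson nat_le_linear order_trans order_refl)
    finally show ?case .
  qed
qed

section \<open>Contractive actions\<close>

text \<open>Otherwise there are sets of summable \<open>M\<close>-measure whose \<open>N\<close>-measure stays above \<open>\<epsilon>\<close>; their upper
  limit is \<open>M\<close>-null, but has \<open>N\<close>-measure at least \<open>\<epsilon>\<close>.\<close>

lemma absolutely_continuous_small:
  assumes M: "finite_measure M" and N: "finite_measure N" and sets: "sets N = sets M"
    and null: "\<And>A. A \<in> null_sets M \<Longrightarrow> A \<in> null_sets N" and \<epsilon>: "0 < \<epsilon>"
  shows "\<exists>\<delta>>0. \<forall>A\<in>sets M. measure M A < \<delta> \<longrightarrow> measure N A < \<epsilon>"
proof (rule ccontr)
  interpret M: finite_measure M by fact
  interpret N: finite_measure N by fact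
  assume "\<not> ?thesis"
  then have "\<forall>n. \<exists>A. A \<in> sets M \<and> measure M A < (1/2) ^ n \<and> \<epsilon> \<le> measure N A"
    by (metis not_less zero_less_divide_1_iff zero_less_numeral zero_less_power)
  then obtain A where A: "\<And>n. A n \<in> sets M" "\<And>n. measure M (A n) < (1/2) ^ n"
    "\<And>n. \<epsilon> \<le> measure N (A n)"
    by metis
  define D where "D n = (\<Union>k\<in>{n..}. A k)" for n
  have D: "D n \<in> sets M" for n using A(1) unfolding D_def by auto
  have "summable (\<lambda>n. measure M (A n))"
    by (rule summable_comparison_test'[of "\<lambda>n. (1/2) ^ n" 0]) (auto simp: A(2) less_imp_le)
  then have "AE x in M. \<forall>\<^sub>F n in sequentially. x \<in> space M - A n"
    using A(1) by (intro borel_cantelli_AE1) (auto simp: less_top[symmetric])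
  then have "AE x in M. x \<notin> (\<Inter>n. D n)"
    by eventually_elim (auto simp: D_def eventually_sequentially)
  then have "(\<Inter>n. D n) \<in> null_sets M"
    using D by (subst AE_iff_null_sets) auto
  then have "measure N (\<Inter>n. D n) = 0"
    using null by (auto simp: null_sets_def measure_def)
  moreover have "(\<lambda>n. measure N (D n)) \<longlonglongrightarrow> measure N (\<Inter>n. D n)"
    using D sets by (intro N.finite_Lim_measure_decseq) (force simp: D_def decseq_def)+
  moreover have "\<epsilon> \<le> measure N (D n)" for n
    using A(3)[of n] D sets
    by (intro order_trans[OF A(3)[of n]] N.finite_measure_mono) (auto simp: D_def)
  ultimately show False
    using \<epsilon> by (metis LIMSEQ_le_const not_less)
qed

lemma AE_distr_notin:
  assumes "f \<in> measurable M N" "D \<in> sets N"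
  shows "(AE y in distr M N f. y \<notin> D) \<longleftrightarrow> (AE x in M. f x \<notin> D)"
proof -
  have "{y \<in> space N. y \<notin> D} \<in> sets N" using assms(2) by measurable
  then show ?thesis by (rule AE_distr_iff[OF assms(1)])
qed

context quasi_invariant_space
begin

lemma act_mem: "g \<in> carrier L \<Longrightarrow> x \<in> X\<^sub>0 \<Longrightarrow> a g x \<in> X\<^sub>0"
  by (rule element_image) auto

lemma act_mult: "g \<in> carrier L \<Longrightarrow> h \<in> carrier L \<Longrightarrow> x \<in> X\<^sub>0 \<Longrightarrow> a (g \<otimes>\<^bsub>L\<^esub> h) x = a g (a h x)"
  by (rule composition_rule)

lemma act_inv:
  assumes "g \<in> carrier L" "x \<in> X\<^sub>0"
  shows "a (inv\<^bsub>L\<^esub> g) (a g x) = x" "a g (a (inv\<^bsub>L\<^esub> g) x) = x"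
proof -
  interpret group L using group_hom by (rule group_hom.axioms(1))
  show "a (inv\<^bsub>L\<^esub> g) (a g x) = x"
    using orbit_sym_aux[OF assms(1) assms(2) refl] .
  show "a g (a (inv\<^bsub>L\<^esub> g) x) = x"
    using orbit_sym_aux[OF inv_closed[OF assms(1)] assms(2) refl] assms(1) by simp
qed

lemma X0_subset: "X\<^sub>0 \<subseteq> space M"
  using sets.sets_into_space[OF sets_X0] .

lemma AE_X0: "AE x in M. x \<in> X\<^sub>0"
  using conull_X0 sets_X0 by (simp add: prob_eq_1)

lemma space_restrict_X0: "space (restrict_space M X\<^sub>0) = X\<^sub>0"
  using X0_subset by (auto simp: space_restrict_space)

lemma sets_restrict_X0: "B \<in> sets M \<Longrightarrow> B \<inter> X\<^sub>0 \<in> sets (restrict_space M X\<^sub>0)"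
  by (auto simp: sets_restrict_space)

lemma act_vimage_sets:
  assumes g: "g \<in> carrier L" and B: "B \<in> sets M"
  shows "{x \<in> X\<^sub>0. a g x \<in> B} \<in> sets M"
proof -
  have "a g -` (B \<inter> X\<^sub>0) \<inter> space (restrict_space M X\<^sub>0) \<in> sets (restrict_space M X\<^sub>0)"
    using measurable_sets[OF measurable_action_elem[OF g] sets_restrict_X0[OF B]] .
  also have "a g -` (B \<inter> X\<^sub>0) \<inter> space (restrict_space M X\<^sub>0) = {x \<in> X\<^sub>0. a g x \<in> B}"
    using act_mem[OF g] by (auto simp: space_restrict_X0)
  finally show ?thesis using sets_X0 by (simp add: sets_restrict_space_iff)
qed

text \<open>Quasi-invariance for arbitrary predicates: it suffices to move a measurable null set that
  contains the exceptional points.\<close>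

lemma AE_act:
  assumes g: "g \<in> carrier L" and P: "AE x in M. P x"
  shows "AE x in M. P (a g x)"
proof -
  obtain N where N: "N \<in> null_sets M" "{x \<in> space M. \<not> P x} \<subseteq> N"
    using P by (auto simp: eventually_ae_filter)
  have "N \<inter> X\<^sub>0 \<in> null_sets (restrict_space M X\<^sub>0)"
    using N(1) sets_X0 null_set_Int2[OF N(1) sets_X0] by (subst null_sets_restrict_space) auto
  then have "N \<inter> X\<^sub>0 \<in> null_sets (distr (restrict_space M X\<^sub>0) (restrict_space M X\<^sub>0) (a g))"
    using quasi_invariant[OF g] by simp
  then have "a g -` (N \<inter> X\<^sub>0) \<inter> X\<^sub>0 \<in> null_sets (restrict_space M X\<^sub>0)"
    by (simp add: null_sets_distr_iff[OF measurable_action_elem[OF g]] space_restrict_X0)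
  then have "a g -` (N \<inter> X\<^sub>0) \<inter> X\<^sub>0 \<in> null_sets M"
    using sets_X0 by (simp add: null_sets_restrict_space)
  then have "AE x in M. x \<notin> a g -` (N \<inter> X\<^sub>0) \<inter> X\<^sub>0"
    by (rule AE_not_in)
  then show ?thesis
    using AE_X0
  proof eventually_elim
    case (elim x)
    then have "a g x \<notin> N" "a g x \<in> X\<^sub>0" using act_mem[OF g] by auto
    then show ?case using N(2) X0_subset by auto
  qed
qed

text \<open>Extending the action by the identity gives a measurable map of the whole space, to which the
  lemmas on measurable maps apply.\<close>

lemma measurable_total_act:
  assumes g: "g \<in> carrier L"
  shows "(\<lambda>x. if x \<in> X\<^sub>0 then a g x else x) \<in> measurable M M"
proof (rule measurableI)
  fix x assume "x \<in> space M"
  then show "(if x \<in> X\<^sub>0 then a g x else x) \<in> space M"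
    using act_mem[OF g] X0_subset by auto
next
  fix B assume B: "B \<in> sets M"
  have "(\<lambda>x. if x \<in> X\<^sub>0 then a g x else x) -` B \<inter> space M = {x \<in> X\<^sub>0. a g x \<in> B} \<union> (B - X\<^sub>0)"
    using X0_subset sets.sets_into_space[OF B] by (auto split: if_splits)
  then show "(\<lambda>x. if x \<in> X\<^sub>0 then a g x else x) -` B \<inter> space M \<in> sets M"
    using act_vimage_sets[OF g B] B sets_X0 by auto
qed

lemma act_image_eq:
  assumes "g \<in> carrier L"
  shows "a g ` (B \<inter> X\<^sub>0) = {x \<in> X\<^sub>0. a (inv\<^bsub>L\<^esub> g) x \<in> B}"
proof -
  interpret group L using group_hom by (rule group_hom.axioms(1))
  show ?thesis
  proof (intro equalityI subsetI)
    fix x assume "x \<in> {x \<in> X\<^sub>0. a (inv\<^bsub>L\<^esub> g) x \<in> B}"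
    then show "x \<in> a g ` (B \<inter> X\<^sub>0)"
      using act_inv(2)[OF assms, of x] act_mem[of "inv\<^bsub>L\<^esub> g" x] assms
      by (intro image_eqI[of _ _ "a (inv\<^bsub>L\<^esub> g) x"]) auto
  qed (use assms act_inv(1) act_mem in auto)
qed

lemma act_small:
  assumes g: "g \<in> carrier L" and \<epsilon>: "0 < \<epsilon>"
  shows "\<exists>\<delta>>0. \<forall>A\<in>sets M. measure M A < \<delta> \<longrightarrow> measure M (a g ` (A \<inter> X\<^sub>0)) < \<epsilon>"
proof -
  interpret group L using group_hom by (rule group_hom.axioms(1))
  have ig: "inv\<^bsub>L\<^esub> g \<in> carrier L" using g by simp
  let ?R = "restrict_space M X\<^sub>0"
  have meas[measurable]: "a (inv\<^bsub>L\<^esub> g) \<in> measurable ?R M"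
    using measurable_action_elem[OF ig] by (simp add: measurable_restrict_space2_iff)
  define N where "N = distr ?R M (a (inv\<^bsub>L\<^esub> g))"
  have eN: "emeasure N A = emeasure M (a g ` (A \<inter> X\<^sub>0))" if A: "A \<in> sets M" for A
  proof -
    have "emeasure N A = emeasure ?R {x \<in> X\<^sub>0. a (inv\<^bsub>L\<^esub> g) x \<in> A}"
      unfolding N_def using A
      by (subst emeasure_distr) (auto simp: space_restrict_X0 intro!: arg_cong[where f="emeasure ?R"])
    also have "\<dots> = emeasure M {x \<in> X\<^sub>0. a (inv\<^bsub>L\<^esub> g) x \<in> A}"
      using sets_X0 by (intro emeasure_restrict_space) auto
    finally show ?thesis by (simp add: act_image_eq[OF g])
  qed
  have "finite_measure N"
    unfolding N_def
    by (intro finite_measure.finite_measure_distr finite_measure_restrict_space meas sets_X0) unfold_locales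
  have "\<exists>\<delta>>0. \<forall>A\<in>sets M. measure M A < \<delta> \<longrightarrow> measure N A < \<epsilon>"
  proof (rule absolutely_continuous_small[OF _ \<open>finite_measure N\<close> _ _ \<epsilon>])
    fix A assume A: "A \<in> null_sets M"
    then have A_sets: "A \<in> sets M" by auto
    have "AE x in M. a (inv\<^bsub>L\<^esub> g) x \<notin> A"
      using AE_act[OF ig AE_not_in[OF A]] .
    then have "AE x in M. x \<notin> {x \<in> X\<^sub>0. a (inv\<^bsub>L\<^esub> g) x \<in> A}"
      by eventually_elim auto
    then have "a g ` (A \<inter> X\<^sub>0) \<in> null_sets M"
      using act_vimage_sets[OF ig A_sets] unfolding act_image_eq[OF g]
      by (simp add: AE_iff_null_sets)
    then have "emeasure N A = 0" using eN[OF A_sets] by auto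
    then show "A \<in> null_sets N" using A_sets by (auto simp: N_def null_sets_def)
  qed (unfold_locales, simp add: N_def)
  then show ?thesis using eN by (auto simp: measure_def)
qed

text \<open>Let \<open>\<gamma>\<close> contract \<open>B\<close>, and write \<open>\<gamma>\<inverse> = k t\<close> with \<open>k \<in> K\<close> and \<open>t\<close> from a finite set of coset
  representatives. Then \<open>k\<inverse> B = t (\<gamma> B)\<close>, and the finitely many \<open>t\<close> map sufficiently small sets to
  small sets.\<close>

lemma contractive_finite_index_subgroup:
  assumes \<Gamma>: "subgroup \<Gamma> L" and contr: "contractive (L\<lparr>carrier := \<Gamma>\<rparr>) M X\<^sub>0 a"
    and K: "subgroup K L" "K \<subseteq> \<Gamma>" and fin: "finite_index L K \<Gamma>"
  shows "contractive (L\<lparr>carrier := K\<rparr>) M X\<^sub>0 a"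
proof -
  interpret group L using group_hom by (rule group_hom.axioms(1))
  interpret \<Gamma>: subgroup \<Gamma> L by fact
  interpret K: subgroup K L by fact
  define Q where "Q = (\<lambda>t. K #>\<^bsub>L\<^esub> t) ` \<Gamma>"
  have "rcosets\<^bsub>L\<lparr>carrier := \<Gamma>\<rparr>\<^esub> K = Q"
    unfolding RCOSETS_def r_coset_def Q_def by auto
  then have "finite Q" using fin by (simp add: finite_index_def)
  define R where "R = (\<lambda>D. SOME t. t \<in> \<Gamma> \<and> D = K #>\<^bsub>L\<^esub> t) ` Q"
  have R_fin: "finite R" unfolding R_def using \<open>finite Q\<close> by simp
  have repr: "\<exists>t. t \<in> \<Gamma> \<and> D = K #>\<^bsub>L\<^esub> t" if "D \<in> Q" for D using that by (auto simp: Q_def)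
  have R_sub: "R \<subseteq> \<Gamma>"
    unfolding R_def using someI_ex[OF repr] by auto
  have R_cover: "\<exists>k\<in>K. \<exists>t\<in>R. \<gamma> = k \<otimes>\<^bsub>L\<^esub> t" if \<gamma>: "\<gamma> \<in> \<Gamma>" for \<gamma>
  proof -
    have D: "K #>\<^bsub>L\<^esub> \<gamma> \<in> Q" using \<gamma> by (auto simp: Q_def)
    define t where "t = (SOME t. t \<in> \<Gamma> \<and> K #>\<^bsub>L\<^esub> \<gamma> = K #>\<^bsub>L\<^esub> t)"
    have t: "t \<in> R" "K #>\<^bsub>L\<^esub> \<gamma> = K #>\<^bsub>L\<^esub> t"
      using D someI_ex[OF repr[OF D]] by (auto simp: R_def t_def)
    have "\<gamma> \<in> K #>\<^bsub>L\<^esub> \<gamma>" using \<gamma> K.one_closed by (force simp: r_coset_def)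
    then have "\<gamma> \<in> K #>\<^bsub>L\<^esub> t" using t(2) by simp
    then show ?thesis using t(1) by (auto simp: r_coset_def)
  qed
  show ?thesis
    unfolding contractive_def
  proof (intro ballI impI allI)
    fix B and \<epsilon> :: real
    assume B: "B \<in> sets M" "measure M B < 1" and \<epsilon>: "0 < \<epsilon>"
    have "\<exists>\<delta>>0. \<forall>A\<in>sets M. measure M A < \<delta> \<longrightarrow> measure M (a t ` (A \<inter> X\<^sub>0)) < \<epsilon>"
      if "t \<in> R" for t
      using R_sub \<Gamma>.subset that by (intro act_small \<epsilon>) auto
    then obtain \<delta> where \<delta>: "\<And>t. t \<in> R \<Longrightarrow> 0 < \<delta> t"
      "\<And>t A. t \<in> R \<Longrightarrow> A \<in> sets M \<Longrightarrow> measure M A < \<delta> t \<Longrightarrow> measure M (a t ` (A \<inter> X\<^sub>0)) < \<epsilon>"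
      by metis
    define d where "d = Min (insert 1 (\<delta> ` R))"
    have "0 < d" unfolding d_def using R_fin \<delta>(1) by auto
    have d_le: "d \<le> \<delta> t" if "t \<in> R" for t unfolding d_def using R_fin that by auto
    obtain \<gamma> where \<gamma>: "\<gamma> \<in> \<Gamma>" "measure M (a \<gamma> ` (B \<inter> X\<^sub>0)) < d"
      using contr B \<open>0 < d\<close> by (auto simp: contractive_def)
    obtain k t where kt: "k \<in> K" "t \<in> R" "inv\<^bsub>L\<^esub> \<gamma> = k \<otimes>\<^bsub>L\<^esub> t"
      using R_cover[of "inv\<^bsub>L\<^esub> \<gamma>"] \<gamma>(1) by auto
    have mem: "k \<in> carrier L" "t \<in> carrier L" "\<gamma> \<in> carrier L"
      using kt \<gamma> R_sub \<Gamma>.subset K.subset by auto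
    have "inv\<^bsub>L\<^esub> k = t \<otimes>\<^bsub>L\<^esub> \<gamma>"
    proof -
      have "inv\<^bsub>L\<^esub> (k \<otimes>\<^bsub>L\<^esub> t) = \<gamma>" using kt(3)[symmetric] mem by simp
      then have "\<gamma> = inv\<^bsub>L\<^esub> t \<otimes>\<^bsub>L\<^esub> inv\<^bsub>L\<^esub> k" using mem by (simp add: inv_mult_group)
      then show ?thesis using mem by (simp add: m_assoc[symmetric])
    qed
    then have "a (inv\<^bsub>L\<^esub> k) ` (B \<inter> X\<^sub>0) = a t ` (a \<gamma> ` (B \<inter> X\<^sub>0) \<inter> X\<^sub>0)"
      using mem act_mem[of \<gamma>] by (auto simp: act_mult image_iff)
    also have "measure M \<dots> < \<epsilon>"
      using \<gamma>(2) d_le[OF kt(2)] act_vimage_sets[of "inv\<^bsub>L\<^esub> \<gamma>" B] mem B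
      by (intro \<delta>(2)[OF kt(2)]) (auto simp: act_image_eq)
    finally show "\<exists>g\<in>carrier (L\<lparr>carrier := K\<rparr>). measure M (a g ` (B \<inter> X\<^sub>0)) < \<epsilon>"
      using kt(1) by (intro bexI[of _ "inv\<^bsub>L\<^esub> k"]) auto
  qed
qed

text \<open>Let \<open>A\<close> be the set where \<open>\<phi> x \<in> B\<close> implies \<open>\<psi> x \<in> B\<close>, and suppose that it is not conull. Some
  \<open>g \<in> K\<close> maps \<open>A\<close> to a set \<open>E\<close> of small measure. Outside \<open>E\<close> the point \<open>\<phi> x\<close> lies in the
  translate \<open>D\<close> of \<open>B\<close> and \<open>\<psi> x\<close> does not. So \<open>D\<close> is almost null for the law of \<open>\<psi>\<close> and almost
  conull for the law of \<open>\<phi>\<close>, against absolute continuity. Equivariance enters through the assumption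
  that one and the same set \<open>D\<close> serves as the translate of \<open>B\<close> for both maps.\<close>

lemma contractive_maps_agree:
  assumes K: "subgroup K L" and contr: "contractive (L\<lparr>carrier := K\<rparr>) M X\<^sub>0 a"
    and \<phi>[measurable]: "\<phi> \<in> measurable M N" and \<psi>[measurable]: "\<psi> \<in> measurable M N"
    and equiv: "\<And>g B. g \<in> K \<Longrightarrow> B \<in> sets N \<Longrightarrow>
      \<exists>D\<in>sets N. (AE x in M. \<phi> (a g x) \<in> B \<longleftrightarrow> \<phi> x \<in> D) \<and> (AE x in M. \<psi> (a g x) \<in> B \<longleftrightarrow> \<psi> x \<in> D)"
    and ac: "\<And>D. D \<in> sets N \<Longrightarrow> AE x in M. \<psi> x \<notin> D \<Longrightarrow> AE x in M. \<phi> x \<notin> D"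
    and B: "B \<in> sets N"
  shows "AE x in M. \<phi> x \<in> B \<longleftrightarrow> \<psi> x \<in> B"
proof -
  interpret group L using group_hom by (rule group_hom.axioms(1))
  interpret K: subgroup K L by fact
  have "\<exists>\<delta>>0. \<forall>D\<in>sets N. measure (distr M N \<psi>) D < \<delta> \<longrightarrow> measure (distr M N \<phi>) D < 1/2"
  proof -
    have "D \<in> null_sets (distr M N f) \<longleftrightarrow> (AE x in M. f x \<notin> D)"
      if "f \<in> measurable M N" "D \<in> sets N" for f D
      using AE_iff_null_sets[of D "distr M N f"] AE_distr_notin[OF that] that(2) by simp
    then have "D \<in> null_sets (distr M N \<phi>)" if "D \<in> null_sets (distr M N \<psi>)" for D
      using ac[of D] that null_setsD2[OF that] by simp
    then show ?thesis
      using absolutely_continuous_small[OF finite_measure_distr[OF \<psi>] finite_measure_distr[OF \<phi>],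
          of "1/2"]
      by simp
  qed
  then obtain \<delta> where \<delta>: "0 < \<delta>"
    "\<And>D. D \<in> sets N \<Longrightarrow> measure M (\<psi> -` D \<inter> space M) < \<delta> \<Longrightarrow> measure M (\<phi> -` D \<inter> space M) < 1/2"
    by (auto simp: measure_distr)
  have half: "AE x in M. \<phi> x \<in> B \<longrightarrow> \<psi> x \<in> B" if B[measurable]: "B \<in> sets N" for B
  proof (rule ccontr)
    assume not: "\<not> (AE x in M. \<phi> x \<in> B \<longrightarrow> \<psi> x \<in> B)"
    define A where "A = {x \<in> space M. \<phi> x \<in> B \<longrightarrow> \<psi> x \<in> B}"
    have [measurable]: "A \<in> sets M" unfolding A_def by measurable
    have "measure M A \<noteq> 1"
      using not by (simp add: prob_eq_1 A_def)
    then have "measure M A < 1" using prob_le_1[of A] by linarith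
    then have "\<exists>g\<in>carrier (L\<lparr>carrier := K\<rparr>). measure M (a g ` (A \<inter> X\<^sub>0)) < min \<delta> (1/2)"
      using contr \<delta>(1) unfolding contractive_def by (meson \<open>A \<in> sets M\<close> half_gt_zero min_less_iff_conj zero_less_one)
    then obtain g where g: "g \<in> K" "measure M (a g ` (A \<inter> X\<^sub>0)) < min \<delta> (1/2)"
      by auto
    have gL: "g \<in> carrier L" "inv\<^bsub>L\<^esub> g \<in> carrier L" "inv\<^bsub>L\<^esub> g \<in> K"
      using g K.subset by auto
    obtain D where D[measurable]: "D \<in> sets N"
      and \<phi>D: "AE x in M. \<phi> (a (inv\<^bsub>L\<^esub> g) x) \<in> B \<longleftrightarrow> \<phi> x \<in> D"
      and \<psi>D: "AE x in M. \<psi> (a (inv\<^bsub>L\<^esub> g) x) \<in> B \<longleftrightarrow> \<psi> x \<in> D"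
      using equiv[OF gL(3) B] by auto
    define E where "E = a g ` (A \<inter> X\<^sub>0)"
    have E_eq: "E = {x \<in> X\<^sub>0. a (inv\<^bsub>L\<^esub> g) x \<in> A}"
      unfolding E_def by (rule act_image_eq[OF gL(1)])
    have [measurable]: "E \<in> sets M" unfolding E_eq by (rule act_vimage_sets) (use gL in auto)
    \<comment> \<open>Outside \<open>E\<close> the point \<open>g\<inverse> x\<close> is in the complement of \<open>A\<close>.\<close>
    have off_E: "AE x in M. x \<notin> E \<longrightarrow> \<phi> x \<in> D \<and> \<psi> x \<notin> D"
      using \<phi>D \<psi>D AE_X0
    proof eventually_elim
      case (elim x)
      have "a (inv\<^bsub>L\<^esub> g) x \<in> space M" using act_mem[OF gL(2) elim(3)] X0_subset by auto
      then show ?case using elim by (auto simp: E_eq A_def)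
    qed
    have "measure M (\<psi> -` D \<inter> space M) \<le> measure M E"
    proof (rule finite_measure_mono_AE)
      show "AE x in M. x \<in> \<psi> -` D \<inter> space M \<longrightarrow> x \<in> E"
        using off_E by eventually_elim auto
    qed measurable
    then have "measure M (\<phi> -` D \<inter> space M) < 1/2"
      using g(2) by (intro \<delta>(2)[OF D]) (simp add: E_def)
    moreover have "measure M (space M - E) \<le> measure M (\<phi> -` D \<inter> space M)"
    proof (rule finite_measure_mono_AE)
      show "AE x in M. x \<in> space M - E \<longrightarrow> x \<in> \<phi> -` D \<inter> space M"
        using off_E by eventually_elim auto
    qed measurable
    moreover have "measure M (space M - E) = 1 - measure M E" by (rule prob_compl) measurable
    ultimately show False using g(2) by (simp add: E_def)
  qed
  have "space N - B \<in> sets N" using B by auto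
  from half[OF B] half[OF this] AE_space show ?thesis
    by eventually_elim (use measurable_space[OF \<phi>] measurable_space[OF \<psi>] in auto)
qed

end

text \<open>The maps \<open>\<phi>\<close> and \<open>x \<mapsto> l\<inverse> \<phi> (l x)\<close> are both equivariant under \<open>\<Gamma> \<inter> l\<inverse> \<Gamma> l\<close>, which has finite index
  in \<open>\<Gamma>\<close>, so contractivity forces them to agree.\<close>

lemma contractive_equivariance_extends:
  fixes G :: "('g, 'm) monoid_scheme" (structure)
  assumes G: "group G" and \<Gamma>: "subgroup \<Gamma> G" and \<Lambda>: "subgroup \<Lambda> G" and sub: "\<Gamma> \<subseteq> \<Lambda>"
    and comm: "commensurates G \<Lambda> \<Gamma>"
    and X: "quasi_invariant_space G \<nu> X\<^sub>0 a"
    and contr: "contractive (G\<lparr>carrier := \<Gamma>\<rparr>) \<nu> X\<^sub>0 a"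
    and Y: "quasi_invariant_space (G\<lparr>carrier := \<Lambda>\<rparr>) \<eta> Y\<^sub>0 b"
    and \<phi>: "equivariant_map (G\<lparr>carrier := \<Gamma>\<rparr>) \<nu> a \<eta> b \<phi>"
  shows "equivariant_map (G\<lparr>carrier := \<Lambda>\<rparr>) \<nu> a \<eta> b \<phi>"
proof -
  interpret group G by fact
  interpret \<Gamma>: subgroup \<Gamma> G by fact
  interpret \<Lambda>: subgroup \<Lambda> G by fact
  interpret X: quasi_invariant_space G \<nu> X\<^sub>0 a by fact
  interpret Y: quasi_invariant_space "G\<lparr>carrier := \<Lambda>\<rparr>" \<eta> Y\<^sub>0 b by fact
  have inv_eq: "inv\<^bsub>G\<lparr>carrier := \<Lambda>\<rparr>\<^esub> l = inv l" if "l \<in> \<Lambda>" for l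
    using that by (rule m_inv_consistent[OF \<Lambda>])
  have \<phi>_meas[measurable]: "\<phi> \<in> measurable \<nu> \<eta>" and \<eta>: "distr \<nu> \<eta> \<phi> = \<eta>"
    and \<phi>_eq: "\<And>g. g \<in> \<Gamma> \<Longrightarrow> AE x in \<nu>. \<phi> (a g x) = b g (\<phi> x)"
    using \<phi> by (auto simp: equivariant_map_def)
  have \<phi>_Y0: "AE x in \<nu>. \<phi> x \<in> Y\<^sub>0"
    using Y.AE_X0 by (subst (asm) \<eta>[symmetric]) (rule AE_distrD[OF \<phi>_meas])
  have "AE x in \<nu>. \<phi> (a l x) = b l (\<phi> x)" if l: "l \<in> \<Lambda>" for l
  proof -
    have lG: "l \<in> carrier G" and il: "inv l \<in> \<Lambda>" "inv l \<in> carrier G"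
      using l \<Lambda>.subset by auto
    note Y_mult = Y.act_mult[simplified]
    \<comment> \<open>The intersection of \<open>\<Gamma>\<close> and \<open>l\<inverse> \<Gamma> l\<close>; commensuration is applied to \<open>inv l\<close>.\<close>
    define K where "K = {g \<in> \<Gamma>. l \<otimes> g \<otimes> inv l \<in> \<Gamma>}"
    have K_eq: "(inv l <# \<Gamma> #> inv (inv l)) \<inter> \<Gamma> = K"
    proof (intro equalityI subsetI)
      fix g assume "g \<in> (inv l <# \<Gamma> #> inv (inv l)) \<inter> \<Gamma>"
      then obtain h where h: "h \<in> \<Gamma>" "g = inv l \<otimes> h \<otimes> l" "g \<in> \<Gamma>"
        using lG by (auto simp: l_coset_def r_coset_def)
      have hG: "h \<in> carrier G" using h \<Gamma>.subset by auto
      have "l \<otimes> g \<otimes> inv l = h"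
        unfolding h(2) using lG hG by (simp add: m_assoc[symmetric]) (simp add: m_assoc)
      then show "g \<in> K" using h by (simp add: K_def)
    next
      fix g assume "g \<in> K"
      then have g: "g \<in> \<Gamma>" "l \<otimes> g \<otimes> inv l \<in> \<Gamma>" "g \<in> carrier G"
        using \<Gamma>.subset by (auto simp: K_def)
      have "g = inv l \<otimes> (l \<otimes> g \<otimes> inv l) \<otimes> l"
        using lG g(3) by (simp add: m_assoc[symmetric]) (simp add: m_assoc)
      then show "g \<in> (inv l <# \<Gamma> #> inv (inv l)) \<inter> \<Gamma>"
        using g lG by (auto simp: l_coset_def r_coset_def)
    qed
    have fin: "finite_index G K \<Gamma>"
      using comm il(1) K_eq by (auto simp: commensurates_def Let_def)
    have K_sub: "subgroup K G"
    proof
      show "K \<subseteq> carrier G" using \<Gamma>.subset by (auto simp: K_def)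
      show "\<one> \<in> K" using lG by (simp add: K_def)
    next
      fix g h assume "g \<in> K" "h \<in> K"
      then have gh: "g \<in> \<Gamma>" "h \<in> \<Gamma>" "l \<otimes> g \<otimes> inv l \<in> \<Gamma>" "l \<otimes> h \<otimes> inv l \<in> \<Gamma>"
        "g \<in> carrier G" "h \<in> carrier G"
        using \<Gamma>.subset by (auto simp: K_def)
      have "l \<otimes> (g \<otimes> h) \<otimes> inv l = (l \<otimes> g \<otimes> inv l) \<otimes> (l \<otimes> h \<otimes> inv l)"
        using lG gh by (simp add: m_assoc inv_solve_left)
      then show "g \<otimes> h \<in> K" using gh by (simp add: K_def)
    next
      fix g assume "g \<in> K"
      then have g: "g \<in> \<Gamma>" "l \<otimes> g \<otimes> inv l \<in> \<Gamma>" "g \<in> carrier G"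
        using \<Gamma>.subset by (auto simp: K_def)
      have "l \<otimes> inv g \<otimes> inv l = inv (l \<otimes> g \<otimes> inv l)"
        using lG g by (simp add: inv_mult_group m_assoc)
      then show "inv g \<in> K" using g by (simp add: K_def)
    qed
    have K_contr: "contractive (G\<lparr>carrier := K\<rparr>) \<nu> X\<^sub>0 a"
      by (rule X.contractive_finite_index_subgroup[OF \<Gamma> contr K_sub _ fin]) (auto simp: K_def)
    define al where "al x = (if x \<in> X\<^sub>0 then a l x else x)" for x
    define bi where "bi y = (if y \<in> Y\<^sub>0 then b (inv l) y else y)" for y
    have [measurable]: "al \<in> measurable \<nu> \<nu>"
      unfolding al_def by (rule X.measurable_total_act[OF lG])
    have [measurable]: "bi \<in> measurable \<eta> \<eta>"
      unfolding bi_def by (rule Y.measurable_total_act) (use il in simp)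
    define \<psi> where "\<psi> x = bi (\<phi> (al x))" for x
    have \<psi>_meas[measurable]: "\<psi> \<in> measurable \<nu> \<eta>" unfolding \<psi>_def by measurable
    have \<psi>_eq: "AE x in \<nu>. \<psi> x = b (inv l) (\<phi> (a l x)) \<and> \<phi> (a l x) \<in> Y\<^sub>0"
      using X.AE_X0 X.AE_act[OF lG \<phi>_Y0]
      by eventually_elim (auto simp: \<psi>_def al_def bi_def)
    have "AE x in \<nu>. \<phi> x \<in> B \<longleftrightarrow> \<psi> x \<in> B" if B: "B \<in> sets \<eta>" for B
    proof (rule X.contractive_maps_agree[OF K_sub K_contr \<phi>_meas \<psi>_meas _ _ B])
      fix g B assume g: "g \<in> K" and B: "B \<in> sets \<eta>"
      \<comment> \<open>Moving \<open>g\<close> past \<open>l\<close> turns it into an element of \<open>\<Gamma>\<close>, for which \<open>\<phi>\<close> is equivariant.\<close>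
      define h where "h = l \<otimes> g \<otimes> inv l"
      have gh: "g \<in> \<Gamma>" "h \<in> \<Gamma>" "g \<in> carrier G" "h \<in> carrier G" "g \<in> \<Lambda>" "h \<in> \<Lambda>"
        using g \<Gamma>.subset sub by (auto simp: K_def h_def)
      have lg: "l \<otimes> g = h \<otimes> l" "inv l \<otimes> h = g \<otimes> inv l"
        using lG gh(3) by (simp_all add: h_def m_assoc) (simp add: m_assoc[symmetric])
      define D where "D = {y \<in> Y\<^sub>0. b g y \<in> B}"
      have "D \<in> sets \<eta>" unfolding D_def by (rule Y.act_vimage_sets[OF _ B]) (use gh in simp)
      moreover have "AE x in \<nu>. \<phi> (a g x) \<in> B \<longleftrightarrow> \<phi> x \<in> D"
        using \<phi>_eq[OF gh(1)] \<phi>_Y0 by eventually_elim (auto simp: D_def)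
      moreover have "AE x in \<nu>. \<psi> (a g x) \<in> B \<longleftrightarrow> \<psi> x \<in> D"
        using X.AE_act[OF gh(3) \<psi>_eq] \<psi>_eq X.AE_act[OF lG \<phi>_eq[OF gh(2)]] X.AE_X0
      proof eventually_elim
        case (elim x)
        have "a l (a g x) = a h (a l x)"
          using X.act_mult[of l g x] X.act_mult[of h l x] lG gh elim(4) lg by simp
        then have "\<psi> (a g x) = b (inv l) (b h (\<phi> (a l x)))"
          using elim by simp
        also have "\<dots> = b (inv l \<otimes> h) (\<phi> (a l x))"
          using Y_mult[of "inv l" h] il gh elim(2) by simp
        also have "\<dots> = b g (\<psi> x)"
          using Y_mult[of g "inv l"] il gh elim(2) lg by simp
        finally have "\<psi> (a g x) = b g (\<psi> x)" .
        moreover have "\<psi> x \<in> Y\<^sub>0" using elim(2) Y.act_mem[of "inv l"] il by simp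
        ultimately show ?case by (simp add: D_def)
      qed
      ultimately show "\<exists>D\<in>sets \<eta>. (AE x in \<nu>. \<phi> (a g x) \<in> B \<longleftrightarrow> \<phi> x \<in> D) \<and> (AE x in \<nu>. \<psi> (a g x) \<in> B \<longleftrightarrow> \<psi> x \<in> D)"
        by blast
    next
      fix D assume D: "D \<in> sets \<eta>" and \<psi>D: "AE x in \<nu>. \<psi> x \<notin> D"
      define D' where "D' = {y \<in> Y\<^sub>0. b (inv l) y \<in> D}"
      have D': "D' \<in> sets \<eta>" unfolding D'_def by (rule Y.act_vimage_sets[OF _ D]) (use il in simp)
      have "AE x in \<nu>. \<phi> (a l x) \<notin> D'"
        using \<psi>D \<psi>_eq by eventually_elim (auto simp: D'_def)
      from X.AE_act[OF il(2) this] X.AE_X0 have "AE x in \<nu>. \<phi> x \<notin> D'"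
        by eventually_elim (simp add: X.act_inv[OF lG])
      then have "AE y in \<eta>. y \<notin> D'"
        using AE_distr_notin[OF \<phi>_meas D'] unfolding \<eta> by blast
      from Y.AE_act[OF _ this, of l] Y.AE_X0 have "AE y in \<eta>. y \<notin> D"
        using l by (auto elim!: eventually_elim2 simp: D'_def Y.act_mem Y.act_inv[of l, simplified inv_eq[OF l], simplified])
      then show "AE x in \<nu>. \<phi> x \<notin> D"
        using AE_distr_notin[OF \<phi>_meas D] unfolding \<eta> by blast
    qed
    then have "AE x in \<nu>. \<phi> x = \<psi> x"
      by (rule AE_eq_of_AE_mem_iff[OF Y.standard \<phi>_meas \<psi>_meas])
    then show ?thesis
      using \<psi>_eq
    proof eventually_elim
      case (elim x)
      then show ?case using Y.act_inv(2)[of l "\<phi> (a l x)"] l inv_eq[OF l] by simp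
    qed
  qed
  then show ?thesis using \<phi>_meas \<eta> by (simp add: equivariant_map_def)
qed

section \<open>Continuity of translation in Haar measure\<close>

lemma closure_of_sequence:
  assumes T: "first_countable T" and g: "g \<in> T closure_of S"
  shows "\<exists>h :: nat \<Rightarrow> 'a. (\<forall>n. h n \<in> S) \<and> limitin T h g sequentially"
proof -
  have gT: "g \<in> topspace T" using g by (meson in_closure_of)
  then obtain \<B> where \<B>: "countable \<B>" "\<And>V. V \<in> \<B> \<Longrightarrow> openin T V"
    "\<And>U. openin T U \<Longrightarrow> g \<in> U \<Longrightarrow> \<exists>V\<in>\<B>. g \<in> V \<and> V \<subseteq> U"
    using T unfolding first_countable_def by metis
  define \<B>' where "\<B>' = {V \<in> \<B>. g \<in> V}"
  have "\<B>' \<noteq> {}" using \<B>(3)[OF openin_topspace gT] by (auto simp: \<B>'_def)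
  moreover have "countable \<B>'" using \<B>(1) by (auto simp: \<B>'_def)
  ultimately obtain V :: "nat \<Rightarrow> 'a set" where V: "range V = \<B>'"
    by (metis range_from_nat_into)
  have V_op: "openin T (V i)" "g \<in> V i" for i
    using V \<B>(2) by (auto simp: \<B>'_def)
  have "openin T (\<Inter>i\<in>{..n}. V i)" "g \<in> (\<Inter>i\<in>{..n}. V i)" for n
    using V_op by (auto intro!: openin_INT)
  then have "\<exists>h. h \<in> S \<and> h \<in> (\<Inter>i\<in>{..n}. V i)" for n
    using g unfolding in_closure_of by meson
  then obtain h where h: "\<And>n. h n \<in> S" "\<And>n. h n \<in> (\<Inter>i\<in>{..n}. V i)" by metis
  have "limitin T h g sequentially"
    unfolding limitin_def
  proof (intro conjI allI impI gT)
    fix U assume U: "openin T U \<and> g \<in> U"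
    then obtain W where "W \<in> \<B>'" "W \<subseteq> U" using \<B>(3)[of U] by (auto simp: \<B>'_def)
    then obtain i where "V i \<subseteq> U" using V by auto
    then have "h n \<in> U" if "n \<ge> i" for n using h(2)[of n] that by auto
    then show "\<forall>\<^sub>F n in sequentially. h n \<in> U" by (auto simp: eventually_sequentially)
  qed
  then show ?thesis using h(1) by blast
qed

context lcsc_group
begin

lemma measurable_mult [measurable]: "(\<lambda>(g, h). g \<otimes> h) \<in> measurable (borel_of T \<Otimes>\<^sub>M borel_of T) (borel_of T)"
  by (rule continuous_map_prod_measurable[OF second_countable second_countable continuous_mult])

lemma measurable_inv [measurable]: "(\<lambda>g. inv g) \<in> measurable (borel_of T) (borel_of T)"
  by (rule continuous_map_measurable[OF continuous_inv])

lemma measurable_translate [measurable]: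
  assumes "g \<in> carrier G"
  shows "(\<lambda>x. g \<otimes> x) \<in> measurable (borel_of T) (borel_of T)"
proof -
  have "(\<lambda>x. (g, x)) \<in> measurable (borel_of T) (borel_of T \<Otimes>\<^sub>M borel_of T)"
    using assms topspace_eq by (intro measurable_Pair) auto
  from measurable_compose[OF this measurable_mult] show ?thesis by simp
qed

text \<open>The translate \<open>g\<inverse> E\<close>, described by a membership condition that is convenient for measurability
  proofs.\<close>

definition pull :: "'a \<Rightarrow> 'a set \<Rightarrow> 'a set" where
  "pull g E = {x \<in> carrier G. g \<otimes> x \<in> E}"

lemma pull_sets [measurable]:
  assumes "g \<in> carrier G" and E: "E \<in> sets (borel_of T)"
  shows "pull g E \<in> sets (borel_of T)"
proof -
  have "pull g E = (\<lambda>x. g \<otimes> x) -` E \<inter> space (borel_of T)"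
    by (auto simp: pull_def topspace_eq)
  then show ?thesis using measurable_sets[OF measurable_translate[OF assms(1)] E] by simp
qed

end

locale haar_group = lcsc_group G T for G (structure) and T +
  fixes \<mu>
  assumes left_haar: "left_haar_measure G T \<mu>"
begin

lemma space_haar [simp]: "space \<mu> = carrier G"
  and sets_haar [measurable_cong]: "sets \<mu> = sets (borel_of T)"
  using left_haar by (auto simp: left_haar_measure_def)

lemma emeasure_pull:
  assumes g: "g \<in> carrier G" and E: "E \<in> sets (borel_of T)"
  shows "emeasure \<mu> (pull g E) = emeasure \<mu> E"
proof -
  have EG: "E \<subseteq> carrier G" using sets.sets_into_space[OF E] by (simp add: topspace_eq)
  have "pull g E = inv g <# E"
  proof (intro equalityI subsetI)
    fix x assume "x \<in> pull g E"
    then have "x = inv g \<otimes> (g \<otimes> x)" "g \<otimes> x \<in> E"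
      using g by (auto simp: pull_def m_assoc[symmetric])
    then show "x \<in> inv g <# E" by (auto simp: l_coset_def)
  next
    fix x assume "x \<in> inv g <# E"
    then obtain e where e: "e \<in> E" "x = inv g \<otimes> e" by (auto simp: l_coset_def)
    then have "g \<otimes> x = e" using g EG by (auto simp: m_assoc[symmetric])
    then show "x \<in> pull g E" using e g EG by (auto simp: pull_def)
  qed
  then show ?thesis
    using left_haar g E sets_haar by (simp add: left_haar_measure_def)
qed

lemma measure_pull: "g \<in> carrier G \<Longrightarrow> E \<in> sets (borel_of T) \<Longrightarrow> measure \<mu> (pull g E) = measure \<mu> E"
  by (simp add: measure_def emeasure_pull)

text \<open>Local compactness gives open sets inside compact ones, and second countability reduces them to
  countably many.\<close>

lemma countable_open_cover:
  "\<exists>\<B>. countable \<B> \<and> \<Union>\<B> = carrier G \<and> (\<forall>U\<in>\<B>. openin T U \<and> emeasure \<mu> U < \<infinity>)"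
proof -
  obtain \<B> where \<B>: "countable \<B>" "\<And>V. V \<in> \<B> \<Longrightarrow> openin T V"
    "\<And>U x. openin T U \<Longrightarrow> x \<in> U \<Longrightarrow> \<exists>V\<in>\<B>. x \<in> V \<and> V \<subseteq> U"
    using second_countable unfolding second_countable_def by metis
  define \<C> where "\<C> = {V \<in> \<B>. emeasure \<mu> V < \<infinity>}"
  have "x \<in> \<Union>\<C>" if "x \<in> carrier G" for x
  proof -
    from that have "x \<in> topspace T" by (simp add: topspace_eq)
    with locally_compact obtain U K where UK: "openin T U" "compactin T K" "x \<in> U" "U \<subseteq> K"
      unfolding locally_compact_space_def by metis
    obtain V where V: "V \<in> \<B>" "x \<in> V" "V \<subseteq> U" using \<B>(3)[OF UK(1,3)] by blast
    have "closedin T K" using compactin_imp_closedin[OF Hausdorff UK(2)] .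
    then have "topspace T - (topspace T - K) \<in> sets (borel_of T)"
      by (intro sets.Diff openin_sets_borel_of) (auto simp: closedin_def)
    then have "K \<in> sets \<mu>" using compactin_subset_topspace[OF UK(2)] sets_haar
      by (simp add: double_diff)
    then have "emeasure \<mu> V \<le> emeasure \<mu> K"
      using V UK by (intro emeasure_mono) auto
    also have "\<dots> < \<infinity>" using left_haar UK(2) by (auto simp: left_haar_measure_def)
    finally show ?thesis using V by (auto simp: \<C>_def)
  qed
  moreover have "\<Union>\<C> \<subseteq> carrier G"
    using \<B>(2)[THEN openin_subset] by (auto simp: \<C>_def topspace_eq)
  moreover have "countable \<C>" using \<B>(1) by (auto simp: \<C>_def)
  ultimately show ?thesis using \<B>(2) by (intro exI[of _ \<C>]) (auto simp: \<C>_def)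
qed

sublocale haar: sigma_finite_measure \<mu>
proof
  obtain \<B> where \<B>: "countable \<B>" "\<Union>\<B> = carrier G" "\<forall>U\<in>\<B>. openin T U \<and> emeasure \<mu> U < \<infinity>"
    using countable_open_cover by blast
  have "\<B> \<subseteq> sets \<mu>" using \<B>(3) openin_sets_borel_of by (auto simp: sets_haar)
  then show "\<exists>A. countable A \<and> A \<subseteq> sets \<mu> \<and> \<Union>A = space \<mu> \<and> (\<forall>a\<in>A. emeasure \<mu> a \<noteq> \<infinity>)"
    using \<B> by (intro exI[of _ \<B>]) (auto simp: less_top)
qed

lemma open_positive_finite: "\<exists>U. openin T U \<and> emeasure \<mu> U \<noteq> 0 \<and> emeasure \<mu> U < \<infinity>"
proof (rule ccontr)
  assume neg: "\<not> ?thesis"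
  obtain \<B> where \<B>: "countable \<B>" "\<Union>\<B> = carrier G" "\<forall>U\<in>\<B>. openin T U \<and> emeasure \<mu> U < \<infinity>"
    using countable_open_cover by blast
  then have "U \<in> null_sets \<mu>" if "U \<in> \<B>" for U
    using neg that openin_sets_borel_of[of T U] by (auto simp: null_sets_def sets_haar)
  then have "\<Union>\<B> \<in> null_sets \<mu>"
    using null_sets_UN'[OF \<B>(1), of "\<lambda>U. U"] by simp
  then show False using left_haar \<B>(2) by (auto simp: left_haar_measure_def)
qed

lemma eventually_translate_in_open:
  assumes h: "limitin T h g sequentially" and V: "openin T V" and x: "x \<in> carrier G" "g \<otimes> x \<in> V"
  shows "\<forall>\<^sub>F n in sequentially. h n \<otimes> x \<in> V"
proof -
  have g: "g \<in> carrier G" using h topspace_eq by (auto simp: limitin_def)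
  have "continuous_map T (prod_topology T T) (\<lambda>k. (k, x))"
    using x topspace_eq by (intro continuous_map_pairedI) auto
  from continuous_map_compose[OF this continuous_mult]
  have "continuous_map T T (\<lambda>k. k \<otimes> x)" by (simp add: o_def)
  then have "openin T {k \<in> topspace T. k \<otimes> x \<in> V}"
    using V by (auto simp: continuous_map_def)
  moreover have "g \<in> {k \<in> topspace T. k \<otimes> x \<in> V}" using g x topspace_eq by auto
  ultimately have "\<forall>\<^sub>F n in sequentially. h n \<in> {k \<in> topspace T. k \<otimes> x \<in> V}"
    using h unfolding limitin_def by blast
  then show ?thesis by (rule eventually_mono) auto
qed

end

locale translation_limit = haar_group +
  fixes h :: "nat \<Rightarrow> 'a" and g
  assumes h: "\<And>n. h n \<in> carrier G" and lim: "limitin T h g sequentially"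
begin

lemma g: "g \<in> carrier G" using lim topspace_eq by (auto simp: limitin_def)

definition gap :: "nat \<Rightarrow> 'a set \<Rightarrow> 'a set" where
  "gap n E = sym_diff (pull (h n) E) (pull g E)"

lemma gap_sets: "E \<in> sets (borel_of T) \<Longrightarrow> gap n E \<in> sets \<mu>"
  using pull_sets[OF h] pull_sets[OF g] by (auto simp: gap_def sets_haar)

lemma pull_fmeasurable:
  assumes "k \<in> carrier G" "E \<in> sets (borel_of T)" "emeasure \<mu> E < \<infinity>"
  shows "pull k E \<in> fmeasurable \<mu>"
  using assms by (auto simp: fmeasurable_def sets_haar emeasure_pull pull_sets)

lemma gap_fmeasurable:
  assumes "E \<in> sets (borel_of T)" "emeasure \<mu> E < \<infinity>"
  shows "gap n E \<in> fmeasurable \<mu>"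
  using pull_fmeasurable[OF h[of n] assms] pull_fmeasurable[OF g assms] by (auto simp: gap_def)

lemma emeasure_gap_le:
  assumes E: "E \<in> sets (borel_of T)"
  shows "emeasure \<mu> (gap n E) \<le> 2 * emeasure \<mu> E"
proof -
  have "emeasure \<mu> (gap n E) \<le> emeasure \<mu> (pull (h n) E \<union> pull g E)"
    using pull_sets[OF h[of n] E] pull_sets[OF g E]
    by (intro emeasure_mono) (auto simp: gap_def sets_haar)
  also have "\<dots> \<le> emeasure \<mu> (pull (h n) E) + emeasure \<mu> (pull g E)"
    using pull_sets[OF h[of n] E] pull_sets[OF g E] by (intro emeasure_subadditive) (auto simp: sets_haar)
  finally show ?thesis using emeasure_pull[OF h[of n] E] emeasure_pull[OF g E] by (simp add: mult_2)
qed

text \<open>If \<open>g x\<close> lies in the open set \<open>V\<close>, then so does \<open>h n x\<close> for large \<open>n\<close>; hence the part of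
  \<open>g\<inverse> V\<close> outside \<open>(h n)\<inverse> V\<close> shrinks to measure zero. Both translates have the same finite
  measure, so the opposite difference has the same measure.\<close>

lemma gap_open:
  assumes V: "openin T V" and fin: "emeasure \<mu> V < \<infinity>"
  shows "(\<lambda>n. measure \<mu> (gap n V)) \<longlonglongrightarrow> 0"
proof -
  note Vs = openin_sets_borel_of[OF V]
  have fm: "pull (h n) V \<in> fmeasurable \<mu>" "pull g V \<in> fmeasurable \<mu>" for n
    using pull_fmeasurable[OF _ Vs fin] h g by auto
  define D where "D n = pull g V - pull (h n) V" for n
  have D: "D n \<in> fmeasurable \<mu>" for n unfolding D_def using fm by auto
  have "(\<lambda>n. \<integral>x. indicator (D n) x \<partial>\<mu>) \<longlonglongrightarrow> (\<integral>x. 0 \<partial>\<mu> :: real)"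
  proof (rule integral_dominated_convergence)
    show "integrable \<mu> (indicator (pull g V) :: _ \<Rightarrow> real)"
      using fm(2) by (auto simp: fmeasurable_def intro!: integrable_real_indicator)
    show "AE x in \<mu>. (\<lambda>n. indicator (D n) x :: real) \<longlonglongrightarrow> 0"
    proof (rule AE_I2)
      fix x assume "x \<in> space \<mu>"
      have "\<forall>\<^sub>F n in sequentially. x \<notin> D n"
      proof (cases "x \<in> pull g V")
        case True
        then show ?thesis
          using eventually_translate_in_open[OF lim V, of x]
          by (auto simp: D_def pull_def elim: eventually_mono)
      qed (auto simp: D_def)
      then show "(\<lambda>n. indicator (D n) x :: real) \<longlonglongrightarrow> 0"
        by (intro tendsto_eventually) (auto elim: eventually_mono)
    qed
    show "AE x in \<mu>. norm (indicator (D n) x :: real) \<le> indicator (pull g V) x" for n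
      by (auto simp: D_def indicator_def)
    show "(indicator (D n) :: _ \<Rightarrow> real) \<in> borel_measurable \<mu>" for n
      using D[of n] by (intro borel_measurable_indicator) auto
  qed simp
  then have lim0: "(\<lambda>n. measure \<mu> (D n)) \<longlonglongrightarrow> 0"
    using D sets.sets_into_space[OF fmeasurableD[OF D]] by (simp add: Int_absorb2)
  have "measure \<mu> (gap n V) = 2 * measure \<mu> (D n)" for n
  proof -
    have split: "measure \<mu> A = measure \<mu> (A - B) + measure \<mu> (A \<inter> B)"
      if "A \<in> fmeasurable \<mu>" "B \<in> fmeasurable \<mu>" for A B
    proof -
      have "measure \<mu> ((A - B) \<union> (A \<inter> B)) = measure \<mu> (A - B) + measure \<mu> (A \<inter> B)"
        using that fmeasurableD2[OF fmeasurable.Diff[OF that]] fmeasurableD2[OF fmeasurable.Int[OF that]]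
        by (intro measure_Union) auto
      moreover have "(A - B) \<union> (A \<inter> B) = A" by blast
      ultimately show ?thesis by simp
    qed
    have "measure \<mu> (gap n V) = measure \<mu> (pull (h n) V - pull g V) + measure \<mu> (D n)"
      unfolding gap_def D_def
      using fm(1)[of n] fm(2) fmeasurableD2[OF fmeasurable.Diff[OF fm(1)[of n] fm(2)]] 
        fmeasurableD2[OF fmeasurable.Diff[OF fm(2) fm(1)[of n]]]
      by (intro measure_Union) auto
    moreover note split[OF fm(1)[of n] fm(2)] split[OF fm(2) fm(1)[of n]]
    ultimately show ?thesis
      using measure_pull[OF h[of n] Vs] measure_pull[OF g Vs] by (simp add: D_def Int_commute)
  qed
  then show ?thesis using tendsto_mult_left[OF lim0, of 2] by simp
qed

text \<open>Continuity of translation in the mean. The property passes from open sets to all Borel sets: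
  the complement is taken inside \<open>U\<close>, where the gap is controlled by \<open>gap_open\<close>, and for a countable
  union the tail \<open>A - F N\<close> is uniformly small after translation, by invariance of the measure.\<close>

lemma gap_Borel:
  assumes U: "openin T U" and fin: "emeasure \<mu> U < \<infinity>" and E: "E \<in> sets (borel_of T)"
  shows "(\<lambda>n. measure \<mu> (gap n (E \<inter> U))) \<longlonglongrightarrow> 0"
proof -
  note Us = openin_sets_borel_of[OF U]
  have fin': "emeasure \<mu> A < \<infinity>" if "A \<subseteq> U" "A \<in> sets (borel_of T)" for A
    using emeasure_mono[of A U \<mu>] that Us fin by (auto simp: sets_haar)
  have "E \<in> sigma_sets (topspace T) {V. openin T V}" using E by (simp add: sets_borel_of)
  then show ?thesis
  proof induction
    case (Basic V)
    then show ?case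
      using U fin'[of "V \<inter> U"] openin_sets_borel_of[of T "V \<inter> U"] by (intro gap_open) auto
  next
    case Empty
    then show ?case by (simp add: gap_def pull_def)
  next
    case (Compl E)
    have Es: "E \<in> sets (borel_of T)" using Compl by (simp add: sets_borel_of)
    have Cs: "(topspace T - E) \<inter> U \<in> sets (borel_of T)"
      using sets.compl_sets[OF Es] Us by auto
    show ?case
    proof (rule tendsto_sandwich[OF _ _ tendsto_const])
      show "(\<lambda>n. measure \<mu> (gap n U) + measure \<mu> (gap n (E \<inter> U))) \<longlonglongrightarrow> 0"
        using tendsto_add[OF gap_open[OF U fin] Compl.IH] by simp
      have "measure \<mu> (gap n ((topspace T - E) \<inter> U)) \<le> measure \<mu> (gap n U) + measure \<mu> (gap n (E \<inter> U))" for n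
      proof -
        have "measure \<mu> (gap n ((topspace T - E) \<inter> U)) \<le> measure \<mu> (gap n U \<union> gap n (E \<inter> U))"
          using Es Us Cs Cs[unfolded topspace_eq] fin fin' h[of n] g
          by (intro measure_mono_fmeasurable fmeasurable.Un gap_fmeasurable gap_sets)
             (auto simp: gap_def pull_def topspace_eq)
        also have "\<dots> \<le> measure \<mu> (gap n U) + measure \<mu> (gap n (E \<inter> U))"
          using Es Us by (intro measure_Un_le gap_sets) auto
        finally show ?thesis .
      qed
      then show "\<forall>\<^sub>F n in sequentially. measure \<mu> (gap n ((topspace T - E) \<inter> U)) \<le> measure \<mu> (gap n U) + measure \<mu> (gap n (E \<inter> U))"
        by simp
    qed simp
  next
    case (Union E)
    have Es: "E i \<in> sets (borel_of T)" for i using Union by (simp add: sets_borel_of)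
    define F where "F N = (\<Union>i<N. E i \<inter> U)" for N
    define A where "A = (\<Union>i. E i) \<inter> U"
    have A_sets: "A \<in> sets (borel_of T)" and F_sets: "F N \<in> sets (borel_of T)" for N
      using Es Us by (auto simp: A_def F_def)
    have AF_fm: "A \<in> fmeasurable \<mu>" "F N \<in> fmeasurable \<mu>" for N
      using A_sets F_sets fin' by (auto simp: fmeasurable_def sets_haar A_def F_def)
    have F_lim: "\<exists>N. measure \<mu> (A - F N) < \<epsilon>" if "0 < \<epsilon>" for \<epsilon>
    proof -
      have "(\<lambda>N. measure \<mu> (A - F N)) \<longlonglongrightarrow> measure \<mu> (\<Inter>N. A - F N)"
      proof (rule Lim_measure_decseq)
        show "range (\<lambda>N. A - F N) \<subseteq> sets \<mu>" using A_sets F_sets by (auto simp: sets_haar)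
        show "decseq (\<lambda>N. A - F N)" by (force simp: decseq_def F_def)
        show "emeasure \<mu> (A - F N) \<noteq> \<infinity>" for N
          using fmeasurableD2[OF fmeasurable.Diff[OF AF_fm(1) AF_fm(2)]] by simp
      qed
      moreover have "(\<Inter>N. A - F N) = {}" by (auto simp: A_def F_def)
      ultimately have "(\<lambda>N. measure \<mu> (A - F N)) \<longlonglongrightarrow> 0" by (metis measure_empty)
      from order_tendstoD(2)[OF this that] show ?thesis by (auto simp: eventually_sequentially)
    qed
    have finite_unions: "(\<lambda>n. measure \<mu> (gap n (F N))) \<longlonglongrightarrow> 0" for N
    proof (rule tendsto_sandwich[OF _ _ tendsto_const])
      show "(\<lambda>n. \<Sum>i<N. measure \<mu> (gap n (E i \<inter> U))) \<longlonglongrightarrow> 0"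
        using tendsto_sum[of "{..<N}", OF Union.IH] by simp
      have "measure \<mu> (gap n (F N)) \<le> (\<Sum>i<N. measure \<mu> (gap n (E i \<inter> U)))" for n
      proof -
        have "measure \<mu> (gap n (F N)) \<le> measure \<mu> (\<Union>i<N. gap n (E i \<inter> U))"
          using Es Us fin' F_sets
          by (intro measure_mono_fmeasurable fmeasurable.finite_UN gap_fmeasurable gap_sets)
             (auto simp: gap_def pull_def F_def)
        also have "\<dots> \<le> (\<Sum>i<N. measure \<mu> (gap n (E i \<inter> U)))"
          using Es Us fin' by (intro measure_UNION_le gap_sets) auto
        finally show ?thesis .
      qed
      then show "\<forall>\<^sub>F n in sequentially. measure \<mu> (gap n (F N)) \<le> (\<Sum>i<N. measure \<mu> (gap n (E i \<inter> U)))"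
        by simp
    qed simp
    have "(\<lambda>n. measure \<mu> (gap n A)) \<longlonglongrightarrow> 0"
    proof (rule order_tendstoI)
      fix \<epsilon> :: real assume \<epsilon>: "0 < \<epsilon>"
      obtain N where N: "measure \<mu> (A - F N) < \<epsilon> / 4" using F_lim[of "\<epsilon> / 4"] \<epsilon> by auto
      have R: "A - F N \<in> sets (borel_of T)" "A - F N \<subseteq> U" using A_sets F_sets by (auto simp: A_def)
      have le: "measure \<mu> (gap n A) \<le> measure \<mu> (gap n (F N)) + 2 * measure \<mu> (A - F N)" for n
      proof -
        have "measure \<mu> (gap n A) \<le> measure \<mu> (gap n (F N) \<union> (pull (h n) (A - F N) \<union> pull g (A - F N)))"
          using A_sets F_sets R fin' h[of n] g
          by (intro measure_mono_fmeasurable fmeasurable.Un gap_fmeasurable pull_fmeasurable gap_sets)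
             (auto simp: gap_def pull_def F_def A_def)
        also have "\<dots> \<le> measure \<mu> (gap n (F N)) + measure \<mu> (pull (h n) (A - F N) \<union> pull g (A - F N))"
          using F_sets pull_sets[OF h[of n] R(1)] pull_sets[OF g R(1)] by (intro measure_Un_le gap_sets) (auto simp: sets_haar)
        also have "measure \<mu> (pull (h n) (A - F N) \<union> pull g (A - F N)) \<le> measure \<mu> (pull (h n) (A - F N)) + measure \<mu> (pull g (A - F N))"
          using pull_sets[OF h[of n] R(1)] pull_sets[OF g R(1)] by (intro measure_Un_le) (auto simp: sets_haar)
        finally show ?thesis using measure_pull[OF h[of n] R(1)] measure_pull[OF g R(1)] by simp
      qed
      have "\<forall>\<^sub>F n in sequentially. measure \<mu> (gap n (F N)) < \<epsilon> / 2"
        using \<epsilon> by (intro order_tendstoD(2)[OF finite_unions]) simp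
      then show "\<forall>\<^sub>F n in sequentially. measure \<mu> (gap n A) < \<epsilon>"
      proof eventually_elim
        case (elim n)
        then show ?case using le[of n] N by simp
      qed
    qed (simp add: order_less_le_trans[OF _ measure_nonneg])
    then show ?case by (simp add: A_def)
  qed
qed

end

section \<open>Invariance of the factor under the closure\<close>

lemma (in topological_quasi_invariant_space) action_graph_sets:
  assumes A: "A \<in> sets M"
  shows "{(t, x). t \<in> topspace T \<and> x \<in> X\<^sub>0 \<and> a t x \<in> A} \<in> sets (borel_of T \<Otimes>\<^sub>M M)"
proof -
  let ?P = "borel_of T \<Otimes>\<^sub>M M" and ?D = "topspace T \<times> X\<^sub>0"
  have D: "?D \<in> sets ?P" using sets_X0 sets.top[of "borel_of T"] by (auto intro: pair_measureI)
  have "(\<lambda>z. (fst z, snd z)) \<in> measurable (restrict_space ?P ?D) (borel_of T \<Otimes>\<^sub>M restrict_space M X\<^sub>0)"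
    by (intro measurable_Pair measurable_restrict_space1 measurable_restrict_space2 measurable_fst measurable_snd)
       (auto simp: space_restrict_space)
  then have "(\<lambda>z. case (fst z, snd z) of (t, x) \<Rightarrow> a t x) \<in> measurable (restrict_space ?P ?D) (restrict_space M X\<^sub>0)"
    by (rule measurable_compose[OF _ jointly_measurable])
  from measurable_sets[OF this sets_restrict_X0[OF A]]
  have "(\<lambda>z. case (fst z, snd z) of (t, x) \<Rightarrow> a t x) -` (A \<inter> X\<^sub>0) \<inter> space (restrict_space ?P ?D) \<in> sets ?P"
    using D by (simp add: sets_restrict_space_iff)
  moreover have "{(t, x). t \<in> topspace T \<and> x \<in> X\<^sub>0 \<and> a t x \<in> A} =
      (\<lambda>z. case (fst z, snd z) of (t, x) \<Rightarrow> a t x) -` (A \<inter> X\<^sub>0) \<inter> space (restrict_space ?P ?D)"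
  proof -
    have "a t x \<in> X\<^sub>0" if "t \<in> topspace T" "x \<in> X\<^sub>0" for t x
      using measurable_space[OF jointly_measurable, of "(t, x)"] that
      by (simp add: space_pair_measure space_restrict_X0)
    then show ?thesis using X0_subset by (auto simp: space_restrict_space space_pair_measure)
  qed
  ultimately show ?thesis by simp
qed

context translation_limit
begin

text \<open>For fixed \<open>x\<close> the visit set \<open>{t. a t x \<in> A}\<close> is Borel, so its translates by \<open>h n\<close> converge inside
  \<open>U\<close> by \<open>gap_Borel\<close>. Integration over \<open>x\<close> gives convergence in \<open>L\<^sup>1\<close> of the product measure, and along
  a subsequence pointwise convergence at almost every pair \<open>(t, x)\<close>. A good \<open>t\<close> is fixed and then
  removed by substituting \<open>t\<inverse> x\<close> for \<open>x\<close>, which is where quasi-invariance is used.\<close>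

lemma AE_translates_agree_subsequence:
  assumes X: "topological_quasi_invariant_space G T \<nu> X\<^sub>0 a" and A: "A \<in> sets \<nu>"
  shows "\<exists>r :: nat \<Rightarrow> nat. strict_mono r \<and>
    (AE x in \<nu>. \<forall>\<^sub>F n in sequentially. (a (h (r n)) x \<in> A) = (a g x \<in> A))"
proof -
  interpret X: topological_quasi_invariant_space G T \<nu> X\<^sub>0 a by fact
  interpret P: pair_sigma_finite \<mu> \<nu>
    by (intro pair_sigma_finite.intro haar.sigma_finite_measure_axioms X.sigma_finite_measure_axioms)
  obtain U where U: "openin T U" "emeasure \<mu> U \<noteq> 0" "emeasure \<mu> U < \<infinity>"
    using open_positive_finite by blast
  note Us = openin_sets_borel_of[OF U(1)]
  define F where "F x = {t \<in> carrier G. a t x \<in> A}" for x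
  \<comment> \<open>The factor \<open>U\<close> keeps the measure of these sets finite, although Haar measure may be infinite.\<close>
  define W where "W k = {(t, x). t \<in> carrier G \<and> x \<in> X\<^sub>0 \<and> k \<otimes> t \<in> U \<and> a (k \<otimes> t) x \<in> A}" for k
  have W_sets: "W k \<in> sets (\<mu> \<Otimes>\<^sub>M \<nu>)" if k: "k \<in> carrier G" for k
  proof -
    define Q where "Q = {(t, x). t \<in> topspace T \<and> x \<in> X\<^sub>0 \<and> a t x \<in> A} \<inter> (U \<times> space \<nu>)"
    have Q: "Q \<in> sets (borel_of T \<Otimes>\<^sub>M \<nu>)"
      unfolding Q_def using X.action_graph_sets[OF A] Us by (intro sets.Int pair_measureI) auto
    have "(\<lambda>z. (k \<otimes> fst z, snd z)) \<in> measurable (borel_of T \<Otimes>\<^sub>M \<nu>) (borel_of T \<Otimes>\<^sub>M \<nu>)"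
      using measurable_translate[OF k] by (intro measurable_Pair measurable_compose[OF measurable_fst] measurable_snd)
    from measurable_sets[OF this Q]
    have "(\<lambda>z. (k \<otimes> fst z, snd z)) -` Q \<inter> space (borel_of T \<Otimes>\<^sub>M \<nu>) \<in> sets (borel_of T \<Otimes>\<^sub>M \<nu>)" .
    also have "(\<lambda>z. (k \<otimes> fst z, snd z)) -` Q \<inter> space (borel_of T \<Otimes>\<^sub>M \<nu>) = W k"
      using k X.X0_subset by (auto simp: Q_def W_def space_pair_measure topspace_eq)
    also have "sets (borel_of T \<Otimes>\<^sub>M \<nu>) = sets (\<mu> \<Otimes>\<^sub>M \<nu>)"
      by (intro sets_pair_measure_cong) (auto simp: sets_haar)
    finally show ?thesis .
  qed
  \<comment> \<open>The section of \<open>S n\<close> at \<open>x\<close> is a gap in the sense of \<open>gap_Borel\<close>.\<close>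
  define S where "S n = sym_diff (W (h n)) (W g)" for n
  have S_sets[measurable]: "S n \<in> sets (\<mu> \<Otimes>\<^sub>M \<nu>)" for n
    unfolding S_def using W_sets[OF h[of n]] W_sets[OF g] by auto
  have F_sets: "F x \<in> sets (borel_of T)" if x: "x \<in> X\<^sub>0" for x
  proof -
    have "(\<lambda>t. (t, x)) -` {(t, x). t \<in> topspace T \<and> x \<in> X\<^sub>0 \<and> a t x \<in> A} \<in> sets (borel_of T)"
      by (rule sets_Pair2[OF X.action_graph_sets[OF A]])
    moreover have "F x = (\<lambda>t. (t, x)) -` {(t, x). t \<in> topspace T \<and> x \<in> X\<^sub>0 \<and> a t x \<in> A}"
      using x by (auto simp: F_def topspace_eq)
    ultimately show ?thesis by simp
  qed
  have slice: "(\<lambda>t. (t, x)) -` S n = (if x \<in> X\<^sub>0 then gap n (F x \<inter> U) else {})" for n x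
    using h[of n] g by (auto simp: S_def W_def gap_def pull_def F_def)
  have emeasure_S: "emeasure (\<mu> \<Otimes>\<^sub>M \<nu>) (S n) = (\<integral>\<^sup>+x. emeasure \<mu> ((\<lambda>t. (t, x)) -` S n) \<partial>\<nu>)" for n
    by (rule P.emeasure_pair_measure_alt2[OF S_sets])
  have FU_sets: "F x \<inter> U \<in> sets (borel_of T)" if "x \<in> X\<^sub>0" for x
    using F_sets[OF that] Us by auto
  have FU_le: "emeasure \<mu> (F x \<inter> U) \<le> emeasure \<mu> U" for x
    using Us by (intro emeasure_mono) (auto simp: sets_haar)
  have bound: "emeasure \<mu> ((\<lambda>t. (t, x)) -` S n) \<le> 2 * emeasure \<mu> U" for n x
  proof (cases "x \<in> X\<^sub>0")
    case True
    have "emeasure \<mu> (gap n (F x \<inter> U)) \<le> 2 * emeasure \<mu> (F x \<inter> U)"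
      by (rule emeasure_gap_le[OF FU_sets[OF True]])
    also have "\<dots> \<le> 2 * emeasure \<mu> U"
      by (rule mult_left_mono[OF FU_le]) simp
    finally show ?thesis using True by (simp add: slice)
  qed (simp add: slice)
  have fin: "2 * emeasure \<mu> U < \<infinity>" using U(3) by (simp add: ennreal_mult_less_top)
  have "(\<lambda>n. \<integral>\<^sup>+x. emeasure \<mu> ((\<lambda>t. (t, x)) -` S n) \<partial>\<nu>) \<longlonglongrightarrow> (\<integral>\<^sup>+x. 0 \<partial>\<nu>)"
  proof (rule nn_integral_dominated_convergence)
    show "(\<integral>\<^sup>+x. 2 * emeasure \<mu> U \<partial>\<nu>) < \<infinity>" using fin by (simp add: X.emeasure_space_1)
    show "(\<lambda>x. emeasure \<mu> ((\<lambda>t. (t, x)) -` S n)) \<in> borel_measurable \<nu>" for n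
      by (rule P.measurable_emeasure_Pair2[OF S_sets])
    show "AE x in \<nu>. (\<lambda>n. emeasure \<mu> ((\<lambda>t. (t, x)) -` S n)) \<longlonglongrightarrow> 0"
      using X.AE_X0
    proof eventually_elim
      case (elim x)
      have fm: "gap n (F x \<inter> U) \<in> fmeasurable \<mu>" for n
        using FU_sets[OF elim] FU_le[of x] U(3) by (intro gap_fmeasurable) auto
      have "(\<lambda>n. ennreal (measure \<mu> (gap n (F x \<inter> U)))) \<longlonglongrightarrow> ennreal 0"
        by (intro tendsto_ennrealI gap_Borel[OF U(1,3) F_sets[OF elim]])
      then show ?case
        using elim fmeasurableD2[OF fm] by (simp add: slice emeasure_eq_ennreal_measure)
    qed
  qed (use bound in auto)
  then have "(\<lambda>n. emeasure (\<mu> \<Otimes>\<^sub>M \<nu>) (S n)) \<longlonglongrightarrow> 0" by (simp add: emeasure_S)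
  moreover have S_fin: "emeasure (\<mu> \<Otimes>\<^sub>M \<nu>) (S n) < \<infinity>" for n
  proof -
    have "emeasure (\<mu> \<Otimes>\<^sub>M \<nu>) (S n) \<le> (\<integral>\<^sup>+x. 2 * emeasure \<mu> U \<partial>\<nu>)"
      unfolding emeasure_S using bound by (intro nn_integral_mono)
    also have "\<dots> < \<infinity>" using fin by (simp add: X.emeasure_space_1)
    finally show ?thesis .
  qed
  ultimately have "(\<lambda>n. measure (\<mu> \<Otimes>\<^sub>M \<nu>) (S n)) \<longlonglongrightarrow> 0"
    using tendsto_enn2real[of "\<lambda>n. emeasure (\<mu> \<Otimes>\<^sub>M \<nu>) (S n)" 0 sequentially]
    by (simp add: measure_def)
  then have L1: "(\<lambda>n. \<integral>z. norm (indicator (S n) z :: real) \<partial>(\<mu> \<Otimes>\<^sub>M \<nu>)) \<longlonglongrightarrow> 0"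
    using S_sets by simp
  have "integrable (\<mu> \<Otimes>\<^sub>M \<nu>) (indicator (S n) :: _ \<Rightarrow> real)" for n
    using S_fin by (intro integrable_real_indicator) auto
  from tendsto_L1_AE_subseq[OF this L1] obtain r :: "nat \<Rightarrow> nat" where r: "strict_mono r"
    "AE z in \<mu> \<Otimes>\<^sub>M \<nu>. (\<lambda>n. indicator (S (r n)) z :: real) \<longlonglongrightarrow> 0" by blast
  from P.AE_pair[OF r(2)]
  have ae: "AE t in \<mu>. AE x in \<nu>. (\<lambda>n. indicator (S (r n)) (t, x) :: real) \<longlonglongrightarrow> 0" .
  have "\<exists>t\<in>pull g U. AE x in \<nu>. (\<lambda>n. indicator (S (r n)) (t, x) :: real) \<longlonglongrightarrow> 0"
  proof (rule ccontr)
    assume "\<not> ?thesis"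
    with ae have "AE t in \<mu>. t \<notin> pull g U" by (auto elim: eventually_mono)
    then have "emeasure \<mu> (pull g U) = 0"
      using pull_sets[OF g Us] by (subst (asm) AE_iff_null_sets[symmetric]) (auto simp: sets_haar)
    then show False using U(2) emeasure_pull[OF g Us] by simp
  qed
  \<comment> \<open>For this \<open>t\<close> the restriction to \<open>U\<close> disappears for large \<open>n\<close>, because \<open>h n t\<close> enters the open set \<open>U\<close>.\<close>
  then obtain t where t: "t \<in> carrier G" "g \<otimes> t \<in> U"
    and ae_t: "AE x in \<nu>. (\<lambda>n. indicator (S (r n)) (t, x) :: real) \<longlonglongrightarrow> 0"
    by (auto simp: pull_def)
  have "\<forall>\<^sub>F n in sequentially. h n \<otimes> t \<in> U"
    by (rule eventually_translate_in_open[OF lim U(1) t])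
  then have ev_U: "\<forall>\<^sub>F n in sequentially. h (r n) \<otimes> t \<in> U"
    using filterlim_subseq[OF r(1)] by (rule eventually_compose_filterlim)
  have "AE x in \<nu>. \<forall>\<^sub>F n in sequentially. (a (h (r n) \<otimes> t) x \<in> A) = (a (g \<otimes> t) x \<in> A)"
    using ae_t X.AE_X0
  proof eventually_elim
    case (elim x)
    have "\<forall>\<^sub>F n in sequentially. indicator (S (r n)) (t, x) < (1 :: real)"
      using elim(1) by (rule order_tendstoD) simp
    then show ?case
      using ev_U
    proof eventually_elim
      case (elim n)
      then have "(t, x) \<notin> S (r n)" by (auto simp: indicator_def split: if_splits)
      then show ?case using t elim(2) \<open>x \<in> X\<^sub>0\<close> by (auto simp: S_def W_def)
    qed
  qed
  from X.AE_act[OF inv_closed[OF t(1)] this] X.AE_X0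
  have "AE x in \<nu>. \<forall>\<^sub>F n in sequentially. (a (h (r n)) x \<in> A) = (a g x \<in> A)"
  proof eventually_elim
    case (elim x)
    have "a (k \<otimes> t) (a (inv t) x) = a k x" if k: "k \<in> carrier G" for k
      using X.act_mult[of "k \<otimes> t" "inv t" x] k t elim(2) by (simp add: m_assoc)
    then show ?case using elim(1) h g by simp
  qed
  then show ?thesis using r(1) by blast
qed

end

text \<open>For \<open>g \<in> \<Lambda>\<close> this is equivariance. A general \<open>g\<close> is a limit of elements of \<open>\<Lambda>\<close>, and the
  predicates of a suitable subsequence converge almost everywhere.\<close>

lemma (in haar_group) equivariant_factor_invariant:
  assumes X: "topological_quasi_invariant_space G T \<nu> X\<^sub>0 a"
    and \<Lambda>: "subgroup \<Lambda> G" and dense: "T closure_of \<Lambda> = carrier G"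
    and Y: "quasi_invariant_space (G\<lparr>carrier := \<Lambda>\<rparr>) \<eta> Y\<^sub>0 b"
    and \<phi>: "equivariant_map (G\<lparr>carrier := \<Lambda>\<rparr>) \<nu> a \<eta> b \<phi>"
    and g: "g \<in> carrier G" and B: "B \<in> sets \<eta>"
  shows "determined_by \<nu> \<eta> \<phi> (\<lambda>x. \<phi> (a g x) \<in> B)"
proof -
  interpret X: topological_quasi_invariant_space G T \<nu> X\<^sub>0 a by fact
  interpret Y: quasi_invariant_space "G\<lparr>carrier := \<Lambda>\<rparr>" \<eta> Y\<^sub>0 b by fact
  have \<phi>_meas[measurable]: "\<phi> \<in> measurable \<nu> \<eta>" and \<eta>: "distr \<nu> \<eta> \<phi> = \<eta>"
    and \<phi>_eq: "\<And>l. l \<in> \<Lambda> \<Longrightarrow> AE x in \<nu>. \<phi> (a l x) = b l (\<phi> x)"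
    using \<phi> by (auto simp: equivariant_map_def)
  have \<phi>_Y0: "AE x in \<nu>. \<phi> x \<in> Y\<^sub>0"
    using Y.AE_X0 by (subst (asm) \<eta>[symmetric]) (rule AE_distrD[OF \<phi>_meas])
  have "first_countable T" using second_countable by (rule second_countable_imp_first_countable)
  then obtain h :: "nat \<Rightarrow> 'a" where h\<Lambda>: "\<And>n. h n \<in> \<Lambda>" "limitin T h g sequentially"
    using closure_of_sequence[of T g \<Lambda>] dense g by auto
  have hG: "h n \<in> carrier G" for n using h\<Lambda>(1) \<Lambda> by (meson subgroup.mem_carrier)
  interpret translation_limit G T \<mu> h g
    by unfold_locales (use hG h\<Lambda> in auto)
  define A where "A = \<phi> -` B \<inter> space \<nu>"
  have A: "A \<in> sets \<nu>" using B unfolding A_def by measurable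
  obtain r :: "nat \<Rightarrow> nat" where
    r: "AE x in \<nu>. \<forall>\<^sub>F n in sequentially. (a (h (r n)) x \<in> A) = (a g x \<in> A)"
    using AE_translates_agree_subsequence[OF X A] by blast
  have in_A: "a k x \<in> A \<longleftrightarrow> \<phi> (a k x) \<in> B" if "k \<in> carrier G" "x \<in> X\<^sub>0" for k x
    using X.act_mem[OF that] X.X0_subset by (auto simp: A_def)
  show ?thesis
  proof (rule determined_by_limit[where P="\<lambda>n x. a (h (r n)) x \<in> A"])
    fix n
    have l: "h (r n) \<in> \<Lambda>" by (rule h\<Lambda>(1))
    define D where "D = {y \<in> Y\<^sub>0. b (h (r n)) y \<in> B}"
    have "D \<in> sets \<eta>" unfolding D_def using l by (intro Y.act_vimage_sets B) simp
    moreover have "AE x in \<nu>. a (h (r n)) x \<in> A \<longleftrightarrow> \<phi> x \<in> D"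
      using \<phi>_eq[OF l] \<phi>_Y0 X.AE_X0
      by eventually_elim (simp add: D_def in_A hG)
    ultimately show "determined_by \<nu> \<eta> \<phi> (\<lambda>x. a (h (r n)) x \<in> A)"
      by (auto simp: determined_by_def)
  next
    show "AE x in \<nu>. \<forall>\<^sub>F n in sequentially. (a (h (r n)) x \<in> A) = (\<phi> (a g x) \<in> B)"
      using r X.AE_X0 by eventually_elim (simp add: in_A g)
  qed
qed

section \<open>The translation action on codes\<close>

lemma (in finite_measure) measurable_measure_section:
  assumes P: "Measurable.pred (N \<Otimes>\<^sub>M M) P"
  shows "(\<lambda>x. measure M {g \<in> space M. P (x, g)}) \<in> borel_measurable N"
proof -
  define Q where "Q = {z \<in> space (N \<Otimes>\<^sub>M M). P z}"
  have Q: "Q \<in> sets (N \<Otimes>\<^sub>M M)" unfolding Q_def using P by measurable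
  have "(\<lambda>x. enn2real (emeasure M (Pair x -` Q))) \<in> borel_measurable N"
    using measurable_emeasure_Pair[OF Q] by measurable
  moreover have "enn2real (emeasure M (Pair x -` Q)) = measure M {g \<in> space M. P (x, g)}"
    if "x \<in> space N" for x
  proof -
    have "Pair x -` Q = {g \<in> space M. P (x, g)}" using that by (auto simp: Q_def space_pair_measure)
    then show ?thesis by (simp add: measure_def)
  qed
  ultimately show ?thesis by (subst measurable_cong) (auto simp: measure_def)
qed

text \<open>In the application \<open>m\<close> is a finite measure with the null sets of Haar measure. Finiteness makes
  the distances between sets real numbers; of the invariance of Haar measure only the invariance of
  the null sets under left translation is retained.\<close>

locale coded_group = lcsc_group G T + finite_measure m for G (structure) and T and m +
  fixes C :: "nat \<Rightarrow> 'a set"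
  assumes sets_m [measurable_cong]: "sets m = sets (borel_of T)"
    and AE_translate: "\<And>k P. k \<in> carrier G \<Longrightarrow> AE x in m. P x \<Longrightarrow> AE x in m. P (k \<otimes> x)"
    and nontrivial: "\<not> (AE x in m. False)"
    and C_sets [measurable]: "\<And>k. C k \<in> sets m"
    and C_dense: "\<And>E \<epsilon>. E \<in> sets m \<Longrightarrow> 0 < \<epsilon> \<Longrightarrow> \<exists>k. measure m (sym_diff E (C k)) < \<epsilon>"
begin

lemma space_m [simp]: "space m = carrier G"
  using sets_eq_imp_space_eq[OF sets_m] topspace_eq by simp

abbreviation "code \<equiv> set_code m C"
abbreviation "decode \<equiv> set_decode m C"

text \<open>Since decoding inverts coding up to null sets and codes do not see null sets, the fixed points
  of decoding and recoding are exactly the codes; in this form the set of codes is visibly Borel.\<close>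

definition codes :: "(nat \<Rightarrow> real) set" where
  "codes = {z. code (decode z) = z}"

definition shift :: "'a \<Rightarrow> (nat \<Rightarrow> real) \<Rightarrow> (nat \<Rightarrow> real)" where
  "shift h = (\<lambda>z\<in>codes. code (\<lambda>i. pull (inv h) (decode z i)))"

lemma decode_sets: "decode z i \<in> sets m"
  by (rule set_decode_sets[OF C_sets])

lemma pull_sets_m: "k \<in> carrier G \<Longrightarrow> E \<in> sets m \<Longrightarrow> pull k E \<in> sets m"
  using pull_sets by (simp add: sets_m)

lemma decode_code: "(\<And>i. E i \<in> sets m) \<Longrightarrow> AE g in m. g \<in> decode (code E) i \<longleftrightarrow> g \<in> E i"
  by (rule set_decode_code[OF finite_measure_axioms C_sets C_dense])

lemma code_in_codes:
  assumes "\<And>i. E i \<in> sets m"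
  shows "code E \<in> codes"
  unfolding codes_def mem_Collect_eq
  by (rule set_code_cong_AE[OF decode_sets assms C_sets decode_code[OF assms]])

text \<open>Decoding recovers each \<open>E i\<close> up to a null set, and left translation preserves null sets.\<close>

lemma shift_code:
  assumes k: "k \<in> carrier G" and E: "\<And>i. E i \<in> sets m"
  shows "shift k (code E) = code (\<lambda>i. pull (inv k) (E i))"
proof -
  have "code (\<lambda>i. pull (inv k) (decode (code E) i)) = code (\<lambda>i. pull (inv k) (E i))"
  proof (rule set_code_cong_AE)
    fix i
    show "AE g in m. g \<in> pull (inv k) (decode (code E) i) \<longleftrightarrow> g \<in> pull (inv k) (E i)"
      using AE_translate[OF inv_closed[OF k] decode_code[of E i, OF E]] by (auto simp: pull_def)
  qed (use k E decode_sets in \<open>auto intro!: pull_sets_m\<close>)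
  then show ?thesis using code_in_codes[OF E] by (simp add: shift_def)
qed

lemma shift_in_codes: "k \<in> carrier G \<Longrightarrow> z \<in> codes \<Longrightarrow> shift k z \<in> codes"
  unfolding shift_def by (simp add: code_in_codes pull_sets_m decode_sets)

lemma codes_eq: "z \<in> codes \<Longrightarrow> code (decode z) = z"
  by (simp add: codes_def)

lemma shift_mult:
  assumes h: "h \<in> carrier G" and k: "k \<in> carrier G" and z: "z \<in> codes"
  shows "shift (h \<otimes> k) z = shift h (shift k z)"
proof -
  have "shift h (shift k z) = code (\<lambda>i. pull (inv h) (pull (inv k) (decode z i)))"
    using h k z by (simp add: shift_def[of k] shift_code pull_sets_m decode_sets)
  also have "(\<lambda>i. pull (inv h) (pull (inv k) (decode z i))) = (\<lambda>i. pull (inv (h \<otimes> k)) (decode z i))"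
    using h k by (auto simp: pull_def inv_mult_group m_assoc fun_eq_iff)
  finally show ?thesis using z by (simp add: shift_def)
qed

lemma shift_one: "z \<in> codes \<Longrightarrow> shift \<one> z = z"
proof -
  assume z: "z \<in> codes"
  have "pull (inv \<one>) (decode z i) = decode z i" for i
    using sets.sets_into_space[OF decode_sets[of z i]] by (auto simp: pull_def)
  then show "shift \<one> z = z" using z by (simp add: shift_def codes_eq)
qed

lemma group_action_shift: "group_action G codes shift"
proof -
  have Bij: "shift k \<in> Bij codes" if k: "k \<in> carrier G" for k
  proof -
    have "bij_betw (shift k) codes codes"
    proof (rule bij_betw_byWitness[where f'="shift (inv k)"])
      show "\<forall>z\<in>codes. shift (inv k) (shift k z) = z" "\<forall>z\<in>codes. shift k (shift (inv k) z) = z"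
        using k shift_one by (auto simp flip: shift_mult)
    qed (use k shift_in_codes in auto)
    then show ?thesis by (simp add: Bij_def shift_def)
  qed
  have "group_hom G (BijGroup codes) shift"
  proof (rule group_hom.intro)
    show "group_hom_axioms G (BijGroup codes) shift"
    proof
      show "shift \<in> hom G (BijGroup codes)"
      proof (rule homI)
        fix h k assume hk: "h \<in> carrier G" "k \<in> carrier G"
        have "shift (h \<otimes> k) = compose codes (shift h) (shift k)"
          using hk Bij[of "h \<otimes> k"]
          by (intro extensionalityI[of _ codes]) (auto simp: Bij_def compose_def shift_mult)
        then show "shift (h \<otimes> k) = shift h \<otimes>\<^bsub>BijGroup codes\<^esub> shift k"
          using Bij hk by (simp add: BijGroup_def)
      qed (simp add: Bij BijGroup_def)
    qed
  qed (simp_all add: group_BijGroup is_group)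
  then show ?thesis by (rule group_action.intro)
qed

text \<open>Each coordinate of the code is the measure of a section.\<close>

lemma code_measurable:
  assumes "\<And>i. Measurable.pred (N \<Otimes>\<^sub>M m) (\<lambda>(x, g). g \<in> E x i)" and E: "\<And>x i. x \<in> space N \<Longrightarrow> E x i \<subseteq> carrier G"
  shows "(\<lambda>x. code (E x)) \<in> borel_measurable N"
proof (rule measurable_coordinatewise_then_product)
  fix n
  obtain i k where ik: "prod_decode n = (i, k)" by (cases "prod_decode n")
  note assms(1)[measurable]
  have "Measurable.pred (N \<Otimes>\<^sub>M m) (\<lambda>z. (case z of (x, g) \<Rightarrow> g \<in> E x i) \<noteq> (snd z \<in> C k))"
    by measurable
  then have "(\<lambda>x. measure m {g \<in> space m. (g \<in> E x i) \<noteq> (g \<in> C k)}) \<in> borel_measurable N"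
    by (drule_tac measurable_measure_section) simp
  moreover have "{g \<in> space m. (g \<in> E x i) \<noteq> (g \<in> C k)} = sym_diff (E x i) (C k)" if "x \<in> space N" for x
    using E[OF that, of i] sets.sets_into_space[OF C_sets[of k]] by auto
  ultimately show "(\<lambda>x. code (E x) n) \<in> borel_measurable N"
    by (subst measurable_cong[where g="\<lambda>x. measure m {g \<in> space m. (g \<in> E x i) \<noteq> (g \<in> C k)}"])
       (auto simp: set_code_def ik)
qed

lemma decode_subset: "decode z i \<subseteq> carrier G"
  using sets.sets_into_space[OF decode_sets] by simp

lemma codes_sets: "codes \<in> sets borel"
proof -
  have meas: "(\<lambda>z. code (decode z)) \<in> borel_measurable borel"
    by (rule code_measurable[OF set_decode_measurable[OF C_sets] decode_subset])
  have "(\<lambda>z. code (decode z) n) \<in> borel_measurable borel" for n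
    by (rule measurable_compose[OF meas measurable_sequence_component])
  then have "{z \<in> space borel. code (decode z) n = z n} \<in> sets borel" for n
    by (intro borel_measurable_eq measurable_sequence_component)
  then have "{z \<in> space borel. \<forall>n. code (decode z) n = z n} \<in> sets borel"
    by (rule sets.sets_Collect_countable_All)
  also have "{z \<in> space borel. \<forall>n. code (decode z) n = z n} = codes"
    by (auto simp: codes_def fun_eq_iff)
  finally show ?thesis .
qed

lemma pull_decode_measurable:
  assumes f: "f \<in> measurable N (borel_of T)" and u: "u \<in> measurable N borel"
  shows "Measurable.pred (N \<Otimes>\<^sub>M m) (\<lambda>(x, g). g \<in> pull (inv (f x)) (decode (u x) i))"
proof -
  have "(\<lambda>z. (u (fst z), inv (f (fst z)) \<otimes> snd z)) \<in> measurable (N \<Otimes>\<^sub>M m) (borel \<Otimes>\<^sub>M m)"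
  proof (rule measurable_Pair)
    have "(\<lambda>z. (inv (f (fst z)), snd z)) \<in> measurable (N \<Otimes>\<^sub>M m) (borel_of T \<Otimes>\<^sub>M borel_of T)"
      using measurable_compose[OF measurable_compose[OF measurable_fst f] measurable_inv]
        measurable_snd[of N m] by (intro measurable_Pair) (auto cong: measurable_cong_sets[OF refl sets_m])
    from measurable_compose[OF this measurable_mult]
    show "(\<lambda>z. inv (f (fst z)) \<otimes> snd z) \<in> measurable (N \<Otimes>\<^sub>M m) m"
      by (simp cong: measurable_cong_sets[OF refl sets_m])
  qed (rule measurable_compose[OF measurable_fst u])
  from measurable_compose[OF this set_decode_measurable[OF C_sets, where i=i]]
  have "Measurable.pred (N \<Otimes>\<^sub>M m) (\<lambda>z. inv (f (fst z)) \<otimes> snd z \<in> decode (u (fst z)) i)"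
    by simp
  then show ?thesis
    by (subst measurable_cong[where g="\<lambda>z. inv (f (fst z)) \<otimes> snd z \<in> decode (u (fst z)) i"])
       (auto simp: pull_def space_pair_measure)
qed

lemma shift_measurable:
  "(\<lambda>(h, z). shift h z) \<in> measurable (borel_of T \<Otimes>\<^sub>M restrict_space borel codes) (restrict_space borel codes)"
proof (rule measurable_restrict_space2)
  let ?N = "borel_of T \<Otimes>\<^sub>M restrict_space borel codes"
  have "fst \<in> measurable ?N (borel_of T)" by simp
  moreover have "snd \<in> measurable ?N borel"
    by (rule measurable_compose[OF measurable_snd]) (rule measurable_restrict_space1, simp)
  ultimately have "(\<lambda>x. code (\<lambda>i. pull (inv (fst x)) (decode (snd x) i))) \<in> borel_measurable ?N"
    by (intro code_measurable pull_decode_measurable) (auto simp: pull_def)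
  then show "(\<lambda>(h, z). shift h z) \<in> borel_measurable ?N"
    by (subst measurable_cong[where g="\<lambda>x. code (\<lambda>i. pull (inv (fst x)) (decode (snd x) i))"])
       (auto simp: shift_def space_pair_measure space_restrict_space)
  show "(\<lambda>(h, z). shift h z) \<in> space ?N \<rightarrow> codes"
    by (auto simp: space_pair_measure space_restrict_space topspace_eq shift_in_codes)
qed

end

text \<open>Haar measure is sigma-finite, hence has a positive integrable density to a finite measure with
  the same null sets, and the Borel sets are countably generated.\<close>

lemma (in haar_group) ex_coded_group: "\<exists>m C. coded_group G T m C"
proof -
  obtain w where w[measurable]: "w \<in> borel_measurable \<mu>" and w_fin: "integral\<^sup>N \<mu> w \<noteq> \<infinity>"
    and w_pos: "\<And>x. x \<in> space \<mu> \<Longrightarrow> 0 < w x \<and> w x < \<infinity>"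
    using haar.Ex_finite_integrable_function by blast
  define m where "m = density \<mu> w"
  have sets_m: "sets m = sets (borel_of T)" by (simp add: m_def sets_haar)
  have space_m: "space m = carrier G" by (simp add: m_def)
  have AE_m: "(AE x in m. P x) \<longleftrightarrow> (AE x in \<mu>. P x)" for P
  proof -
    have "(AE x in m. P x) \<longleftrightarrow> (AE x in \<mu>. 0 < w x \<longrightarrow> P x)"
      unfolding m_def by (rule AE_density) measurable
    also have "\<dots> \<longleftrightarrow> (AE x in \<mu>. P x)" using w_pos by (intro AE_cong) auto
    finally show ?thesis .
  qed
  have fin: "finite_measure m"
  proof
    have "emeasure m (space m) = integral\<^sup>N \<mu> w"
      unfolding m_def using sets.top[of \<mu>] by (subst emeasure_density) (auto intro!: nn_integral_cong)
    then show "emeasure m (space m) \<noteq> \<infinity>" using w_fin by simp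
  qed
  obtain \<B> where \<B>: "countable \<B>" "\<And>V. V \<in> \<B> \<Longrightarrow> openin T V"
    "\<And>U x. openin T U \<Longrightarrow> x \<in> U \<Longrightarrow> \<exists>V\<in>\<B>. x \<in> V \<and> V \<subseteq> U"
    using second_countable unfolding second_countable_def by metis
  have "sigma_sets (topspace T) {U. openin T U} = sigma_sets (topspace T) \<B>"
  proof (rule sigma_sets_eqI)
    fix U assume "U \<in> {U. openin T U}"
    then have "U = \<Union>{V \<in> \<B>. V \<subseteq> U}" using \<B>(3) by blast
    also have "\<dots> \<in> sigma_sets (topspace T) \<B>"
      using \<B>(1) by (intro sigma_sets_UNION) (auto intro: countable_subset[of _ \<B>])
    finally show "U \<in> sigma_sets (topspace T) \<B>" .
  qed (use \<B>(2) in auto)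
  then have "sets m = sigma_sets (space m) \<B>"
    by (simp add: sets_m sets_borel_of space_m topspace_eq)
  from countable_dense_family[OF fin \<B>(1) this]
  obtain C :: "nat \<Rightarrow> 'a set" where C: "\<And>k. C k \<in> sets m"
    "\<And>E \<epsilon>. E \<in> sets m \<Longrightarrow> 0 < \<epsilon> \<Longrightarrow> \<exists>k. measure m (sym_diff E (C k)) < \<epsilon>" by blast
  have translate: "AE x in m. P (k \<otimes> x)" if k: "k \<in> carrier G" and P: "AE x in m. P x" for k P
  proof -
    have "AE x in \<mu>. P x" using P AE_m by simp
    then obtain N where N: "N \<in> null_sets \<mu>" "{x \<in> space \<mu>. \<not> P x} \<subseteq> N"
      by (auto simp: eventually_ae_filter)
    have "N \<in> sets (borel_of T)" using N(1) by (auto simp: sets_haar)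
    then have "pull k N \<in> null_sets \<mu>"
      using N(1) emeasure_pull[OF k] pull_sets[OF k] by (auto simp: null_sets_def sets_haar)
    then have "AE x in \<mu>. x \<notin> pull k N" by (rule AE_not_in)
    then have "AE x in \<mu>. P (k \<otimes> x)"
      using AE_space
    proof eventually_elim
      case (elim x)
      then have "k \<otimes> x \<notin> N" "k \<otimes> x \<in> space \<mu>" using k by (auto simp: pull_def)
      then show ?case using N(2) by auto
    qed
    then show ?thesis using AE_m by simp
  qed
  have "\<not> (AE x in \<mu>. False)"
  proof
    assume "AE x in \<mu>. False"
    then have "emeasure \<mu> (space \<mu>) = 0" using sets.top[of \<mu>] by (subst (asm) AE_iff_null) auto
    then show False using left_haar by (simp add: left_haar_measure_def)
  qed
  then have "coded_group G T m C"
    using fin sets_m translate C AE_m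
    by (intro coded_group.intro coded_group_axioms.intro lcsc_group_axioms) auto
  then show ?thesis by blast
qed

section \<open>Codes of orbits\<close>

locale coded_action = coded_group G T m C + X: topological_quasi_invariant_space G T M X\<^sub>0 a
  for G (structure) and T and m and C and M :: "'x measure" and X\<^sub>0 and a +
  fixes A :: "nat \<Rightarrow> 'x set"
  assumes A_sets: "\<And>i. A i \<in> sets M"
begin

text \<open>The set of those \<open>g\<close> for which \<open>x\<close> lies in \<open>g (A i)\<close>. The inverse turns the action on
  \<open>x\<close> into left translation, under which Haar null sets are invariant. Points outside \<open>X\<^sub>0\<close> get the
  empty set.\<close>

definition trace :: "'x \<Rightarrow> nat \<Rightarrow> 'a set" where
  "trace x i = {g \<in> carrier G. x \<in> X\<^sub>0 \<and> a (inv g) x \<in> A i}"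

definition orbit_code :: "'x \<Rightarrow> nat \<Rightarrow> real" where
  "orbit_code x = code (trace x)"

lemma trace_subset: "trace x i \<subseteq> carrier G"
  by (auto simp: trace_def)

lemma trace_measurable: "Measurable.pred (M \<Otimes>\<^sub>M m) (\<lambda>(x, g). g \<in> trace x i)"
proof -
  define Q where "Q = {(t, x). t \<in> topspace T \<and> x \<in> X\<^sub>0 \<and> a t x \<in> A i}"
  have Q: "Q \<in> sets (borel_of T \<Otimes>\<^sub>M M)"
    unfolding Q_def by (rule X.action_graph_sets[OF A_sets])
  have "snd \<in> measurable (M \<Otimes>\<^sub>M m) (borel_of T)"
    using measurable_snd[of M m] by (simp cong: measurable_cong_sets[OF refl sets_m])
  then have "(\<lambda>z. (inv (snd z), fst z)) \<in> measurable (M \<Otimes>\<^sub>M m) (borel_of T \<Otimes>\<^sub>M M)"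
    by (intro measurable_Pair measurable_compose[OF _ measurable_inv] measurable_fst)
  from measurable_sets[OF this Q]
  have "(\<lambda>z. (inv (snd z), fst z)) -` Q \<inter> space (M \<Otimes>\<^sub>M m) \<in> sets (M \<Otimes>\<^sub>M m)" .
  also have "(\<lambda>z. (inv (snd z), fst z)) -` Q \<inter> space (M \<Otimes>\<^sub>M m)
      = {z \<in> space (M \<Otimes>\<^sub>M m). case z of (x, g) \<Rightarrow> g \<in> trace x i}"
    by (auto simp: Q_def trace_def space_pair_measure topspace_eq)
  finally show ?thesis by (simp add: pred_def)
qed

lemma trace_sets:
  assumes "x \<in> space M"
  shows "trace x i \<in> sets m"
proof -
  note trace_measurable[measurable]
  have [measurable]: "x \<in> space M" by fact
  have "{g \<in> space m. case (x, g) of (x, g) \<Rightarrow> g \<in> trace x i} \<in> sets m" by measurable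
  moreover have "{g \<in> space m. case (x, g) of (x, g) \<Rightarrow> g \<in> trace x i} = trace x i"
    using trace_subset by auto
  ultimately show ?thesis by simp
qed

lemma trace_sets_X0: "x \<in> X\<^sub>0 \<Longrightarrow> trace x i \<in> sets m"
  using trace_sets X.X0_subset by auto

lemma orbit_code_measurable [measurable]: "orbit_code \<in> borel_measurable M"
proof -
  have "(\<lambda>x. code (trace x)) \<in> borel_measurable M"
    by (rule code_measurable[OF trace_measurable trace_subset])
  then show ?thesis by (simp add: orbit_code_def[abs_def])
qed

lemma orbit_code_in_codes: "x \<in> X\<^sub>0 \<Longrightarrow> orbit_code x \<in> codes"
  unfolding orbit_code_def by (rule code_in_codes) (rule trace_sets_X0)

text \<open>The trace of \<open>h x\<close> is the left translate by \<open>h\<close> of the trace of \<open>x\<close>; this holds for every point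
  and not only almost everywhere.\<close>

lemma orbit_code_act:
  assumes h: "h \<in> carrier G" and x: "x \<in> X\<^sub>0"
  shows "orbit_code (a h x) = shift h (orbit_code x)"
proof -
  have "trace (a h x) i = pull (inv h) (trace x i)" for i
  proof -
    have "a (inv g) (a h x) = a (inv (inv h \<otimes> g)) x" if "g \<in> carrier G" for g
      using X.act_mult[of "inv g" h x] h x that by (simp add: inv_mult_group)
    then show ?thesis using h x X.act_mem by (auto simp: trace_def pull_def)
  qed
  then have "trace (a h x) = (\<lambda>i. pull (inv h) (trace x i))" by (rule ext)
  then have "orbit_code (a h x) = code (\<lambda>i. pull (inv h) (trace x i))"
    by (simp add: orbit_code_def)
  then show ?thesis
    using shift_code[OF h trace_sets_X0[OF x]] by (simp add: orbit_code_def)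
qed

definition model :: "(nat \<Rightarrow> real) measure" where
  "model = distr M borel orbit_code"

lemma sets_model [measurable_cong]: "sets model = sets borel" and space_model [simp]: "space model = UNIV"
  by (simp_all add: model_def)

lemma shift_elem_measurable:
  assumes h: "h \<in> carrier G"
  shows "shift h \<in> measurable (restrict_space borel codes) (restrict_space borel codes)"
proof -
  have "(\<lambda>z. (h, z)) \<in> measurable (restrict_space borel codes) (borel_of T \<Otimes>\<^sub>M restrict_space borel codes)"
    using h by (intro measurable_Pair) (auto simp: topspace_eq)
  from measurable_compose[OF this shift_measurable] show ?thesis by simp
qed

lemma restrict_model_cong: "sets (restrict_space model codes) = sets (restrict_space borel codes)"
  by (simp add: sets_restrict_space sets_model)

lemma null_model_iff:
  assumes "N \<in> sets borel"
  shows "emeasure model N = 0 \<longleftrightarrow> (AE x in M. orbit_code x \<notin> N)"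
proof -
  have "N \<in> null_sets model \<longleftrightarrow> (AE z in model. z \<notin> N)"
    using assms by (intro AE_iff_null_sets) (simp add: sets_model)
  also have "\<dots> \<longleftrightarrow> (AE x in M. orbit_code x \<notin> N)"
    unfolding model_def by (rule AE_distr_notin[OF orbit_code_measurable assms])
  finally show ?thesis using assms by (simp add: null_sets_def sets_model)
qed

text \<open>Quasi-invariance is inherited from \<open>M\<close>: a set of codes is null if and only if almost no point
  has its code there, and \<open>orbit_code\<close> intertwines the actions.\<close>

lemma topological_quasi_invariant_space_model:
  "topological_quasi_invariant_space G T model codes shift"
proof -
  interpret model: prob_space model
    unfolding model_def by (rule X.prob_space_distr) measurable
  interpret act: group_action G codes shift by (rule group_action_shift)
  have codes_model: "codes \<in> sets model" using codes_sets by (simp add: sets_model)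
  have "AE x in M. orbit_code x \<in> codes"
    using X.AE_X0 by eventually_elim (rule orbit_code_in_codes)
  then have conull: "AE x in model. x \<in> codes"
    unfolding model_def using codes_sets by (subst AE_distr_iff) auto
  have elem: "shift g \<in> measurable (restrict_space model codes) (restrict_space model codes)"
    if "g \<in> carrier G" for g
    using shift_elem_measurable[OF that] by (simp cong: measurable_cong_sets[OF restrict_model_cong restrict_model_cong])
  have null: "null_sets (distr (restrict_space model codes) (restrict_space model codes) (shift g)) =
        null_sets (restrict_space model codes)" if g: "g \<in> carrier G" for g
  proof -
    have iff: "emeasure (distr (restrict_space model codes) (restrict_space model codes) (shift g)) N = 0
        \<longleftrightarrow> emeasure (restrict_space model codes) N = 0" if N: "N \<in> sets (restrict_space model codes)" for N
    proof -
      let ?R = "restrict_space model codes"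
      have N': "N \<in> sets borel" "N \<subseteq> codes"
        using N codes_sets by (auto simp: restrict_model_cong sets_restrict_space_iff)
      define N1 where "N1 = shift g -` N \<inter> space ?R"
      have "N1 \<in> sets ?R" unfolding N1_def by (rule measurable_sets[OF elem[OF g] N])
      then have N1: "N1 \<in> sets borel" "N1 \<subseteq> codes"
        using codes_sets by (auto simp: restrict_model_cong sets_restrict_space_iff)
      have restr: "emeasure ?R D = emeasure model D" if "D \<subseteq> codes" for D
        using codes_model that by (intro emeasure_restrict_space) auto
      have "emeasure (distr ?R ?R (shift g)) N = emeasure model N1"
        using N elem[OF g] N1 by (simp add: emeasure_distr restr flip: N1_def)
      also have "\<dots> = 0 \<longleftrightarrow> (AE x in M. orbit_code x \<notin> N1)"
        by (rule null_model_iff[OF N1(1)])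
      also have "\<dots> \<longleftrightarrow> (AE x in M. orbit_code (a g x) \<notin> N)"
      proof -
        have same: "AE x in M. orbit_code x \<in> N1 \<longleftrightarrow> orbit_code (a g x) \<in> N"
          using X.AE_X0 by eventually_elim
            (auto simp: N1_def orbit_code_act[OF g] space_restrict_space orbit_code_in_codes)
        show ?thesis
        proof
          assume "AE x in M. orbit_code x \<notin> N1"
          with same show "AE x in M. orbit_code (a g x) \<notin> N" by eventually_elim auto
        next
          assume "AE x in M. orbit_code (a g x) \<notin> N"
          with same show "AE x in M. orbit_code x \<notin> N1" by eventually_elim auto
        qed
      qed
      also have "\<dots> \<longleftrightarrow> (AE x in M. orbit_code x \<notin> N)"
      proof
        assume "AE x in M. orbit_code (a g x) \<notin> N"
        from X.AE_act[OF inv_closed[OF g] this] X.AE_X0 show "AE x in M. orbit_code x \<notin> N"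
          by eventually_elim (simp add: X.act_inv[OF g])
      qed (rule X.AE_act[OF g])
      also have "\<dots> \<longleftrightarrow> emeasure ?R N = 0"
        using null_model_iff[OF N'(1)] restr[OF N'(2)] by simp
      finally show ?thesis .
    qed
    then show ?thesis by (auto simp: null_sets_def)
  qed
  have joint: "(\<lambda>(g, x). shift g x)
      \<in> measurable (borel_of T \<Otimes>\<^sub>M restrict_space model codes) (restrict_space model codes)"
    using shift_measurable
    by (simp cong: measurable_cong_sets[OF sets_pair_measure_cong[OF refl restrict_model_cong] restrict_model_cong])
  show ?thesis
    by unfold_locales
       (use codes_model conull elem null joint standard_borel_sequences in
         \<open>simp_all add: model.prob_eq_1 standard_borel_cong[OF sets_model]\<close>)
qed

lemma equivariant_orbit_code: "equivariant_map G M a model shift orbit_code"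
proof -
  have "AE x in M. orbit_code (a g x) = shift g (orbit_code x)" if "g \<in> carrier G" for g
    using X.AE_X0 by eventually_elim (rule orbit_code_act[OF that])
  moreover have "distr M model orbit_code = model"
    unfolding model_def by (rule distr_cong) auto
  ultimately show ?thesis
    by (simp add: equivariant_map_def cong: measurable_cong_sets[OF refl sets_model])
qed

text \<open>By Fubini there is one \<open>g\<close> such that, for almost every \<open>x\<close>, the decoded trace of \<open>x\<close> contains \<open>g\<close>
  if and only if \<open>g\<inverse> x \<in> A i\<close>. Substituting \<open>g x\<close> for \<open>x\<close> turns the latter into \<open>x \<in> A i\<close> and the code of \<open>x\<close>
  into its shift by \<open>g\<close>.\<close>

lemma set_determined_by_orbit_code: "determined_by M borel orbit_code (\<lambda>x. x \<in> A i)"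
proof -
  interpret P: pair_sigma_finite M m
    by (intro pair_sigma_finite.intro sigma_finite_measure_axioms X.sigma_finite_measure_axioms)
  define R where "R x g \<longleftrightarrow> (g \<in> decode (orbit_code x) i \<longleftrightarrow> g \<in> trace x i)" for x g
  have R_meas: "{z \<in> space (M \<Otimes>\<^sub>M m). R (fst z) (snd z)} \<in> sets (M \<Otimes>\<^sub>M m)"
  proof -
    have "(\<lambda>z. (orbit_code (fst z), snd z)) \<in> measurable (M \<Otimes>\<^sub>M m) (borel \<Otimes>\<^sub>M m)"
      by measurable
    from measurable_compose[OF this set_decode_measurable[OF C_sets, where i=i]]
    have [measurable]: "Measurable.pred (M \<Otimes>\<^sub>M m) (\<lambda>z. snd z \<in> decode (orbit_code (fst z)) i)"
      by simp
    have [measurable]: "Measurable.pred (M \<Otimes>\<^sub>M m) (\<lambda>z. snd z \<in> trace (fst z) i)"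
      using trace_measurable[of i] by (simp add: case_prod_beta')
    show ?thesis unfolding R_def by measurable
  qed
  have "AE x in M. AE g in m. R x g"
    using AE_space
  proof eventually_elim
    case (elim x)
    show ?case
      unfolding R_def orbit_code_def by (rule decode_code[OF trace_sets[OF elim]])
  qed
  then have ae_g: "AE g in m. AE x in M. R x g"
    using P.AE_commute[OF R_meas] by simp
  have "\<exists>g\<in>space m. AE x in M. R x g"
  proof (rule ccontr)
    assume "\<not> ?thesis"
    with ae_g AE_space have "AE g in m. False" by (auto elim: eventually_elim2)
    with nontrivial show False by simp
  qed
  then obtain g where g: "g \<in> carrier G" and ae: "AE x in M. R x g" by auto
  define Q where "Q = {z \<in> codes. g \<in> decode (shift g z) i}"
  have "Q \<in> sets borel"
  proof -
    have "shift g \<in> measurable (restrict_space borel codes) borel"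
      using shift_elem_measurable[OF g] by (simp add: measurable_restrict_space2_iff)
    then have "(\<lambda>z. (shift g z, g)) \<in> measurable (restrict_space borel codes) (borel \<Otimes>\<^sub>M m)"
      using g by (intro measurable_Pair) auto
    from measurable_compose[OF this set_decode_measurable[OF C_sets, where i=i]]
    have "{z \<in> space (restrict_space borel codes). g \<in> decode (shift g z) i} \<in> sets (restrict_space borel codes)"
      by (simp add: pred_def)
    then show ?thesis
      using codes_sets by (simp add: Q_def space_restrict_space sets_restrict_space_iff)
  qed
  moreover have "AE x in M. x \<in> A i \<longleftrightarrow> orbit_code x \<in> Q"
    using X.AE_act[OF g ae] X.AE_X0
    by eventually_elim
       (use g X.act_mem[OF g] in \<open>auto simp: R_def Q_def trace_def orbit_code_act orbit_code_in_codes X.act_inv\<close>)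
  ultimately show ?thesis by (auto simp: determined_by_def)
qed

text \<open>A coordinate of the code is the average over \<open>g\<close> of indicator functions that are determined
  by \<open>\<psi>\<close> for each \<open>g\<close>.\<close>

lemma orbit_code_factors:
  assumes \<psi>: "\<psi> \<in> measurable M N"
    and det: "\<And>g i. g \<in> carrier G \<Longrightarrow> determined_by M N \<psi> (\<lambda>x. a g x \<in> A i)"
  shows "\<exists>\<rho>\<in>borel_measurable N. AE x in M. orbit_code x = \<rho> (\<psi> x)"
proof -
  have "\<exists>r\<in>borel_measurable N. AE x in M. orbit_code x n = r (\<psi> x)" for n
  proof -
    obtain i k where ik: "prod_decode n = (i, k)" by (cases "prod_decode n")
    define W where "W = {z \<in> space (m \<Otimes>\<^sub>M M). (fst z \<in> trace (snd z) i) \<noteq> (fst z \<in> C k)}"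
    have "(\<lambda>z. (snd z, fst z)) \<in> measurable (m \<Otimes>\<^sub>M M) (M \<Otimes>\<^sub>M m)" by measurable
    from measurable_compose[OF this trace_measurable[of i]]
    have [measurable]: "Measurable.pred (m \<Otimes>\<^sub>M M) (\<lambda>z. fst z \<in> trace (snd z) i)" by simp
    have W: "W \<in> sets (m \<Otimes>\<^sub>M M)" unfolding W_def by measurable
    have "AE g in m. determined_by M N \<psi> (\<lambda>x. (g, x) \<in> W)"
    proof (rule AE_I2)
      fix g assume "g \<in> space m"
      then have g: "g \<in> carrier G" by simp
      obtain D where D: "D \<in> sets N" "AE x in M. a (inv g) x \<in> A i \<longleftrightarrow> \<psi> x \<in> D"
        using det[OF inv_closed[OF g], of i] by (auto simp: determined_by_def)
      show "determined_by M N \<psi> (\<lambda>x. (g, x) \<in> W)"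
        unfolding determined_by_def
      proof
        show "(if g \<in> C k then space N - D else D) \<in> sets N" using D(1) by auto
        show "AE x in M. (g, x) \<in> W \<longleftrightarrow> \<psi> x \<in> (if g \<in> C k then space N - D else D)"
          using D(2) X.AE_X0 AE_space
          by eventually_elim
             (use g measurable_space[OF \<psi>] in \<open>auto simp: W_def trace_def space_pair_measure\<close>)
      qed
    qed
    from determined_by_average[OF X.prob_space_axioms finite_measure_axioms \<psi> W this]
    obtain r where r: "r \<in> borel_measurable N" "AE x in M. measure m {g \<in> space m. (g, x) \<in> W} = r (\<psi> x)"
      by blast
    have "AE x in M. orbit_code x n = r (\<psi> x)"
      using r(2) AE_space
    proof eventually_elim
      case (elim x)
      have "{g \<in> space m. (g, x) \<in> W} = sym_diff (trace x i) (C k)"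
        using elim(2) trace_subset[of x i] sets.sets_into_space[OF C_sets[of k]]
        by (auto simp: W_def space_pair_measure)
      then show ?case using elim(1) by (simp add: orbit_code_def set_code_def ik)
    qed
    then show ?thesis using r(1) by blast
  qed
  then obtain r where r: "\<And>n. r n \<in> borel_measurable N" "\<And>n. AE x in M. orbit_code x n = r n (\<psi> x)"
    by metis
  have "(\<lambda>y n. r n y) \<in> borel_measurable N"
    by (rule measurable_coordinatewise_then_product) (rule r(1))
  moreover have "AE x in M. \<forall>n. orbit_code x n = r n (\<psi> x)"
    using r(2) by (simp add: AE_all_countable)
  then have "AE x in M. orbit_code x = (\<lambda>n. r n (\<psi> x))"
    by eventually_elim auto
  ultimately show ?thesis by (intro bexI[of _ "\<lambda>y n. r n y"])
qed

end

section \<open>The extended action\<close>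

text \<open>The sets where the two compositions are the identity are conull, measurable, and mapped
  bijectively onto each other.\<close>

lemma isomorphism_mod_nullI:
  assumes M: "standard_borel M" and N: "standard_borel N"
    and \<rho>: "\<rho> \<in> measurable M N" "distr M N \<rho> = N" and \<sigma>: "\<sigma> \<in> measurable N M"
    and inv: "AE y in M. \<sigma> (\<rho> y) = y" "AE z in N. \<rho> (\<sigma> z) = z"
  shows "isomorphism_mod_null M N \<rho>"
proof -
  define A where "A = {y \<in> space M. \<sigma> (\<rho> y) = y}"
  define B where "B = {z \<in> space N. \<rho> (\<sigma> z) = z}"
  have A: "A \<in> sets M"
    unfolding A_def by (rule standard_borel_equalizer_sets[OF M measurable_compose[OF \<rho>(1) \<sigma>] measurable_ident_sets[OF refl]])
  have B: "B \<in> sets N"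
    unfolding B_def by (rule standard_borel_equalizer_sets[OF N measurable_compose[OF \<sigma> \<rho>(1)] measurable_ident_sets[OF refl]])
  have null: "space M - A \<in> null_sets M" "space N - B \<in> null_sets N"
  proof -
    have "AE y in M. y \<notin> space M - A" using inv(1) by eventually_elim (auto simp: A_def)
    then show "space M - A \<in> null_sets M" using A by (subst AE_iff_null_sets) auto
    have "AE y in N. y \<notin> space N - B" using inv(2) by eventually_elim (auto simp: B_def)
    then show "space N - B \<in> null_sets N" using B by (subst AE_iff_null_sets) auto
  qed
  have bij: "bij_betw \<rho> A B"
    by (rule bij_betw_byWitness[where f'=\<sigma>])
       (use measurable_space[OF \<rho>(1)] measurable_space[OF \<sigma>] in \<open>auto simp: A_def B_def\<close>)
  have "the_inv_into A \<rho> z = \<sigma> z" if "z \<in> B" for z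
  proof (rule the_inv_into_f_eq)
    show "inj_on \<rho> A" using bij by (simp add: bij_betw_def)
  qed (use that measurable_space[OF \<sigma>] in \<open>auto simp: A_def B_def\<close>)
  moreover have "\<sigma> \<in> measurable (restrict_space N B) (restrict_space M A)"
    by (intro measurable_restrict_space2 measurable_restrict_space1 \<sigma>)
       (use measurable_space[OF \<sigma>] in \<open>auto simp: A_def B_def space_restrict_space\<close>)
  ultimately have "the_inv_into A \<rho> \<in> measurable (restrict_space N B) (restrict_space M A)"
    by (subst measurable_cong[where g=\<sigma>]) (auto simp: space_restrict_space)
  then show ?thesis
    unfolding isomorphism_mod_null_def using \<rho> A B null bij by blast
qed

text \<open>The coordinates of the embedded point \<open>\<iota> (\<phi> x)\<close> are measurable functions of \<open>\<Phi> x\<close>. Where these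
  functions leave the image of \<open>\<iota>\<close>, which happens on a null set only, a constant value is used.\<close>

lemma standard_borel_determined_retraction:
  fixes \<Phi> :: "'x \<Rightarrow> 'z"
  assumes N: "standard_borel N" and ne: "space N \<noteq> {}"
    and \<phi>: "\<phi> \<in> measurable M N" and \<Phi>: "\<Phi> \<in> measurable M K"
    and \<iota>: "\<iota> \<in> borel_measurable N" "\<iota> ` space N \<in> sets borel"
    and \<theta>: "\<theta> \<in> measurable (restrict_space borel (\<iota> ` space N)) N" "\<And>y. y \<in> space N \<Longrightarrow> \<theta> (\<iota> y) = y"
    and det: "\<And>k q. q \<in> \<rat> \<Longrightarrow> determined_by M K \<Phi> (\<lambda>x. (\<iota> (\<phi> x) :: nat \<Rightarrow> real) k < q)"
  shows "\<exists>\<sigma>\<in>measurable K N. AE x in M. \<sigma> (\<Phi> x) = \<phi> x"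
proof -
  obtain s where s: "s \<in> borel_measurable K" "AE x in M. \<iota> (\<phi> x) = s (\<Phi> x)"
    using determined_by_real_sequence[of M K \<Phi> "\<lambda>x. \<iota> (\<phi> x)", OF det] by blast
  obtain y0 where y0: "y0 \<in> space N" using ne by blast
  define J where "J = \<iota> ` space N"
  define \<sigma> where "\<sigma> z = (if s z \<in> J then \<theta> (s z) else y0)" for z
  have pre: "{z \<in> space K. s z \<in> J} \<in> sets K"
    using measurable_sets[OF s(1) \<iota>(2)] by (simp add: J_def vimage_def Int_def conj_commute)
  have "s \<in> measurable (restrict_space K {z. s z \<in> J}) (restrict_space borel J)"
    by (intro measurable_restrict_space2 measurable_restrict_space1 s(1)) (auto simp: space_restrict_space)
  from measurable_compose[OF this \<theta>(1)[folded J_def]]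
  have "\<sigma> \<in> measurable K N"
    unfolding \<sigma>_def measurable_If_restrict_space_iff[OF pre] using y0 by simp
  moreover have "AE x in M. \<sigma> (\<Phi> x) = \<phi> x"
    using s(2) AE_space
  proof eventually_elim
    case (elim x)
    have y: "\<phi> x \<in> space N" by (rule measurable_space[OF \<phi> elim(2)])
    then show ?case using elim(1)[symmetric] \<theta>(2)[OF y] by (auto simp: \<sigma>_def J_def)
  qed
  ultimately show ?thesis by blast
qed

theorem theorem2p8:
  fixes G :: "('g, 'm) monoid_scheme" and T :: "'g topology"
    and \<Gamma> \<Lambda> :: "'g set"
    and \<nu> :: "'x measure" and X\<^sub>0 :: "'x set" and a :: "'g \<Rightarrow> 'x \<Rightarrow> 'x"
    and \<eta> :: "'y measure" and Y\<^sub>0 :: "'y set" and b :: "'g \<Rightarrow> 'y \<Rightarrow> 'y"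
    and \<phi> :: "'x \<Rightarrow> 'y"
  assumes "lcsc_group G T"
    and "lattice_subgroup G T \<Gamma>"
    and "subgroup \<Lambda> G"
    and "T closure_of \<Lambda> = carrier G"
    and "\<Gamma> \<subseteq> \<Lambda>"
    and "commensurates G \<Lambda> \<Gamma>"
    and "topological_quasi_invariant_space G T \<nu> X\<^sub>0 a"
    and "contractive (G\<lparr>carrier := \<Gamma>\<rparr>) \<nu> X\<^sub>0 a"
    and "quasi_invariant_space (G\<lparr>carrier := \<Lambda>\<rparr>) \<eta> Y\<^sub>0 b"
    and "equivariant_map (G\<lparr>carrier := \<Gamma>\<rparr>) \<nu> a \<eta> b \<phi>"
  shows "\<exists>(\<eta>' :: (nat \<Rightarrow> real) measure) Y\<^sub>0' c \<phi>' \<rho>.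
           topological_quasi_invariant_space G T \<eta>' Y\<^sub>0' c \<and>
           equivariant_map G \<nu> a \<eta>' c \<phi>' \<and>
           equivariant_isomorphism (G\<lparr>carrier := \<Lambda>\<rparr>) \<eta> b \<eta>' c \<rho> \<and>
           (AE x in \<nu>. \<phi>' x = \<rho> (\<phi> x))"
proof -
  note lcsc = assms(1) and \<Lambda> = assms(3) and dense = assms(4) and X = assms(7) and Y = assms(9)
  interpret lcsc_group G T by fact
  interpret X: topological_quasi_invariant_space G T \<nu> X\<^sub>0 a by fact
  interpret Y: quasi_invariant_space "G\<lparr>carrier := \<Lambda>\<rparr>" \<eta> Y\<^sub>0 b by fact
  have \<Gamma>: "subgroup \<Gamma> G" using assms(2) by (simp add: lattice_subgroup_def)
  have \<Lambda>_equiv: "equivariant_map (G\<lparr>carrier := \<Lambda>\<rparr>) \<nu> a \<eta> b \<phi>"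
    by (rule contractive_equivariance_extends[OF is_group \<Gamma> \<Lambda> assms(5,6)
          X.quasi_invariant_space_axioms assms(8) Y assms(10)])
  then have \<phi>_meas: "\<phi> \<in> measurable \<nu> \<eta>" and \<eta>: "distr \<nu> \<eta> \<phi> = \<eta>"
    and \<phi>_eq: "\<And>l. l \<in> \<Lambda> \<Longrightarrow> AE x in \<nu>. \<phi> (a l x) = b l (\<phi> x)"
    by (auto simp: equivariant_map_def)
  obtain \<mu> where "left_haar_measure G T \<mu>"
    using assms(2) by (auto simp: lattice_subgroup_def finite_covolume_def)
  then interpret haar_group G T \<mu> by unfold_locales
  obtain m C where "coded_group G T m C" using ex_coded_group by blast
  then interpret coded_group G T m C .
  obtain \<iota> :: "'y \<Rightarrow> nat \<Rightarrow> real" and \<theta> where \<iota>: "\<iota> \<in> borel_measurable \<eta>" "\<iota> ` space \<eta> \<in> sets borel"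
    and \<theta>: "\<theta> \<in> measurable (restrict_space borel (\<iota> ` space \<eta>)) \<eta>" "\<And>y. y \<in> space \<eta> \<Longrightarrow> \<theta> (\<iota> y) = y"
    using standard_borel_embedding[OF Y.standard] by blast
  define q :: "nat \<Rightarrow> real" where "q = from_nat_into \<rat>"
  have q_range: "range q = \<rat>"
    unfolding q_def using countable_rat by (intro range_from_nat_into) auto
  \<comment> \<open>The rational cuts of all coordinates of \<open>\<iota>\<close>, enumerated by one index.\<close>
  define B where "B n = (case prod_decode n of (k, j) \<Rightarrow> {y \<in> space \<eta>. \<iota> y k < q j})" for n
  have B: "B n \<in> sets \<eta>" for n
  proof -
    obtain k j where kj: "prod_decode n = (k, j)" by (cases "prod_decode n")
    have [measurable]: "(\<lambda>y. \<iota> y k) \<in> borel_measurable \<eta>"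
      by (rule measurable_compose[OF \<iota>(1) measurable_sequence_component])
    have "{y \<in> space \<eta>. \<iota> y k < q j} \<in> sets \<eta>" by measurable
    then show ?thesis by (simp add: B_def kj)
  qed
  define A where "A n = \<phi> -` B n \<inter> space \<nu>" for n
  interpret coded_action G T m C \<nu> X\<^sub>0 a A
    by unfold_locales (simp add: A_def measurable_sets[OF \<phi>_meas B])
  have "determined_by \<nu> \<eta> \<phi> (\<lambda>x. a g x \<in> A n)" if g: "g \<in> carrier G" for g n
  proof (rule determined_by_cong)
    show "determined_by \<nu> \<eta> \<phi> (\<lambda>x. \<phi> (a g x) \<in> B n)"
      by (rule equivariant_factor_invariant[OF X \<Lambda> dense Y \<Lambda>_equiv g B])
    show "AE x in \<nu>. \<phi> (a g x) \<in> B n \<longleftrightarrow> a g x \<in> A n"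
      using X.AE_X0 by eventually_elim (use X.act_mem[OF g] X.X0_subset in \<open>auto simp: A_def\<close>)
  qed
  from orbit_code_factors[OF \<phi>_meas this]
  obtain \<rho> where \<rho>: "\<rho> \<in> borel_measurable \<eta>" "AE x in \<nu>. orbit_code x = \<rho> (\<phi> x)" by blast
  have "determined_by \<nu> borel orbit_code (\<lambda>x. \<iota> (\<phi> x) k < t)" if t: "t \<in> \<rat>" for k t
  proof -
    obtain j where j: "t = q j" using t q_range by (metis imageE)
    show ?thesis
    proof (rule determined_by_cong[OF set_determined_by_orbit_code[of "prod_encode (k, j)"]])
      show "AE x in \<nu>. x \<in> A (prod_encode (k, j)) \<longleftrightarrow> \<iota> (\<phi> x) k < t"
        using AE_space by eventually_elim (use measurable_space[OF \<phi>_meas] in \<open>auto simp: A_def B_def j\<close>)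
    qed
  qed
  from standard_borel_determined_retraction[OF Y.standard Y.not_empty \<phi>_meas orbit_code_measurable \<iota> \<theta> this]
  obtain \<sigma> where \<sigma>: "\<sigma> \<in> measurable borel \<eta>" "AE x in \<nu>. \<sigma> (orbit_code x) = \<phi> x" by blast
  have \<rho>_model: "\<rho> \<in> measurable \<eta> model" and \<sigma>_model: "\<sigma> \<in> measurable model \<eta>"
    using \<rho>(1) \<sigma>(1) by (simp_all cong: measurable_cong_sets[OF refl sets_model] measurable_cong_sets[OF sets_model refl])
  have model_\<rho>: "distr \<eta> model \<rho> = model"
  proof -
    have "distr \<eta> model \<rho> = distr (distr \<nu> \<eta> \<phi>) borel \<rho>"
      unfolding \<eta> by (rule distr_cong) (simp_all add: sets_model)
    also have "\<dots> = distr \<nu> borel (\<rho> \<circ> \<phi>)" by (rule distr_distr[OF \<rho>(1) \<phi>_meas])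
    also have "\<dots> = distr \<nu> borel orbit_code"
      by (rule distr_cong_AE) (use \<rho> \<phi>_meas in \<open>auto elim: eventually_mono\<close>)
    finally show ?thesis by (simp add: model_def)
  qed
  have standard_model: "standard_borel model"
    using standard_borel_sequences by (simp add: standard_borel_cong[OF sets_model])
  have "isomorphism_mod_null \<eta> model \<rho>"
  proof (rule isomorphism_mod_nullI[OF Y.standard standard_model \<rho>_model model_\<rho> \<sigma>_model])
    have "{y \<in> space \<eta>. \<sigma> (\<rho> y) = y} \<in> sets \<eta>"
      by (rule standard_borel_equalizer_sets[OF Y.standard measurable_compose[OF \<rho>_model \<sigma>_model] measurable_ident_sets[OF refl]])
    moreover have "AE x in \<nu>. \<sigma> (\<rho> (\<phi> x)) = \<phi> x"
      using \<rho>(2) \<sigma>(2) by eventually_elim simp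
    ultimately show "AE y in \<eta>. \<sigma> (\<rho> y) = y"
      using AE_distr_iff[OF \<phi>_meas, of "\<lambda>y. \<sigma> (\<rho> y) = y"] unfolding \<eta> by blast
    have "{z \<in> space borel. \<rho> (\<sigma> z) = z} \<in> sets borel"
      by (rule standard_borel_equalizer_sets[OF standard_borel_sequences measurable_compose[OF \<sigma>(1) \<rho>(1)] measurable_ident_sets[OF refl]])
    moreover have "AE x in \<nu>. \<rho> (\<sigma> (orbit_code x)) = orbit_code x"
      using \<rho>(2) \<sigma>(2) by eventually_elim simp
    ultimately show "AE z in model. \<rho> (\<sigma> z) = z"
      using AE_distr_iff[OF orbit_code_measurable, of "\<lambda>z. \<rho> (\<sigma> z) = z"] unfolding model_def by blast
  qed
  moreover have "AE y in \<eta>. \<rho> (b l y) = shift l (\<rho> y)" if l: "l \<in> \<Lambda>" for l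
  proof -
    have lG: "l \<in> carrier G" using l \<Lambda> by (meson subgroup.mem_carrier)
    \<comment> \<open>Total versions of the two actions, so that the set where \<open>\<rho>\<close> is equivariant is measurable.\<close>
    define bl where "bl y = (if y \<in> Y\<^sub>0 then b l y else y)" for y
    define sl where "sl z = (if z \<in> codes then shift l z else z)" for z
    have bl: "bl \<in> measurable \<eta> \<eta>"
      unfolding bl_def by (rule Y.measurable_total_act) (use l in simp)
    interpret model: topological_quasi_invariant_space G T model codes shift
      by (rule topological_quasi_invariant_space_model)
    have sl: "sl \<in> measurable model model"
      unfolding sl_def by (rule model.measurable_total_act[OF lG])
    have E: "{y \<in> space \<eta>. \<rho> (bl y) = sl (\<rho> y)} \<in> sets \<eta>"
      by (rule standard_borel_equalizer_sets[OF standard_model measurable_compose[OF bl \<rho>_model]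
            measurable_compose[OF \<rho>_model sl]])
    have \<phi>_Y0: "AE x in \<nu>. \<phi> x \<in> Y\<^sub>0"
      using Y.AE_X0 by (subst (asm) \<eta>[symmetric]) (rule AE_distrD[OF \<phi>_meas])
    have "AE x in \<nu>. \<rho> (bl (\<phi> x)) = sl (\<rho> (\<phi> x))"
      using \<rho>(2) X.AE_act[OF lG \<rho>(2)] \<phi>_eq[OF l] \<phi>_Y0 X.AE_X0
    proof eventually_elim
      case (elim x)
      then show ?case
        using orbit_code_act[OF lG elim(5)] orbit_code_in_codes[OF elim(5)] by (simp add: bl_def sl_def)
    qed
    then have "AE y in \<eta>. \<rho> (bl y) = sl (\<rho> y)"
      using AE_distr_iff[OF \<phi>_meas E] unfolding \<eta> by blast
    moreover have "AE y in \<eta>. \<rho> y \<in> codes"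
      using model.AE_X0 by (subst (asm) model_\<rho>[symmetric]) (rule AE_distrD[OF \<rho>_model])
    ultimately show ?thesis
      using Y.AE_X0 by eventually_elim (simp add: bl_def sl_def)
  qed
  ultimately have "equivariant_isomorphism (G\<lparr>carrier := \<Lambda>\<rparr>) \<eta> b model shift \<rho>"
    using \<rho>_model model_\<rho> by (simp add: equivariant_isomorphism_def equivariant_map_def)
  then show ?thesis
    using topological_quasi_invariant_space_model equivariant_orbit_code \<rho>(2) by blast
qed

end
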